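(* Let $E\subset\mathbb R$ be compact with $\dim_{\mathcal H}(E)>3/4$. Then the set of cross ratios of four-tuples of points of $E$, $$\mathrm{Cross}(E)=\left\{[x_1,x_2;x_3,x_4]=\frac{(x_3-x_1)(x_4-x_2)}{(x_3-x_2)(x_4-x_1)} : x_1,x_2,x_3,x_4\in E\right\}\subset\mathbb R,$$ (taken over those four-tuples for which the expression is defined) contains an open interval.
   Context: $\dim_{\mathcal H}$ denotes Hausdorff dimension. *)

theory Defs
  imports "HOL-Analysis.Analysis"
begin

definition hausdorff_pre :: "real \<Rightarrow> real \<Rightarrow> 'a::metric_space set \<Rightarrow> ennreal" where
  "hausdorff_pre s \<delta> E =
     (INF U \<in> {U :: nat \<Rightarrow> 'a set. E \<subseteq> (\<Union>i. U i) \<and> (\<forall>i. bounded (U i) \<and> diameter (U i) \<le> \<delta>)}.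
        (\<Sum>i. ennreal (diameter (U i) powr s)))"

definition hausdorff_measure :: "real \<Rightarrow> 'a::metric_space set \<Rightarrow> ennreal" where
  "hausdorff_measure s E = (SUP \<delta> \<in> {0<..}. hausdorff_pre s \<delta> E)"

definition hausdorff_dim :: "'a::metric_space set \<Rightarrow> real" where
  "hausdorff_dim E = Inf {s::real. s > 0 \<and> hausdorff_measure s E = 0}"

end

theory Submission
  imports Defs "HOL-Probability.Distributions"
begin

text \<open>
  Put \<open>a = x1\<close> to the left of the other three points and write \<open>u(x) = 1 / (x - a)\<close>. The cross ratio
  is \<open>t\<close> if and only if \<open>u(x4) = t u(x3) - (t - 1) u(x2)\<close>. Take four separated pieces of \<open>E\<close> carrying
  Frostman weights of exponent \<open>s > 3/4\<close>, and let \<open>nu t R\<close> be the total weight of the quadruples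
  satisfying this relation, counted with a Gaussian kernel of width \<open>1 / R\<close>. Since the relation separates
  the variables \<open>x4\<close> and \<open>(x2, x3)\<close> once \<open>a\<close> is fixed, the Cauchy-Schwarz inequality bounds
  \<open>d nu / d R\<close> by the energy of \<open>u(x4)\<close>, which is of order \<open>R powr - s\<close>, and the energy of
  \<open>t u(x3) - (t - 1) u(x2)\<close>. In the latter the average over \<open>a\<close> is dominated by \<open>R powr (1 - s)\<close> times a
  smooth integral, where the oscillation in \<open>a\<close> localises to \<open>\<bar>x2 - x2'\<bar>, \<bar>x3 - x3'\<bar> \<le> 1 / R\<close> and yields
  \<open>R powr (1 - 3 * s)\<close>. Altogether \<open>d nu / d R\<close> is of order \<open>R powr (1/2 - 2 * s)\<close>, uniformly in \<open>t\<close>, which is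
  integrable at infinity exactly for \<open>s > 3/4\<close>. A pigeonhole argument bounds \<open>nu t R\<close> from below at one
  fixed scale for all \<open>t\<close> in some interval, hence at all finer scales, and compactness concludes.
  The weights are finitely supported and satisfy the Frostman condition only down to a prescribed scale, so
  that no limit measure is needed.
\<close>

section \<open>Dyadic content and discrete Frostman weights\<close>

text \<open>For a single first point \<open>a\<close> the values
  \<open>t u(x3) - (t - 1) u(x2)\<close> may be badly distributed, so all gain comes from varying
  \<open>a\<close>. It rests on a transversality: since \<open>u' = u^2\<close> in the base point, a
  nontrivial phase difference and its derivative cannot vanish together when the pieces are
  separated. As the weights on \<open>a\<close> are only Frostman, a Sobolev inequality at scale
  \<open>1 / R\<close> trades their sum for a Lebesgue integral; this is the price
  \<open>R powr (1 - s)\<close>. The scale derivative of the Gaussian kernel is studied because it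
  is itself a positive definite kernel: energies become square integrals, and no Fourier transform
  is needed. The exponent \<open>1/2 - 2 * s\<close> belongs to the geometric mean of
  \<open>R powr - s\<close> and \<open>R powr (1 - 3 * s)\<close>. All constants depend on the
  pieces, on \<open>s\<close> and on a lower bound for the masses, never on the weights or their
  finest scale. Hence points missing from the set of cross ratios can be fixed before the scale, and
  weights that resolve finely enough are chosen last.\<close>

definition dyadic :: "nat \<Rightarrow> int \<Rightarrow> real set" where
  "dyadic k m = {x. \<lfloor>x * 2 ^ k\<rfloor> = m}"

definition dyadic_cost :: "real \<Rightarrow> (nat \<times> int) set \<Rightarrow> real" where
  "dyadic_cost s K = (\<Sum>(k, m)\<in>K. (1 / 2 ^ k) powr s)"

definition dyadic_cover :: "(nat \<times> int) set \<Rightarrow> real set \<Rightarrow> bool" where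
  "dyadic_cover K A \<longleftrightarrow> finite K \<and> A \<subseteq> (\<Union>(k, m)\<in>K. dyadic k m)"

text \<open>A lower bound for dyadic Hausdorff content. Content is used rather than measure because
  it is dual to flows on the dyadic tree; finite covers suffice because the tree is cut at finite
  depth.\<close>

definition fat :: "real \<Rightarrow> real \<Rightarrow> real set \<Rightarrow> bool" where
  "fat s c A \<longleftrightarrow> (\<forall>K. dyadic_cover K A \<longrightarrow> c \<le> dyadic_cost s K)"

lemma dyadic_iff: "x \<in> dyadic k m \<longleftrightarrow> m / 2 ^ k \<le> x \<and> x < (m + 1) / 2 ^ k"
  by (auto simp: dyadic_def floor_eq_iff field_simps)

lemma dyadic_cost_nonneg: "0 \<le> dyadic_cost s K"
  unfolding dyadic_cost_def by (intro sum_nonneg) auto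

lemma dyadic_cost_union_le:
  "finite K \<Longrightarrow> finite L \<Longrightarrow> dyadic_cost s (K \<union> L) \<le> dyadic_cost s K + dyadic_cost s L"
  unfolding dyadic_cost_def by (subst sum_Un) (auto intro!: sum_nonneg)

lemma dyadic_cost_UN_le:
  "finite I \<Longrightarrow> (\<And>i. i \<in> I \<Longrightarrow> finite (K i)) \<Longrightarrow> dyadic_cost s (\<Union>i\<in>I. K i) \<le> (\<Sum>i\<in>I. dyadic_cost s (K i))"
proof (induction I rule: finite_induct)
  case (insert i I)
  then show ?case
    using dyadic_cost_union_le[of "K i" "\<Union>i\<in>I. K i" s] by force
qed (simp add: dyadic_cost_def)

lemma dyadic_bounded: "bounded (dyadic k m)" "diameter (dyadic k m) \<le> 1 / 2 ^ k"
proof -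
  have sub: "dyadic k m \<subseteq> {m / 2 ^ k .. (m + 1) / 2 ^ k}" by (auto simp: dyadic_iff)
  show "bounded (dyadic k m)" by (rule bounded_subset[OF bounded_closed_interval sub])
  have "diameter (dyadic k m) \<le> diameter {m / 2 ^ k .. (m + 1) / 2 ^ k}"
    by (rule diameter_subset[OF sub bounded_closed_interval])
  also have "\<dots> = 1 / 2 ^ k"
    by (subst diameter_closed_interval) (auto simp: field_simps)
  finally show "diameter (dyadic k m) \<le> 1 / 2 ^ k" .
qed

lemma hausdorff_pre_le_cost:
  assumes K: "dyadic_cover K A" and \<delta>: "\<And>k m. (k, m) \<in> K \<Longrightarrow> 1 / 2 ^ k \<le> \<delta>" and s: "0 < s" and \<delta>0: "0 \<le> \<delta>"
  shows "hausdorff_pre s \<delta> A \<le> ennreal (dyadic_cost s K)"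
proof -
  have fin: "finite K" using K by (simp add: dyadic_cover_def)
  obtain f where f: "bij_betw f {..<card K} K" using ex_bij_betw_nat_finite[OF fin] by (auto simp: atLeast0LessThan)
  \<comment> \<open>The finite cover is padded with empty sets, which cost nothing because
    \<open>0 powr s = 0\<close>.\<close>
  define U where "U i = (if i < card K then (case f i of (k, m) \<Rightarrow> dyadic k m) else {})" for i
  have "hausdorff_pre s \<delta> A \<le> (\<Sum>i. ennreal (diameter (U i) powr s))"
    unfolding hausdorff_pre_def
  proof (rule INF_lower, safe)
    fix x assume "x \<in> A"
    then obtain k m where "(k, m) \<in> K" "x \<in> dyadic k m" using K by (auto simp: dyadic_cover_def)
    moreover then obtain i where "i < card K" "f i = (k, m)" using f by (metis bij_betw_iff_bijections lessThan_iff)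
    ultimately show "x \<in> (\<Union>i. U i)" by (force simp: U_def)
  next
    fix i
    show "bounded (U i)" by (auto simp: U_def dyadic_bounded split: prod.split)
    show "diameter (U i) \<le> \<delta>"
    proof (cases "i < card K")
      case True
      obtain k m where km: "f i = (k, m)" by fastforce
      then have "(k, m) \<in> K" using True f by (metis bij_betwE lessThan_iff)
      then show ?thesis using \<delta>[of k m] dyadic_bounded(2)[of k m] True km by (simp add: U_def)
    qed (simp add: U_def \<delta>0)
  qed
  also have "\<dots> = (\<Sum>i<card K. ennreal (diameter (U i) powr s))"
    by (rule suminf_finite) (auto simp: U_def)
  also have "\<dots> \<le> (\<Sum>i<card K. ennreal (case f i of (k, m) \<Rightarrow> (1 / 2 ^ k) powr s))"
    using dyadic_bounded s
    by (intro sum_mono ennreal_leI) (auto simp: U_def diameter_ge_0 intro!: powr_mono2 split: prod.split)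
  also have "\<dots> = ennreal (\<Sum>i<card K. case f i of (k, m) \<Rightarrow> (1 / 2 ^ k) powr s)"
    by (rule sum_ennreal) (auto split: prod.split)
  also have "(\<Sum>i<card K. case f i of (k, m) \<Rightarrow> (1 / 2 ^ k) powr s) = dyadic_cost s K"
    unfolding dyadic_cost_def by (rule sum.reindex_bij_betw[OF f])
  finally show ?thesis .
qed

text \<open>A cover by cells of size at most \<open>\<delta>\<close> costs at least the premeasure
  at \<open>\<delta>\<close>; any other cover contains a longer cell, which alone costs at least
  \<open>\<delta> powr s\<close>. The minimum of both bounds is free of any restriction on the
  cells.\<close>

lemma fat_if_hausdorff_measure_nonzero:
  assumes "hausdorff_measure s A \<noteq> 0" "0 < s"
  obtains c where "0 < c" "fat s c A"
proof -
  obtain \<delta> where \<delta>: "0 < \<delta>" "hausdorff_pre s \<delta> A \<noteq> 0"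
    using assms(1) unfolding hausdorff_measure_def by (metis (no_types, lifting) SUP_eq_const SUP_bot_conv(2) bot_ennreal greaterThan_iff)
  obtain e where e: "0 < e" "ennreal e \<le> hausdorff_pre s \<delta> A"
  proof (cases "hausdorff_pre s \<delta> A")
    case (real e)
    with \<delta>(2) show ?thesis by (intro that[of e]) (auto simp: less_le)
  next
    case top
    then show ?thesis by (intro that[of 1]) auto
  qed
  let ?c = "min e (\<delta> powr s)"
  have "fat s ?c A" unfolding fat_def
  proof (intro allI impI)
    fix K assume K: "dyadic_cover K A"
    show "?c \<le> dyadic_cost s K"
    proof (cases "\<forall>(k, m)\<in>K. 1 / 2 ^ k \<le> \<delta>")
      case True
      then have "hausdorff_pre s \<delta> A \<le> ennreal (dyadic_cost s K)"
        using K assms(2) \<delta>(1) by (intro hausdorff_pre_le_cost) auto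
      then have "ennreal e \<le> ennreal (dyadic_cost s K)" using e(2) by simp
      then show ?thesis using dyadic_cost_nonneg[of s K] by (simp add: ennreal_le_iff)
    next
      case False
      then obtain k m where km: "(k, m) \<in> K" "\<delta> < 1 / 2 ^ k" by force
      have "\<delta> powr s \<le> (1 / 2 ^ k) powr s" using km \<delta> assms(2) by (intro powr_mono2) auto
      also have "\<dots> \<le> dyadic_cost s K"
        using member_le_sum[of "(k, m)" K "\<lambda>(k, m). (1 / 2 ^ k) powr s"] km K
        by (auto simp: dyadic_cost_def dyadic_cover_def)
      finally show ?thesis by simp
    qed
  qed
  moreover have "0 < ?c" using e \<delta> by simp
  ultimately show ?thesis using that by blast
qed

lemma fat_mono: "fat s c A \<Longrightarrow> c' \<le> c \<Longrightarrow> fat s c' A"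
  unfolding fat_def by (meson order_trans)

text \<open>Greedy choice of minima: each step discards the minimum and at most its successor, so
  one of seven elements survives three steps.\<close>

lemma four_separated_ints:
  fixes G :: "int set"
  assumes "finite G" "7 \<le> card G"
  obtains a b c d where "a \<in> G" "b \<in> G" "c \<in> G" "d \<in> G" "a + 2 \<le> b" "b + 2 \<le> c" "c + 2 \<le> d"
proof -
  have step: "\<exists>a. a \<in> H \<and> (\<forall>x\<in>H - {a, a + 1}. a + 2 \<le> x) \<and> finite (H - {a, a + 1}) \<and> n \<le> card (H - {a, a + 1})"
    if H: "finite H" "n + 2 \<le> card H" for H :: "int set" and n
  proof (intro exI conjI ballI)
    have ne: "H \<noteq> {}" using H by auto
    show "Min H \<in> H" using H ne by simp
    fix x assume "x \<in> H - {Min H, Min H + 1}"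
    then show "Min H + 2 \<le> x" using Min_le[OF H(1), of x] by auto
  next
    have "card H \<le> card (H - {Min H, Min H + 1}) + card {Min H, Min H + 1}"
      using H by (metis card_Un_le card_mono finite_Diff finite_UnI finite.emptyI finite_insert Un_Diff_cancel2 Un_upper1 order_trans)
    moreover have "card {Min H, Min H + 1} \<le> 2" by (simp add: card_insert_if)
    ultimately show "n \<le> card (H - {Min H, Min H + 1})" using H by linarith
  qed (use H in auto)
  obtain a where a: "a \<in> G" "\<forall>x\<in>G - {a, a + 1}. a + 2 \<le> x" "finite (G - {a, a + 1})" "5 \<le> card (G - {a, a + 1})"
    using step[of G 5] assms by auto
  obtain b where b: "b \<in> G - {a, a + 1}" "\<forall>x\<in>G - {a, a + 1} - {b, b + 1}. b + 2 \<le> x"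
    "finite (G - {a, a + 1} - {b, b + 1})" "3 \<le> card (G - {a, a + 1} - {b, b + 1})"
    using step[OF a(3), of 3] a(4) by auto
  obtain c where c: "c \<in> G - {a, a + 1} - {b, b + 1}" "\<forall>x\<in>G - {a, a + 1} - {b, b + 1} - {c, c + 1}. c + 2 \<le> x"
    "finite (G - {a, a + 1} - {b, b + 1} - {c, c + 1})" "1 \<le> card (G - {a, a + 1} - {b, b + 1} - {c, c + 1})"
    using step[OF b(3), of 1] b(4) by auto
  then obtain d where d: "d \<in> G - {a, a + 1} - {b, b + 1} - {c, c + 1}"
    by (metis card.empty ex_in_conv not_one_le_zero)
  show thesis using a b c d by (intro that[of a b c d]) auto
qed

text \<open>The level \<open>k\<close> is so fine that seven cells cost less than
  \<open>c / 2\<close>. If fewer than seven cells were fat, these cells and cheap covers of all the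
  others would cover \<open>E\<close> at a cost below \<open>c\<close>.\<close>

lemma four_fat_pieces:
  assumes "bounded E" "fat s c E" "0 < c" "0 < s"
  obtains k c' m1 m2 m3 m4 where "0 < c'" "m1 + 2 \<le> m2" "m2 + 2 \<le> m3" "m3 + 2 \<le> m4"
    "fat s c' (E \<inter> dyadic k m1)" "fat s c' (E \<inter> dyadic k m2)" "fat s c' (E \<inter> dyadic k m3)" "fat s c' (E \<inter> dyadic k m4)"
proof -
  have "(\<lambda>k. 7 * ((1 / 2) powr s) ^ k) \<longlonglongrightarrow> 7 * 0"
    using assms(4) powr_less_mono2[of s "1/2" 1]
    by (intro tendsto_mult tendsto_const LIMSEQ_power_zero) simp
  from order_tendstoD(2)[OF this, of "c / 2"]
  have "\<forall>\<^sub>F k in sequentially. 7 * ((1 / 2) powr s) ^ k < c / 2"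
    using assms(3) by simp
  then obtain k where k: "7 * ((1 / 2) powr s) ^ k < c / 2" by (metis eventually_happens trivial_limit_sequentially)
  have pw: "(1 / 2 ^ k) powr s = ((1 / 2) powr s) ^ k"
  proof -
    have "(1 / 2 ^ k) powr s = ((1 / 2) powr real k) powr s"
      by (simp add: powr_realpow power_one_over)
    also have "\<dots> = ((1 / 2) powr s) ^ k"
      by (simp add: powr_powr powr_power)
    finally show ?thesis .
  qed
  obtain M where M: "\<And>x. x \<in> E \<Longrightarrow> \<bar>x\<bar> \<le> M" using assms(1) by (auto simp: bounded_real)
  define I where "I = {\<lfloor>- (M * 2 ^ k)\<rfloor>..\<lfloor>M * 2 ^ k\<rfloor>}"
  have EI: "\<lfloor>x * 2 ^ k\<rfloor> \<in> I" if "x \<in> E" for x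
  proof -
    have "\<bar>x * 2 ^ k\<bar> \<le> M * 2 ^ k" using M[OF that] by (simp add: abs_mult mult_right_mono)
    then have "- (M * 2 ^ k) \<le> x * 2 ^ k" "x * 2 ^ k \<le> M * 2 ^ k" by linarith+
    then show ?thesis unfolding I_def atLeastAtMost_iff by (intro conjI floor_mono)
  qed
  have finI: "finite I" by (simp add: I_def)
  define G where "G = {m \<in> I. \<exists>c'>0. fat s c' (E \<inter> dyadic k m)}"
  have finG: "finite G" using finI by (simp add: G_def)
  have "7 \<le> card G"
  proof (rule ccontr)
    assume "\<not> 7 \<le> card G"
    then have cG: "real (card G) \<le> 7" by simp
    \<comment> \<open>The remaining budget \<open>c / 2\<close> is shared by the cells of
      \<open>I\<close>; the \<open>+ 1\<close> guards the division.\<close>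
    define e where "e = c / 2 / (card I + 1)"
    have e: "0 < e" using assms(3) by (simp add: e_def)
    have "\<exists>K. dyadic_cover K (E \<inter> dyadic k m) \<and> dyadic_cost s K < e" if "m \<in> I - G" for m
      using that e unfolding G_def fat_def by (auto simp: not_le)
    then obtain K where K: "\<And>m. m \<in> I - G \<Longrightarrow> dyadic_cover (K m) (E \<inter> dyadic k m)" "\<And>m. m \<in> I - G \<Longrightarrow> dyadic_cost s (K m) < e"
      by metis
    define L where "L = (\<lambda>m. (k, m)) ` G \<union> (\<Union>m\<in>I - G. K m)"
    have finL: "finite (\<Union>m\<in>I - G. K m)" using K(1) finI by (auto simp: dyadic_cover_def)
    have "dyadic_cover L E"
      unfolding dyadic_cover_def
    proof (intro conjI subsetI)
      show "finite L" using finG finL by (simp add: L_def)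
      fix x assume x: "x \<in> E"
      let ?m = "\<lfloor>x * 2 ^ k\<rfloor>"
      have xm: "x \<in> dyadic k ?m" by (simp add: dyadic_def)
      show "x \<in> (\<Union>(k, m)\<in>L. dyadic k m)"
      proof (cases "?m \<in> G")
        case True
        then show ?thesis using xm by (force simp: L_def)
      next
        case False
        then have m: "?m \<in> I - G" using EI[OF x] by simp
        then have "x \<in> (\<Union>(k, m)\<in>K ?m. dyadic k m)" using K(1)[OF m] x xm by (auto simp: dyadic_cover_def)
        then show ?thesis using m unfolding L_def by blast
      qed
    qed
    then have "c \<le> dyadic_cost s L" using assms(2) by (simp add: fat_def)
    also have "\<dots> \<le> dyadic_cost s ((\<lambda>m. (k, m)) ` G) + dyadic_cost s (\<Union>m\<in>I - G. K m)"
      unfolding L_def using finG finL by (intro dyadic_cost_union_le) auto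
    also have "dyadic_cost s ((\<lambda>m. (k, m)) ` G) = card G * ((1 / 2) powr s) ^ k"
      unfolding dyadic_cost_def by (subst sum.reindex) (auto simp: inj_on_def pw)
    also have "\<dots> \<le> 7 * ((1 / 2) powr s) ^ k" using cG by (intro mult_right_mono) auto
    also have "dyadic_cost s (\<Union>m\<in>I - G. K m) \<le> (\<Sum>m\<in>I - G. dyadic_cost s (K m))"
      using K(1) finI by (intro dyadic_cost_UN_le) (auto simp: dyadic_cover_def)
    also have "\<dots> \<le> (\<Sum>m\<in>I - G. e)" using K(2) by (intro sum_mono) (simp add: less_imp_le)
    also have "\<dots> \<le> card I * e" using e finI by (auto intro!: mult_right_mono card_mono)
    also have "\<dots> \<le> c / 2" using assms(3) by (simp add: e_def field_simps)
    finally show False using k by linarith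
  qed
  from four_separated_ints[OF finG this] obtain m1 m2 m3 m4 where m: "m1 \<in> G" "m2 \<in> G" "m3 \<in> G" "m4 \<in> G"
    "m1 + 2 \<le> m2" "m2 + 2 \<le> m3" "m3 + 2 \<le> m4" by metis
  from m(1-4) obtain c1 c2 c3 c4 where c: "0 < c1" "fat s c1 (E \<inter> dyadic k m1)" "0 < c2" "fat s c2 (E \<inter> dyadic k m2)"
    "0 < c3" "fat s c3 (E \<inter> dyadic k m3)" "0 < c4" "fat s c4 (E \<inter> dyadic k m4)"
    unfolding G_def by auto
  show thesis
    by (rule that[of "min (min c1 c2) (min c3 c4)" m1 m2 m3 m4 k]) (use c m in \<open>auto elim: fat_mono\<close>)
qed

section \<open>Flows on the dyadic tree and the Frostman weights obtained from them\<close>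

lemma dyadic_nested:
  assumes "x \<in> dyadic j m" "k \<le> j"
  shows "x \<in> dyadic k (m div 2 ^ (j - k))"
proof -
  have "x * 2 ^ k = x * 2 ^ j / real_of_int (2 ^ (j - k))"
  proof -
    have "(2::real) ^ j = 2 ^ k * 2 ^ (j - k)" using assms(2) by (simp flip: power_add)
    then show ?thesis by simp
  qed
  also have "\<lfloor>\<dots>\<rfloor> = \<lfloor>x * 2 ^ j\<rfloor> div 2 ^ (j - k)"
    by (rule floor_divide_real_eq_div) simp
  finally show ?thesis using assms(1) by (simp add: dyadic_def)
qed

lemma dyadic_split: "dyadic k m = dyadic (Suc k) (2 * m) \<union> dyadic (Suc k) (2 * m + 1)"
proof (intro set_eqI iffI)
  fix x assume "x \<in> dyadic k m"
  then have "\<lfloor>x * 2 ^ Suc k\<rfloor> div 2 = m"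
    using dyadic_nested[of x "Suc k" "\<lfloor>x * 2 ^ Suc k\<rfloor>" k] by (simp add: dyadic_def)
  then have "\<lfloor>x * 2 ^ Suc k\<rfloor> = 2 * m \<or> \<lfloor>x * 2 ^ Suc k\<rfloor> = 2 * m + 1" by presburger
  then show "x \<in> dyadic (Suc k) (2 * m) \<union> dyadic (Suc k) (2 * m + 1)" by (simp add: dyadic_def)
next
  fix x assume "x \<in> dyadic (Suc k) (2 * m) \<union> dyadic (Suc k) (2 * m + 1)"
  then show "x \<in> dyadic k m"
    using dyadic_nested[of x "Suc k" "2 * m" k] dyadic_nested[of x "Suc k" "2 * m + 1" k] by auto
qed

lemma dyadic_disjoint: "m \<noteq> m' \<Longrightarrow> dyadic k m \<inter> dyadic k m' = {}"
  by (auto simp: dyadic_def)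

text \<open>Max-flow min-cut on the binary tree of dyadic subintervals.\<close>

lemma frostman_tree:
  fixes A :: "real set" and s :: real
  shows "\<exists>P w. finite P \<and> P \<subseteq> A \<inter> dyadic k m \<and> (\<forall>p. 0 \<le> w p)
    \<and> (\<forall>j m'. k \<le> j \<and> j \<le> k + d \<longrightarrow> sum w (P \<inter> dyadic j m') \<le> (1 / 2 ^ j) powr s)
    \<and> (\<exists>K. dyadic_cover K (A \<inter> dyadic k m) \<and> dyadic_cost s K \<le> sum w P)"
proof (induction d arbitrary: k m)
  case 0
  show ?case
  proof (cases "A \<inter> dyadic k m = {}")
    case True
    have "dyadic_cover {} (A \<inter> dyadic k m)" "dyadic_cost s {} \<le> 0"
      using True by (auto simp: dyadic_cover_def dyadic_cost_def)
    then show ?thesis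
      by (intro exI[of _ "{}"] exI[of _ "\<lambda>_. 0"]) auto
  next
    case False
    then obtain p where p: "p \<in> A \<inter> dyadic k m" by auto
    have "sum (\<lambda>_. (1 / 2 ^ k) powr s) ({p} \<inter> dyadic k m') \<le> (1 / 2 ^ k) powr s" for m'
      by (cases "p \<in> dyadic k m'") auto
    moreover have "dyadic_cover {(k, m)} (A \<inter> dyadic k m)" "dyadic_cost s {(k, m)} \<le> (1 / 2 ^ k) powr s"
      by (auto simp: dyadic_cover_def dyadic_cost_def)
    ultimately show ?thesis using p
      by (intro exI[of _ "{p}"] exI[of _ "\<lambda>_. (1 / 2 ^ k) powr s"] conjI exI[of _ "{(k, m)}"]) auto
  qed
next
  case (Suc d)
  let ?b = "\<lambda>j. (1 / 2 ^ j) powr s :: real"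
  obtain P1 w1 K1 where 1: "finite P1" "P1 \<subseteq> A \<inter> dyadic (Suc k) (2 * m)" "\<And>p. 0 \<le> w1 p"
    "\<And>j m'. Suc k \<le> j \<Longrightarrow> j \<le> Suc k + d \<Longrightarrow> sum w1 (P1 \<inter> dyadic j m') \<le> ?b j"
    "dyadic_cover K1 (A \<inter> dyadic (Suc k) (2 * m))" "dyadic_cost s K1 \<le> sum w1 P1"
    using Suc.IH[of "Suc k" "2 * m"] by blast
  obtain P2 w2 K2 where 2: "finite P2" "P2 \<subseteq> A \<inter> dyadic (Suc k) (2 * m + 1)" "\<And>p. 0 \<le> w2 p"
    "\<And>j m'. Suc k \<le> j \<Longrightarrow> j \<le> Suc k + d \<Longrightarrow> sum w2 (P2 \<inter> dyadic j m') \<le> ?b j"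
    "dyadic_cover K2 (A \<inter> dyadic (Suc k) (2 * m + 1))" "dyadic_cost s K2 \<le> sum w2 P2"
    using Suc.IH[of "Suc k" "2 * m + 1"] by blast
  have disj: "P1 \<inter> P2 = {}" using 1(2) 2(2) dyadic_disjoint[of "2 * m" "2 * m + 1" "Suc k"] by auto
  define w where "w p = (if p \<in> P1 then w1 p else w2 p)" for p
  define P where "P = P1 \<union> P2"
  have w0: "0 \<le> w p" for p using 1(3) 2(3) by (simp add: w_def)
  have fin: "finite P" using 1 2 by (simp add: P_def)
  have sub: "P \<subseteq> A \<inter> dyadic k m" using 1(2) 2(2) dyadic_split[of k m] by (auto simp: P_def)
  have wS1: "sum w (P1 \<inter> X) = sum w1 (P1 \<inter> X)" for X
    by (intro sum.cong) (auto simp: w_def)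
  have wS2: "sum w (P2 \<inter> X) = sum w2 (P2 \<inter> X)" for X
    using disj by (intro sum.cong) (auto simp: w_def)
  have child: "sum w (P \<inter> dyadic j m') \<le> ?b j" if j: "Suc k \<le> j" "j \<le> Suc k + d" for j m'
  proof (cases "m' div 2 ^ (j - Suc k) = 2 * m")
    case True
    then have "P2 \<inter> dyadic j m' = {}"
      using 2(2) dyadic_nested[OF _ j(1), of _ m'] by (fastforce simp: dyadic_def)
    then have "P \<inter> dyadic j m' = P1 \<inter> dyadic j m'" by (auto simp: P_def)
    then show ?thesis using 1(4)[OF j] wS1 by simp
  next
    case False
    then have "P1 \<inter> dyadic j m' = {}"
      using 1(2) dyadic_nested[OF _ j(1), of _ m'] by (fastforce simp: dyadic_def)
    then have "P \<inter> dyadic j m' = P2 \<inter> dyadic j m'" by (auto simp: P_def)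
    then show ?thesis using 2(4)[OF j] wS2 by simp
  qed
  have W: "sum w P = sum w1 P1 + sum w2 P2"
    unfolding P_def using 1(1) 2(1) disj wS1[of UNIV] wS2[of UNIV] by (simp add: sum.union_disjoint)
  have K12: "dyadic_cover (K1 \<union> K2) (A \<inter> dyadic k m)"
    using 1(5) 2(5) dyadic_split[of k m] by (auto simp: dyadic_cover_def)
  have Kc: "dyadic_cost s (K1 \<union> K2) \<le> sum w P"
    using dyadic_cost_union_le[of K1 K2 s] 1(5,6) 2(5,6) W by (auto simp: dyadic_cover_def)
  have le_total: "sum w (P \<inter> X) \<le> sum w P" for X
    using fin w0 by (intro sum_mono2) auto
  show ?case
  \<comment> \<open>Either the flows of both children fit through the root, and the union of their
    cuts is a cut of equal cost or less; or the flow is scaled down to saturate the root, which is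
    then itself a cut. Scaling by \<open>q \<le> 1\<close> preserves the bounds further
    down.\<close>
  proof (cases "sum w P \<le> ?b k")
    case True
    have "sum w (P \<inter> dyadic j m') \<le> ?b j" if "k \<le> j" "j \<le> k + Suc d" for j m'
    proof (cases "j = k")
      case True
      then show ?thesis using le_total[of "dyadic j m'"] \<open>sum w P \<le> ?b k\<close> by simp
    next
      case False
      then show ?thesis using child[of j m'] that by simp
    qed
    then show ?thesis using fin sub w0 K12 Kc
      by (intro exI[of _ P] exI[of _ w]) blast
  next
    case False
    define q where "q = ?b k / sum w P"
    have q: "0 \<le> q" "q \<le> 1" "q * sum w P = ?b k"
      using False powr_ge_zero[of "1 / 2 ^ k" s] by (auto simp: q_def divide_le_eq_1 simp del: powr_ge_zero)
    have sc: "sum (\<lambda>p. q * w p) X = q * sum w X" for X by (simp add: sum_distrib_left)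
    have "sum (\<lambda>p. q * w p) (P \<inter> dyadic j m') \<le> ?b j" if "k \<le> j" "j \<le> k + Suc d" for j m'
    proof (cases "j = k")
      case True
      then show ?thesis
        using mult_left_mono[OF le_total[of "dyadic j m'"] q(1)] q(3) unfolding sc by simp
    next
      case False
      then have "q * sum w (P \<inter> dyadic j m') \<le> 1 * ?b j"
        using child[of j m'] that q w0 by (intro mult_mono) (auto intro: sum_nonneg)
      then show ?thesis unfolding sc by simp
    qed
    moreover have "dyadic_cover {(k, m)} (A \<inter> dyadic k m)" "dyadic_cost s {(k, m)} \<le> sum (\<lambda>p. q * w p) P"
      unfolding sc q(3) by (auto simp: dyadic_cover_def dyadic_cost_def)
    ultimately show ?thesis using fin sub w0 q(1)
      by (intro exI[of _ P] exI[of _ "\<lambda>p. q * w p"]) (blast intro: mult_nonneg_nonneg)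
  qed
qed

text \<open>A ball of radius \<open>r\<close> meets at most three cells of a level whose cell length
  lies between \<open>r\<close> and \<open>2 * r\<close>, and \<open>3 * 2 powr s \<le> 6\<close>.
  If \<open>r\<close> exceeds the length of the root cell, the root bound alone suffices.\<close>

lemma ball_mass:
  fixes w :: "real \<Rightarrow> real"
  assumes P: "finite P" "P \<subseteq> dyadic k m" and w: "\<And>p. 0 \<le> w p" and s: "0 < s" "s \<le> 1" and kn: "k \<le> n"
    and dy: "\<And>j m'. k \<le> j \<Longrightarrow> j \<le> n \<Longrightarrow> sum w (P \<inter> dyadic j m') \<le> (1 / 2 ^ j) powr s"
    and r: "1 / 2 ^ n \<le> r"
  shows "sum w {p \<in> P. \<bar>p - x\<bar> \<le> r} \<le> 6 * r powr s"
proof (cases "1 / 2 ^ k \<le> r")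
  case True
  have "sum w {p \<in> P. \<bar>p - x\<bar> \<le> r} \<le> sum w (P \<inter> dyadic k m)"
    using P w by (intro sum_mono2) auto
  also have "\<dots> \<le> (1 / 2 ^ k) powr s" using dy[of k m] kn by simp
  also have "\<dots> \<le> r powr s" using True s by (intro powr_mono2) auto
  also have "\<dots> \<le> 6 * r powr s" by simp
  finally show ?thesis .
next
  case False
  have r0: "0 < r" using r by (rule less_le_trans[rotated]) simp
  \<comment> \<open>The finest level with cells no shorter than \<open>r\<close>, capped at
    \<open>n\<close> because nothing is known below level \<open>n\<close>. When the cap is active,
    \<open>1 / 2 ^ n \<le> r\<close> still gives the upper bound on the cell length.\<close>
  define j where "j = (GREATEST j. j \<le> n \<and> r \<le> 1 / 2 ^ j)"
  have ex: "k \<le> n \<and> r \<le> 1 / 2 ^ k" using False kn by simp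
  have j: "j \<le> n \<and> r \<le> 1 / 2 ^ j"
    unfolding j_def by (rule GreatestI_nat[where P = "\<lambda>j. j \<le> n \<and> r \<le> 1 / 2 ^ j", OF ex, of n]) simp
  have kj: "k \<le> j"
    unfolding j_def by (rule Greatest_le_nat[where P = "\<lambda>j. j \<le> n \<and> r \<le> 1 / 2 ^ j", OF ex, of n]) simp
  have up: "1 / 2 ^ j \<le> 2 * r"
  proof (cases "j = n")
    case True
    then show ?thesis using r r0 by simp
  next
    case False
    have "\<not> (Suc j \<le> n \<and> r \<le> 1 / 2 ^ Suc j)"
      using Greatest_le_nat[where P = "\<lambda>j. j \<le> n \<and> r \<le> 1 / 2 ^ j" and k = "Suc j" and b = n]
      unfolding j_def[symmetric] by auto
    then have "1 / 2 ^ Suc j \<le> r" using False j by auto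
    then show ?thesis by (simp add: field_simps)
  qed
  let ?f = "\<lfloor>x * 2 ^ j\<rfloor>"
  have cover: "{p \<in> P. \<bar>p - x\<bar> \<le> r} \<subseteq> (P \<inter> dyadic j (?f - 1)) \<union> (P \<inter> dyadic j ?f) \<union> (P \<inter> dyadic j (?f + 1))"
  proof safe
    fix p assume p: "\<bar>p - x\<bar> \<le> r" "p \<notin> dyadic j (?f + 1)" "p \<notin> dyadic j ?f"
    have "\<bar>p - x\<bar> * 2 ^ j \<le> (1 / 2 ^ j) * 2 ^ j" using p j by (intro mult_right_mono) auto
    then have "\<bar>p * 2 ^ j - x * 2 ^ j\<bar> \<le> 1" by (simp add: abs_mult flip: left_diff_distrib)
    then have "\<lfloor>p * 2 ^ j\<rfloor> \<le> ?f + 1" "?f - 1 \<le> \<lfloor>p * 2 ^ j\<rfloor>" by linarith+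
    then show "p \<in> dyadic j (?f - 1)" using p(2,3) by (auto simp: dyadic_def)
  qed
  have "sum w {p \<in> P. \<bar>p - x\<bar> \<le> r} \<le> sum w ((P \<inter> dyadic j (?f - 1)) \<union> (P \<inter> dyadic j ?f) \<union> (P \<inter> dyadic j (?f + 1)))"
    using P w cover by (intro sum_mono2) auto
  also have "\<dots> = sum w (P \<inter> dyadic j (?f - 1)) + sum w (P \<inter> dyadic j ?f) + sum w (P \<inter> dyadic j (?f + 1))"
    using P by (subst sum.union_disjoint, simp, simp, force simp: dyadic_def)+ simp
  also have "\<dots> \<le> (1 / 2 ^ j) powr s + (1 / 2 ^ j) powr s + (1 / 2 ^ j) powr s"
    using kj j by (intro add_mono dy) auto
  also have "\<dots> \<le> 3 * (2 * r) powr s" using up s powr_mono2[of s "1 / 2 ^ j" "2 * r"] by simp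
  also have "\<dots> = 3 * (2 powr s * r powr s)" using r0 by (simp add: powr_mult)
  also have "\<dots> \<le> 3 * (2 powr 1 * r powr s)" using s by (intro mult_left_mono mult_right_mono powr_mono) auto
  finally show ?thesis by simp
qed

text \<open>By fatness the cut that accompanies the flow costs at least \<open>c\<close>, so the
  total weight is bounded below independently of the depth \<open>n\<close>.\<close>

lemma discrete_frostman:
  assumes "fat s c (A \<inter> dyadic k m)" "0 < s" "s \<le> 1" "k \<le> n"
  obtains P w where "finite P" "P \<subseteq> A \<inter> dyadic k m" "\<And>p. 0 \<le> w p" "c \<le> sum w P" "sum w P \<le> 1"
    "\<And>x r. 1 / 2 ^ n \<le> r \<Longrightarrow> sum w {p \<in> P. \<bar>p - x\<bar> \<le> r} \<le> 6 * r powr s"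
proof -
  obtain P w where P: "finite P" "P \<subseteq> A \<inter> dyadic k m" "\<And>p. 0 \<le> w p"
    "\<And>j m'. k \<le> j \<Longrightarrow> j \<le> n \<Longrightarrow> sum w (P \<inter> dyadic j m') \<le> (1 / 2 ^ j) powr s"
    "\<exists>K. dyadic_cover K (A \<inter> dyadic k m) \<and> dyadic_cost s K \<le> sum w P"
    using frostman_tree[of A k m "n - k" s] unfolding le_add_diff_inverse[OF assms(4)] by blast
  have c: "c \<le> sum w P" using P(5) assms(1) by (auto simp: fat_def intro: order_trans)
  have "sum w P = sum w (P \<inter> dyadic k m)" using P(2) by (intro sum.cong) auto
  also have "\<dots> \<le> (1 / 2 ^ k) powr s" using P(4)[of k m] assms(4) by simp
  also have "\<dots> \<le> 1" using assms(2) by (intro powr_le1) auto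
  finally have "sum w P \<le> 1" .
  moreover have "sum w {p \<in> P. \<bar>p - x\<bar> \<le> r} \<le> 6 * r powr s" if "1 / 2 ^ n \<le> r" for x r
    using P assms that by (intro ball_mass[of P k m w s n]) auto
  ultimately show thesis using that[OF P(1,2,3) c] by blast
qed

text \<open>Only the least \<open>k\<close> with \<open>v \<le> 2 ^ k\<close> is needed: for
  \<open>k > 0\<close> minimality gives \<open>v > 2 ^ (k - 1)\<close>, hence
  \<open>1 / (1 + v) \<le> 2 / 2 ^ k\<close>.\<close>

lemma reciprocal_dyadic_sum:
  fixes v :: real
  assumes "0 \<le> v" "v \<le> 2 ^ K"
  shows "1 / (1 + v) \<le> (\<Sum>k\<le>K. 2 * (1 / 2) ^ k * (if v \<le> 2 ^ k then 1 else 0))"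
proof -
  define k where "k = (LEAST k. v \<le> 2 ^ k)"
  have k: "v \<le> 2 ^ k" unfolding k_def using assms(2) by (rule LeastI)
  have kK: "k \<le> K" unfolding k_def using assms(2) by (rule Least_le)
  have "1 / (1 + v) \<le> 2 * (1 / 2) ^ k"
  proof (cases k)
    case 0
    then show ?thesis using assms(1) by (simp add: field_simps)
  next
    case (Suc j)
    then have "\<not> v \<le> 2 ^ j" unfolding k_def by (metis lessI not_less_Least)
    then have "1 / (1 + v) \<le> 1 / 2 ^ j" using assms(1) by (intro divide_left_mono) (auto intro!: mult_pos_pos add_pos_nonneg)
    then show ?thesis using Suc by (simp add: power_one_over)
  qed
  also have "\<dots> = 2 * (1 / 2) ^ k * (if v \<le> 2 ^ k then 1 else 0)" using k by simp
  also have "\<dots> \<le> (\<Sum>k\<le>K. 2 * (1 / 2) ^ k * (if v \<le> 2 ^ k then 1 else 0))"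
    using kK by (intro member_le_sum) auto
  finally show ?thesis .
qed

text \<open>Summing the Frostman bound over the radii \<open>2 ^ k / R\<close> gives a geometric
  series of ratio \<open>2 powr (s - 1)\<close>, which converges because \<open>s < 1\<close>. All
  radii are at least \<open>1 / R\<close>, so finer scales of the weights never enter.\<close>

lemma energy_bound:
  fixes w :: "real \<Rightarrow> real"
  assumes P: "finite P" and w: "\<And>p. 0 \<le> w p" and s: "0 < s" "s < 1" and R: "0 < R"
    and ball: "\<And>r. 1 / R \<le> r \<Longrightarrow> sum w {p \<in> P. \<bar>p - x\<bar> \<le> r} \<le> 6 * r powr s"
  shows "(\<Sum>p\<in>P. w p / (1 + R * \<bar>p - x\<bar>)) \<le> 12 / (1 - 2 powr (s - 1)) * R powr (- s)"
proof -
  obtain K where K: "Max (insert 0 ((\<lambda>p. R * \<bar>p - x\<bar>) ` P)) < 2 ^ K"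
    using real_arch_pow[of 2] by auto
  have vK: "R * \<bar>p - x\<bar> \<le> 2 ^ K" if "p \<in> P" for p
    using K P that by auto
  have q: "0 < 2 powr (s - 1)" "2 powr (s - 1) < (1::real)"
    using s powr_less_mono[of "s - 1" 0 2] by auto
  have "(\<Sum>p\<in>P. w p / (1 + R * \<bar>p - x\<bar>))
      \<le> (\<Sum>p\<in>P. w p * (\<Sum>k\<le>K. 2 * (1 / 2) ^ k * (if R * \<bar>p - x\<bar> \<le> 2 ^ k then 1 else 0)))"
  proof (rule sum_mono)
    fix p assume "p \<in> P"
    then show "w p / (1 + R * \<bar>p - x\<bar>) \<le> w p * (\<Sum>k\<le>K. 2 * (1 / 2) ^ k * (if R * \<bar>p - x\<bar> \<le> 2 ^ k then 1 else 0))"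
      using mult_left_mono[OF reciprocal_dyadic_sum[of "R * \<bar>p - x\<bar>" K] w[of p]] vK R by simp
  qed
  also have "\<dots> = (\<Sum>k\<le>K. 2 * (1 / 2) ^ k * (\<Sum>p\<in>P. w p * (if R * \<bar>p - x\<bar> \<le> 2 ^ k then 1 else 0)))"
    unfolding sum_distrib_left by (subst sum.swap) (intro sum.cong refl, simp)
  also have "\<dots> = (\<Sum>k\<le>K. 2 * (1 / 2) ^ k * sum w {p \<in> P. \<bar>p - x\<bar> \<le> 2 ^ k / R})"
  proof -
    have e: "(\<Sum>p\<in>P. w p * (if R * \<bar>p - x\<bar> \<le> 2 ^ k then 1 else 0)) = sum w {p \<in> P. \<bar>p - x\<bar> \<le> 2 ^ k / R}" for k
    proof -
    have "(\<Sum>p\<in>P. w p * (if R * \<bar>p - x\<bar> \<le> 2 ^ k then 1 else 0)) = (\<Sum>p\<in>P. if \<bar>p - x\<bar> \<le> 2 ^ k / R then w p else 0)"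
      using R by (intro sum.cong refl) (auto simp: field_simps)
    also have "\<dots> = sum w {p \<in> P. \<bar>p - x\<bar> \<le> 2 ^ k / R}" using P by (simp add: sum.If_cases Int_def)
    finally show ?thesis .
    qed
    show ?thesis by (simp only: e)
  qed
  also have "\<dots> \<le> (\<Sum>k\<le>K. 2 * (1 / 2) ^ k * (6 * (2 ^ k / R) powr s))"
    using R by (intro sum_mono mult_left_mono ball) (auto simp: field_simps)
  also have "\<dots> = (\<Sum>k\<le>K. 12 * R powr (- s) * (2 powr (s - 1)) ^ k)"
  proof (intro sum.cong refl)
    fix k :: nat
    have "(2 ^ k / R) powr s = (2 powr real k) powr s / R powr s"
      using R by (simp add: powr_divide powr_realpow)
    also have "\<dots> = (2 powr s) ^ k * R powr (- s)" by (simp add: powr_powr powr_power powr_minus_divide)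
    finally have e: "(2 ^ k / R) powr s = (2 powr s) ^ k * R powr (- s)" .
    have "(2 powr (s - 1)) = 2 powr s * (1 / 2)" by (simp add: powr_diff)
    then have "(2 powr (s - 1)) ^ k = (2 powr s) ^ k * (1 / 2) ^ k" by (simp only: power_mult_distrib)
    then show "2 * (1 / 2) ^ k * (6 * (2 ^ k / R) powr s) = 12 * R powr (- s) * (2 powr (s - 1)) ^ k"
      unfolding e by simp
  qed
  also have "\<dots> = 12 * R powr (- s) * (\<Sum>k\<le>K. (2 powr (s - 1)) ^ k)" by (simp add: sum_distrib_left)
  also have "\<dots> \<le> 12 * R powr (- s) * (1 / (1 - 2 powr (s - 1)))"
  proof (intro mult_left_mono)
    have "(\<lambda>k. (2 powr (s - 1)) ^ k) sums (1 / (1 - 2 powr (s - 1)))" using q by (intro geometric_sums) auto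
    then show "(\<Sum>k\<le>K. (2 powr (s - 1)) ^ k) \<le> 1 / (1 - 2 powr (s - 1))"
      using q by (metis (no_types, lifting) finite_atMost powr_ge_zero sum_le_suminf sums_iff zero_le_power)
  qed simp
  finally show ?thesis by simp
qed

section \<open>Gaussian kernels\<close>

text \<open>\<open>gker2\<close> is minus the second derivative of \<open>exp (- (v^2) / 2)\<close>,
  while \<open>gker3\<close> and \<open>gker4\<close> are its third and fourth derivatives. With
  these signs \<open>gker2\<close> and \<open>gker4\<close> are positive definite.\<close>

definition gker2 :: "real \<Rightarrow> real" where "gker2 v = (1 - v^2) * exp (- (v^2) / 2)"
definition gker3 :: "real \<Rightarrow> real" where "gker3 v = (3 * v - v^3) * exp (- (v^2) / 2)"
definition gker4 :: "real \<Rightarrow> real" where "gker4 v = (3 - 6 * v^2 + v^4) * exp (- (v^2) / 2)"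

text \<open>Up to the common factor -1/2 these are the first and second derivatives of
  \<open>exp (- (z^2))\<close>, the Gaussian whose autocorrelation is a multiple of
  \<open>exp (- (v^2) / 2)\<close>.\<close>

definition herm0 :: "real \<Rightarrow> real" where "herm0 z = z * exp (- (z^2))"
definition herm1 :: "real \<Rightarrow> real" where "herm1 z = (1 - 2 * z^2) * exp (- (z^2))"

text \<open>Odd central moments vanish, and variance 1/4 gives the moments 1/4 and 3/16. Degree four
  suffices because \<open>herm0\<close> and \<open>herm1\<close> carry polynomials of degree at most
  two.\<close>

lemma gaussian_quartic_integral:
  fixes m :: real
  shows "has_bochner_integral lborel
    (\<lambda>z. normal_density m (1/2) z * (e0 + e1 * (z - m) + e2 * (z - m)^2 + e3 * (z - m)^3 + e4 * (z - m)^4))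
    (e0 + e2 / 4 + 3 * e4 / 16)"
proof -
  have 0: "has_bochner_integral lborel (\<lambda>z. normal_density m (1/2) z * (z - m)^0) 1"
    using normal_moment_even[of "1/2" m 0] by simp
  have 1: "has_bochner_integral lborel (\<lambda>z. normal_density m (1/2) z * (z - m)^1) 0"
    using normal_moment_odd[of "1/2" m 0] by simp
  have 2: "has_bochner_integral lborel (\<lambda>z. normal_density m (1/2) z * (z - m)^2) (1/4)"
    using normal_moment_even[of "1/2" m 1] by (simp add: power2_eq_square)
  have 3: "has_bochner_integral lborel (\<lambda>z. normal_density m (1/2) z * (z - m)^3) 0"
    using normal_moment_odd[of "1/2" m 1] by (simp add: numeral_3_eq_3)
  have 4: "has_bochner_integral lborel (\<lambda>z. normal_density m (1/2) z * (z - m)^4) (3/16)"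
    using normal_moment_even[of "1/2" m 2] by (simp add: power2_eq_square fact_numeral)
  have "has_bochner_integral lborel
    (\<lambda>z. e0 * (normal_density m (1/2) z * (z - m)^0) + e1 * (normal_density m (1/2) z * (z - m)^1)
       + e2 * (normal_density m (1/2) z * (z - m)^2) + e3 * (normal_density m (1/2) z * (z - m)^3)
       + e4 * (normal_density m (1/2) z * (z - m)^4))
    (e0 * 1 + e1 * 0 + e2 * (1/4) + e3 * 0 + e4 * (3/16))"
    by (intro has_bochner_integral_add has_bochner_integral_mult_right 0 1 2 3 4)
  then show ?thesis by (simp add: algebra_simps)
qed

text \<open>Completing the square moves both centres to the midpoint and leaves a factor that
  depends on \<open>A - B\<close> alone.\<close>

lemma gaussian_product:
  fixes A B z :: real
  shows "exp (- ((z - A)^2)) * exp (- ((z - B)^2))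
    = sqrt (pi/2) * exp (- ((A - B)^2) / 2) * normal_density ((A + B)/2) (1/2) z"
proof -
  have "sqrt (pi/2) * (1 / sqrt (2 * pi * (1/2)\<^sup>2)) = 1"
    by (simp add: power2_eq_square)
  then have "sqrt (pi/2) * normal_density ((A + B)/2) (1/2) z = exp (- ((z - (A + B)/2)^2 * 2))"
    unfolding normal_density_def by (simp add: power2_eq_square)
  moreover have "- ((z - A)^2) + (- ((z - B)^2)) = - ((A - B)^2) / 2 + (- ((z - (A + B)/2)^2 * 2))"
    by (simp add: power2_eq_square field_simps)
  ultimately have "sqrt (pi/2) * normal_density ((A + B)/2) (1/2) z * exp (- ((A - B)^2) / 2)
      = exp (- ((z - A)^2) + (- ((z - B)^2)))"
    by (simp only: exp_add mult.commute)
  then show ?thesis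
    by (simp only: exp_add ac_simps)
qed

text \<open>With \<open>m\<close> the midpoint and \<open>D = A - B\<close>, substitute
  \<open>z - A = (z - m) - D/2\<close> and \<open>z - B = (z - m) + D/2\<close>. The coefficients
  here and in the next two lemmas come from expanding the polynomial factor in powers of
  \<open>z - m\<close>.\<close>

lemma herm00: "has_bochner_integral lborel (\<lambda>z. herm0 (z - A) * herm0 (z - B)) (sqrt (pi/2) / 4 * gker2 (A - B))"
proof -
  let ?m = "(A + B)/2" and ?D = "A - B"
  have "has_bochner_integral lborel (\<lambda>z. sqrt (pi/2) * exp (- (?D^2) / 2) * (normal_density ?m (1/2) z *
      (- (?D^2)/4 + 0 * (z - ?m) + 1 * (z - ?m)^2 + 0 * (z - ?m)^3 + 0 * (z - ?m)^4)))
      (sqrt (pi/2) * exp (- (?D^2) / 2) * (- (?D^2)/4 + 1 / 4 + 3 * 0 / 16))"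
    by (intro has_bochner_integral_mult_right gaussian_quartic_integral)
  moreover have "herm0 (z - A) * herm0 (z - B) = sqrt (pi/2) * exp (- (?D^2) / 2) * (normal_density ?m (1/2) z *
      (- (?D^2)/4 + 0 * (z - ?m) + 1 * (z - ?m)^2 + 0 * (z - ?m)^3 + 0 * (z - ?m)^4))" for z
  proof -
    have "herm0 (z - A) * herm0 (z - B) = (z - A) * (z - B) * (exp (- ((z - A)^2)) * exp (- ((z - B)^2)))"
      by (simp add: herm0_def)
    also have "(z - A) * (z - B) = - (?D^2)/4 + 0 * (z - ?m) + 1 * (z - ?m)^2 + 0 * (z - ?m)^3 + 0 * (z - ?m)^4"
      by (simp add: power2_eq_square field_simps)
    finally show ?thesis unfolding gaussian_product by (simp only: ac_simps)
  qed
  moreover have "sqrt (pi/2) * exp (- (?D^2) / 2) * (- (?D^2)/4 + 1 / 4 + 3 * 0 / 16) = sqrt (pi/2) / 4 * gker2 ?D"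
    by (simp add: gker2_def field_simps)
  ultimately show ?thesis by (simp only:)
qed

lemma herm10: "has_bochner_integral lborel (\<lambda>z. herm1 (z - A) * herm0 (z - B)) (sqrt (pi/2) / 4 * gker3 (A - B))"
proof -
  let ?m = "(A + B)/2" and ?D = "A - B"
  have "has_bochner_integral lborel (\<lambda>z. sqrt (pi/2) * exp (- (?D^2) / 2) * (normal_density ?m (1/2) z *
      ((?D/2 - ?D^3/4) + (1 + ?D^2/2) * (z - ?m) + ?D * (z - ?m)^2 + (-2) * (z - ?m)^3 + 0 * (z - ?m)^4)))
      (sqrt (pi/2) * exp (- (?D^2) / 2) * ((?D/2 - ?D^3/4) + ?D / 4 + 3 * 0 / 16))"
    by (intro has_bochner_integral_mult_right gaussian_quartic_integral)
  moreover have "herm1 (z - A) * herm0 (z - B) = sqrt (pi/2) * exp (- (?D^2) / 2) * (normal_density ?m (1/2) z *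
      ((?D/2 - ?D^3/4) + (1 + ?D^2/2) * (z - ?m) + ?D * (z - ?m)^2 + (-2) * (z - ?m)^3 + 0 * (z - ?m)^4))" for z
  proof -
    have "herm1 (z - A) * herm0 (z - B) = (1 - 2 * (z - A)^2) * (z - B) * (exp (- ((z - A)^2)) * exp (- ((z - B)^2)))"
      by (simp add: herm0_def herm1_def)
    also have "(1 - 2 * (z - A)^2) * (z - B) = ((?D/2 - ?D^3/4) + (1 + ?D^2/2) * (z - ?m) + ?D * (z - ?m)^2 + (-2) * (z - ?m)^3 + 0 * (z - ?m)^4)"
      by (simp add: power2_eq_square power3_eq_cube field_simps)
    finally show ?thesis unfolding gaussian_product by (simp only: ac_simps)
  qed
  moreover have "sqrt (pi/2) * exp (- (?D^2) / 2) * ((?D/2 - ?D^3/4) + ?D / 4 + 3 * 0 / 16) = sqrt (pi/2) / 4 * gker3 ?D"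
    by (simp add: gker3_def field_simps)
  ultimately show ?thesis by (simp only:)
qed

lemma herm11: "has_bochner_integral lborel (\<lambda>z. herm1 (z - A) * herm1 (z - B)) (sqrt (pi/2) / 4 * gker4 (A - B))"
proof -
  let ?m = "(A + B)/2" and ?D = "A - B"
  have "has_bochner_integral lborel (\<lambda>z. sqrt (pi/2) * exp (- (?D^2) / 2) * (normal_density ?m (1/2) z *
      ((1 - ?D^2 + ?D^4/4) + 0 * (z - ?m) + (-4 - 2 * ?D^2) * (z - ?m)^2 + 0 * (z - ?m)^3 + 4 * (z - ?m)^4)))
      (sqrt (pi/2) * exp (- (?D^2) / 2) * ((1 - ?D^2 + ?D^4/4) + (-4 - 2 * ?D^2) / 4 + 3 * 4 / 16))"
    by (intro has_bochner_integral_mult_right gaussian_quartic_integral)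
  moreover have "herm1 (z - A) * herm1 (z - B) = sqrt (pi/2) * exp (- (?D^2) / 2) * (normal_density ?m (1/2) z *
      ((1 - ?D^2 + ?D^4/4) + 0 * (z - ?m) + (-4 - 2 * ?D^2) * (z - ?m)^2 + 0 * (z - ?m)^3 + 4 * (z - ?m)^4))" for z
  proof -
    have "herm1 (z - A) * herm1 (z - B) = (1 - 2 * (z - A)^2) * (1 - 2 * (z - B)^2) * (exp (- ((z - A)^2)) * exp (- ((z - B)^2)))"
      by (simp add: herm1_def)
    also have "(1 - 2 * (z - A)^2) * (1 - 2 * (z - B)^2) = ((1 - ?D^2 + ?D^4/4) + 0 * (z - ?m) + (-4 - 2 * ?D^2) * (z - ?m)^2 + 0 * (z - ?m)^3 + 4 * (z - ?m)^4)"
      by (simp add: power2_eq_square power4_eq_xxxx field_simps)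
    finally show ?thesis unfolding gaussian_product by (simp only: ac_simps)
  qed
  moreover have "sqrt (pi/2) * exp (- (?D^2) / 2) * ((1 - ?D^2 + ?D^4/4) + (-4 - 2 * ?D^2) / 4 + 3 * 4 / 16) = sqrt (pi/2) / 4 * gker4 ?D"
    by (simp add: gker4_def field_simps)
  ultimately show ?thesis by (simp only:)
qed

lemma gker3_minus: "gker3 (- v) = - gker3 v"
  by (simp add: gker3_def left_diff_distrib)

lemma nonneg_of_mult_pos: "0 \<le> c * x \<Longrightarrow> 0 < c \<Longrightarrow> 0 \<le> x" for c x :: real
  by (simp add: zero_le_mult_iff)

lemma double_sum_scale:
  fixes C :: real
  shows "(\<Sum>i\<in>I. \<Sum>j\<in>J. u i * v j * (C * w i j)) = C * (\<Sum>i\<in>I. \<Sum>j\<in>J. u i * v j * w i j)"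
  unfolding sum_distrib_left by (intro sum.cong refl) simp

lemma double_sum_scale_swap:
  fixes C :: real
  shows "(\<Sum>i\<in>I. \<Sum>j\<in>J. u i * v j * (C * w j i)) = C * (\<Sum>j\<in>J. \<Sum>i\<in>I. v j * u i * w j i)"
  by (subst sum.swap, simp only: double_sum_scale mult.commute[of "u _"])

text \<open>
  Up to a constant, \<open>gker2\<close>, \<open>gker3\<close> and \<open>gker4\<close> are the correlations of \<open>herm0\<close> and its derivative
  \<open>herm1\<close>, so the sum below is the square integral of \<open>\<Sum>i\<in>I. c i * herm0 (z - A i) + d i * herm1 (z - A i)\<close>.
\<close>

lemma gker_psd:
  fixes c d A :: "'i \<Rightarrow> real"
  assumes "finite I"
  shows "0 \<le> (\<Sum>i\<in>I. \<Sum>j\<in>I. c i * c j * gker2 (A i - A j))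
      + 2 * (\<Sum>i\<in>I. \<Sum>j\<in>I. d i * c j * gker3 (A i - A j))
      + (\<Sum>i\<in>I. \<Sum>j\<in>I. d i * d j * gker4 (A i - A j))"
    (is "0 \<le> ?S2 + 2 * ?S3 + ?S4")
proof -
  let ?C = "sqrt (pi/2) / 4"
  let ?f = "\<lambda>i z. c i * herm0 (z - A i) + d i * herm1 (z - A i)"
  have "has_bochner_integral lborel (\<lambda>z. \<Sum>i\<in>I. \<Sum>j\<in>I.
      c i * c j * (herm0 (z - A i) * herm0 (z - A j)) + c i * d j * (herm1 (z - A j) * herm0 (z - A i))
      + d i * c j * (herm1 (z - A i) * herm0 (z - A j)) + d i * d j * (herm1 (z - A i) * herm1 (z - A j)))
     (\<Sum>i\<in>I. \<Sum>j\<in>I. c i * c j * (?C * gker2 (A i - A j)) + c i * d j * (?C * gker3 (A j - A i))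
      + d i * c j * (?C * gker3 (A i - A j)) + d i * d j * (?C * gker4 (A i - A j)))" (is "has_bochner_integral _ ?F ?V")
    by (intro has_bochner_integral_sum has_bochner_integral_add has_bochner_integral_mult_right
        herm00 herm10 herm11)
  moreover have "?F z = (\<Sum>i\<in>I. ?f i z)^2" for z
    unfolding power2_eq_square sum_product by (intro sum.cong refl) (simp add: algebra_simps)
  ultimately have "has_bochner_integral lborel (\<lambda>z. (\<Sum>i\<in>I. ?f i z)^2) ?V"
    by (simp only:)
  then have V: "0 \<le> ?V"
    using Bochner_Integration.integral_nonneg[of lborel "\<lambda>z. (\<Sum>i\<in>I. ?f i z)^2"]
    by (simp only: has_bochner_integral_integral_eq zero_le_power2 simp_thms)
  note scale = double_sum_scale[where u = c and v = c] double_sum_scale[where u = d and v = c]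
    double_sum_scale[where u = d and v = d] double_sum_scale_swap[where u = c and v = d and w = "\<lambda>i j. gker3 (A i - A j)"]
  have "?V = ?C * (?S2 + 2 * ?S3 + ?S4)"
    unfolding sum.distrib scale by (simp only: distrib_left)
  with V have "0 \<le> ?C * (?S2 + 2 * ?S3 + ?S4)"
    by (simp only:)
  moreover have "?C > 0"
    by simp
  ultimately show ?thesis
    by (rule nonneg_of_mult_pos)
qed

lemma gker2_psd:
  "finite I \<Longrightarrow> 0 \<le> (\<Sum>i\<in>I. \<Sum>j\<in>I. c i * c j * gker2 (A i - A j))"
  using gker_psd[of I c A "\<lambda>_. 0"] by simp

lemma gker4_psd:
  "finite I \<Longrightarrow> 0 \<le> (\<Sum>i\<in>I. \<Sum>j\<in>I. d i * d j * gker4 (A i - A j))"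
  using gker_psd[of I "\<lambda>_. 0" A d] by simp

text \<open>Positivity holds for \<open>d\<close> and for \<open>- d\<close>; together these are the
  Cauchy-Schwarz inequality in additive form. It will bound the derivative of \<open>HH\<close> by
  \<open>HH + DD\<close>.\<close>

lemma gker3_cross:
  assumes "finite I"
  shows "2 * \<bar>\<Sum>i\<in>I. \<Sum>j\<in>I. d i * c j * gker3 (A i - A j)\<bar>
     \<le> (\<Sum>i\<in>I. \<Sum>j\<in>I. c i * c j * gker2 (A i - A j)) + (\<Sum>i\<in>I. \<Sum>j\<in>I. d i * d j * gker4 (A i - A j))"
  using gker_psd[OF assms, of c A d] gker_psd[OF assms, of c A "\<lambda>i. - d i"]
  by (simp add: sum_negf abs_le_iff)

text \<open>Positivity of \<open>gker2\<close> on the disjoint union of both families, with weights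
  \<open>q * \<alpha>\<close> and \<open>\<beta>\<close>, divided by \<open>q\<close>. The free
  parameter \<open>q\<close> replaces the square roots of Cauchy-Schwarz and is later used to
  balance two powers of \<open>R\<close>.\<close>

lemma gker2_cross:
  fixes A :: "'i \<Rightarrow> real" and B :: "'j \<Rightarrow> real"
  assumes "finite I" "finite J" "0 < q"
  shows "- 2 * (\<Sum>i\<in>I. \<Sum>j\<in>J. \<alpha> i * \<beta> j * gker2 (A i - B j))
     \<le> q * (\<Sum>i\<in>I. \<Sum>i'\<in>I. \<alpha> i * \<alpha> i' * gker2 (A i - A i'))
      + (\<Sum>j\<in>J. \<Sum>j'\<in>J. \<beta> j * \<beta> j' * gker2 (B j - B j')) / q"
proof -
  let ?X = "\<Sum>i\<in>I. \<Sum>j\<in>J. \<alpha> i * \<beta> j * gker2 (A i - B j)"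
  let ?E = "\<Sum>i\<in>I. \<Sum>i'\<in>I. \<alpha> i * \<alpha> i' * gker2 (A i - A i')"
  let ?H = "\<Sum>j\<in>J. \<Sum>j'\<in>J. \<beta> j * \<beta> j' * gker2 (B j - B j')"
  let ?c = "case_sum (\<lambda>i. q * \<alpha> i) \<beta>"
  have ev: "gker2 (x - y) = gker2 (y - x)" for x y
    by (simp add: gker2_def power2_commute)
  have "0 \<le> (\<Sum>i\<in>I <+> J. \<Sum>j\<in>I <+> J. ?c i * ?c j * gker2 (case_sum A B i - case_sum A B j))"
    using assms by (intro gker2_psd) auto
  also have "\<dots> = (\<Sum>i\<in>I. \<Sum>i'\<in>I. q * \<alpha> i * (q * \<alpha> i') * gker2 (A i - A i'))
     + (\<Sum>i\<in>I. \<Sum>j\<in>J. q * \<alpha> i * \<beta> j * gker2 (A i - B j))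
     + ((\<Sum>j\<in>J. \<Sum>i\<in>I. \<beta> j * (q * \<alpha> i) * gker2 (B j - A i)) + ?H)"
    by (simp only: sum.Plus[OF assms(1,2)] sum.distrib o_def sum.case add.assoc add.left_commute)
  also have "(\<Sum>j\<in>J. \<Sum>i\<in>I. \<beta> j * (q * \<alpha> i) * gker2 (B j - A i)) = q * ?X"
  proof -
    have "(\<Sum>j\<in>J. \<Sum>i\<in>I. \<beta> j * (q * \<alpha> i) * gker2 (B j - A i)) = (\<Sum>j\<in>J. \<Sum>i\<in>I. \<beta> j * \<alpha> i * (q * gker2 (A i - B j)))"
      by (intro sum.cong refl) (simp add: ev[of "B _" "A _"])
    then show ?thesis
      using double_sum_scale_swap[where u = \<beta> and v = \<alpha> and C = q and w = "\<lambda>i j. gker2 (A i - B j)" and I = J and J = I]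
      by (simp only:)
  qed
  also have "(\<Sum>i\<in>I. \<Sum>j\<in>J. q * \<alpha> i * \<beta> j * gker2 (A i - B j)) = q * ?X"
    unfolding sum_distrib_left by (intro sum.cong refl) simp
  also have "(\<Sum>i\<in>I. \<Sum>i'\<in>I. q * \<alpha> i * (q * \<alpha> i') * gker2 (A i - A i')) = q * (q * ?E)"
    unfolding sum_distrib_left by (intro sum.cong refl) simp
  also have "q * (q * ?E) + q * ?X + (q * ?X + ?H) = q * (q * ?E + 2 * ?X + ?H / q)"
    using assms by (simp only: distrib_left) simp
  finally have "0 \<le> q * ?E + 2 * ?X + ?H / q"
    using assms(3) by (rule nonneg_of_mult_pos)
  then show ?thesis by linarith
qed

section \<open>Oscillatory integrals\<close>

lemma abs_le_one_plus_square: "\<bar>v\<bar> \<le> 1 + v^2" for v :: real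
  using zero_le_power2[of "\<bar>v\<bar> - 1"] zero_le_power2[of v]
  unfolding power2_diff by simp

lemma integral_of_deriv_error:
  fixes f F F' :: "real \<Rightarrow> real"
  assumes "l \<le> r" "f integrable_on {l..r}"
    and "\<And>b. b \<in> {l..r} \<Longrightarrow> (F has_real_derivative F' b) (at b)"
    and "\<And>b. b \<in> {l..r} \<Longrightarrow> \<bar>f b - F' b\<bar> \<le> g b" "g integrable_on {l..r}"
  shows "\<bar>integral {l..r} f\<bar> \<le> \<bar>F r - F l\<bar> + integral {l..r} g"
proof -
  have F: "(F' has_integral (F r - F l)) {l..r}"
    using assms(1,3) by (intro fundamental_theorem_of_calculus)
      (auto simp: has_real_derivative_iff_has_vector_derivative[symmetric] intro: DERIV_subset)
  have "\<bar>integral {l..r} (\<lambda>b. f b - F' b)\<bar> \<le> integral {l..r} g"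
    using integral_norm_bound_integral[of "\<lambda>b. f b - F' b" "{l..r}" g] assms(2,4,5) F
    by (auto intro!: integrable_diff)
  moreover have "integral {l..r} (\<lambda>b. f b - F' b) = integral {l..r} f - (F r - F l)"
    using F assms(2) by (subst Henstock_Kurzweil_Integration.integral_diff) (auto simp: integral_unique)
  ultimately show ?thesis by linarith
qed

text \<open>
  The relation \<open>q' = p + \<gamma> q\<close> with \<open>p\<close> bounded away from zero expresses that \<open>q\<close> and \<open>q'\<close> have no
  common zero; it lets one integrate by parts by writing \<open>1 = (q' - \<gamma> q) / p\<close>, without a case
  distinction on which of the two is large.
\<close>

locale phase =
  fixes l r :: real and q p p' \<gamma> :: "real \<Rightarrow> real" and m C :: real
  assumes lr: "l \<le> r"
    and q: "\<And>b. b \<in> {l..r} \<Longrightarrow> (q has_real_derivative p b + \<gamma> b * q b) (at b)"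
    and p: "\<And>b. b \<in> {l..r} \<Longrightarrow> (p has_real_derivative p' b) (at b)"
    and m: "0 < m" "\<And>b. b \<in> {l..r} \<Longrightarrow> m \<le> \<bar>p b\<bar>"
    and p': "\<And>b. b \<in> {l..r} \<Longrightarrow> \<bar>p' b\<bar> \<le> C * m"
    and \<gamma>: "\<And>b. b \<in> {l..r} \<Longrightarrow> \<bar>\<gamma> b\<bar> \<le> C"
begin

lemma C_nonneg: "0 \<le> C"
  using \<gamma>[of l] lr by auto

lemma cont_q: "continuous_on {l..r} q"
  using q by (meson DERIV_continuous_on DERIV_subset subset_UNIV has_field_derivative_at_within)

lemma p_nz: "b \<in> {l..r} \<Longrightarrow> p b \<noteq> 0"
  using m by fastforce

lemma inv_p: "b \<in> {l..r} \<Longrightarrow> \<bar>x / p b\<bar> \<le> \<bar>x\<bar> / m"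
  using m(1) m(2)[of b] by (simp add: divide_left_mono mult_pos_pos)

lemma inv_p': assumes "b \<in> {l..r}" shows "\<bar>p' b / (p b)^2\<bar> \<le> C / m"
proof -
  have "m * m \<le> \<bar>p b\<bar> * \<bar>p b\<bar>"
    using m assms by (intro mult_mono) auto
  then have "m\<^sup>2 \<le> (p b)^2" by (simp add: power2_eq_square flip: abs_mult)
  then have "\<bar>p' b / (p b)^2\<bar> \<le> (C * m) / m^2"
    using p'[OF assms] m(1) unfolding abs_divide
    by (intro frac_le) (auto simp: C_nonneg)
  also have "\<dots> = C / m" using m(1) by (simp add: power2_eq_square)
  finally show ?thesis .
qed

lemma deriv_quotient:
  assumes "b \<in> {l..r}" "(f has_real_derivative D) (at b)"
  shows "((\<lambda>b. f b / p b / R) has_real_derivative (D / p b - f b * (p' b / (p b)^2)) / R) (at b)"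
  using DERIV_cdivide[OF DERIV_divide[OF assms(2) p[OF assms(1)] p_nz[OF assms(1)]], of R] p_nz[OF assms(1)]
  by (simp add: diff_divide_distrib power2_eq_square)

text \<open>\<open>arctan (R * q b) / (p b * R)\<close> is an approximate antiderivative. The term
  with \<open>\<gamma>\<close> is harmless because \<open>v / (1 + v^2)\<close> is bounded, so every
  defect is of order \<open>1 / (R * m)\<close>.\<close>

lemma small_phase_integral:
  assumes "0 < R"
  shows "integral {l..r} (\<lambda>b. 1 / (1 + (R * q b)^2)) \<le> (4 + 3 * C * (r - l)) / (R * m)"
proof -
  let ?F = "\<lambda>b. arctan (R * q b) / p b / R"
  let ?F' = "\<lambda>b. (inverse (1 + (R * q b)^2) * (R * (p b + \<gamma> b * q b)) / p b - arctan (R * q b) * (p' b / (p b)^2)) / R"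
  have pos: "1 + x^2 \<noteq> 0" for x :: real
    using add_pos_nonneg[of 1 "x^2"] by auto
  have at: "\<bar>arctan x\<bar> \<le> 2" for x
    using arctan_lbound[of x] arctan_ubound[of x] pi_less_4 by linarith
  have F: "(?F has_real_derivative ?F' b) (at b)" if "b \<in> {l..r}" for b
    by (intro deriv_quotient[OF that] DERIV_chain2[OF DERIV_arctan] DERIV_cmult q[OF that])
  have bd: "\<bar>?F b\<bar> \<le> 2 / (R * m)" if "b \<in> {l..r}" for b
  proof -
    have "\<bar>arctan (R * q b) / p b\<bar> \<le> 2 / m"
      using inv_p[OF that, of "arctan (R * q b)"] divide_right_mono[OF at[of "R * q b"], of m] m(1) by linarith
    then have "\<bar>arctan (R * q b) / p b\<bar> / R \<le> 2 / m / R"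
      using assms by (intro divide_right_mono) auto
    then show ?thesis using assms by (simp add: abs_divide abs_mult ac_simps)
  qed
  have err: "\<bar>1 / (1 + (R * q b)^2) - ?F' b\<bar> \<le> 3 * C / (R * m)" if b: "b \<in> {l..r}" for b
  proof -
    let ?v = "R * q b"
    have v: "\<bar>?v / (1 + ?v^2)\<bar> \<le> 1"
      using abs_le_one_plus_square[of ?v] add_pos_nonneg[of 1 "?v^2"]
      by (simp add: abs_divide divide_le_eq_1_pos)
    have eq: "1 / (1 + ?v^2) - ?F' b = (arctan ?v * (p' b / (p b)^2) - \<gamma> b * (?v / (1 + ?v^2)) / p b) / R"
    proof -
      have "1 / d - (inverse d * (R * (x + g * y)) / x - e) / R = (e - g * (R * y / d) / x) / R"
        if "d \<noteq> 0" "x \<noteq> 0" for d x g y e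
        using that assms by (simp add: field_simps)
      from this[OF pos p_nz[OF b]] show ?thesis .
    qed
    have "\<bar>arctan ?v * (p' b / (p b)^2)\<bar> \<le> 2 * (C / m)"
      unfolding abs_mult using inv_p'[OF b] at by (intro mult_mono) auto
    moreover have "\<bar>\<gamma> b * (?v / (1 + ?v^2))\<bar> \<le> C * 1"
      unfolding abs_mult using v \<gamma>[OF b] C_nonneg by (intro mult_mono) auto
    then have "\<bar>\<gamma> b * (?v / (1 + ?v^2)) / p b\<bar> \<le> C / m"
      using inv_p[OF b, of "\<gamma> b * (?v / (1 + ?v^2))"] divide_right_mono[of "\<bar>\<gamma> b * (?v / (1 + ?v^2))\<bar>" C m] m(1)
      by linarith
    ultimately have "\<bar>arctan ?v * (p' b / (p b)^2) - \<gamma> b * (?v / (1 + ?v^2)) / p b\<bar> \<le> 2 * (C / m) + C / m"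
      by (intro order_trans[OF abs_triangle_ineq4] add_mono)
    also have "\<dots> = 3 * (C / m)" by simp
    finally have "\<bar>arctan ?v * (p' b / (p b)^2) - \<gamma> b * (?v / (1 + ?v^2)) / p b\<bar> / R \<le> 3 * (C / m) / R"
      using assms by (intro divide_right_mono) auto
    then show ?thesis unfolding eq using assms by (simp add: abs_divide ac_simps)
  qed
  have "\<bar>integral {l..r} (\<lambda>b. 1 / (1 + (R * q b)^2))\<bar> \<le> \<bar>?F r - ?F l\<bar> + integral {l..r} (\<lambda>_. 3 * C / (R * m))"
    by (rule integral_of_deriv_error[OF lr _ F err])
       (auto intro!: integrable_continuous_interval continuous_intros cont_q simp: pos)
  also have "\<dots> \<le> 4 / (R * m) + (3 * C / (R * m)) * (r - l)"
  proof (rule add_mono)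
    have "\<bar>?F r - ?F l\<bar> \<le> 2 / (R * m) + 2 / (R * m)"
      using bd[of l] bd[of r] lr by (intro order_trans[OF abs_triangle_ineq4] add_mono) auto
    then show "\<bar>?F r - ?F l\<bar> \<le> 4 / (R * m)" by simp
  qed (use lr in \<open>simp add: algebra_simps\<close>)
  also have "\<dots> = (4 + 3 * C * (r - l)) / (R * m)"
    by (simp add: add_divide_distrib)
  finally show ?thesis by linarith
qed

text \<open>One integration by parts yields two factors \<open>1 / (R * m)\<close>. The boundary
  terms vanish with \<open>\<sigma>\<close>; the defect is of order \<open>1 / (R * m)\<close> and
  still carries the decay \<open>1 / (1 + (R * q b)^2)\<close>, whose integral supplies the second
  factor. The bound on \<open>v * k v\<close> serves the \<open>\<gamma>\<close> term.\<close>

lemma oscillatory_integral: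
  assumes R: "0 < R"
    and K: "\<And>v. (K has_real_derivative k v) (at v)" "\<And>v. \<bar>K v\<bar> \<le> M / (1 + v^2)" "\<And>v. \<bar>v * k v\<bar> \<le> M / (1 + v^2)"
    and k: "continuous_on UNIV k"
    and \<sigma>: "\<And>b. b \<in> {l..r} \<Longrightarrow> (\<sigma> has_real_derivative \<sigma>' b) (at b)"
      "\<And>b. b \<in> {l..r} \<Longrightarrow> \<bar>\<sigma> b\<bar> \<le> S" "\<And>b. b \<in> {l..r} \<Longrightarrow> \<bar>\<sigma>' b\<bar> \<le> S" "\<sigma> l = 0" "\<sigma> r = 0"
  shows "\<bar>integral {l..r} (\<lambda>b. \<sigma> b * k (R * q b))\<bar> \<le> (1 + 2 * C) * S * M * (4 + 3 * C * (r - l)) / (R * m)^2"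
proof -
  let ?F = "\<lambda>b. \<sigma> b * K (R * q b) / p b / R"
  let ?F' = "\<lambda>b. (\<sigma>' b * K (R * q b) / p b + \<sigma> b * (k (R * q b) * (R * (p b + \<gamma> b * q b))) / p b
      - \<sigma> b * K (R * q b) * (p' b / (p b)^2)) / R"
  let ?B = "(1 + 2 * C) * S * M / (R * m)"
  have pos: "1 + x^2 > 0" for x :: real
    by (intro add_pos_nonneg) auto
  have S: "0 \<le> S" using \<sigma>(2)[of l] lr by auto
  have M: "0 \<le> M" using K(2)[of 0] by auto
  have DK: "((\<lambda>b. K (R * q b)) has_real_derivative k (R * q b) * (R * (p b + \<gamma> b * q b))) (at b)"
    if "b \<in> {l..r}" for b
    by (rule DERIV_chain2[OF K(1)]) (auto intro!: derivative_eq_intros q[OF that])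
  have F: "(?F has_real_derivative ?F' b) (at b)" if "b \<in> {l..r}" for b
    using deriv_quotient[OF that DERIV_mult[OF \<sigma>(1)[OF that] DK[OF that]], of R]
    by (simp only: add_divide_distrib mult.commute[of _ "\<sigma> b"])
  have err: "\<bar>\<sigma> b * k (R * q b) - ?F' b\<bar> \<le> ?B * (1 / (1 + (R * q b)^2))" if b: "b \<in> {l..r}" for b
  proof -
    let ?v = "R * q b" and ?w = "M / (1 + (R * q b)^2)"
    have w: "0 \<le> ?w" using M pos[of ?v] by simp
    have eq: "\<sigma> b * k ?v - ?F' b = - (\<sigma>' b * K ?v / p b + \<gamma> b * (\<sigma> b * (?v * k ?v)) / p b
        - \<sigma> b * K ?v * (p' b / (p b)^2)) / R"
    proof -
      have "s * k0 - (w / x + s * (k0 * (R * (x + g * y))) / x - e) / R = - (w / x + g * (s * (R * y * k0)) / x - e) / R"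
        if "x \<noteq> 0" for s k0 w x g y e
        using that R by (simp add: field_simps)
      from this[OF p_nz[OF b]] show ?thesis .
    qed
    have 1: "\<bar>\<sigma>' b * K ?v / p b\<bar> \<le> S * ?w / m"
    proof -
      have "\<bar>\<sigma>' b * K ?v\<bar> \<le> S * ?w"
        unfolding abs_mult using \<sigma>(3)[OF b] K(2)[of ?v] S by (intro mult_mono) auto
      then show ?thesis
        using inv_p[OF b, of "\<sigma>' b * K ?v"] divide_right_mono[of "\<bar>\<sigma>' b * K ?v\<bar>" "S * ?w" m] m(1) by linarith
    qed
    have 2: "\<bar>\<gamma> b * (\<sigma> b * (?v * k ?v)) / p b\<bar> \<le> C * (S * ?w) / m"
    proof -
      have "\<bar>\<sigma> b * (?v * k ?v)\<bar> \<le> S * ?w"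
        unfolding abs_mult[of "\<sigma> b"] using \<sigma>(2)[OF b] K(3)[of ?v] S by (intro mult_mono) auto
      then have "\<bar>\<gamma> b * (\<sigma> b * (?v * k ?v))\<bar> \<le> C * (S * ?w)"
        unfolding abs_mult[of "\<gamma> b"] using \<gamma>[OF b] C_nonneg by (intro mult_mono) auto
      then show ?thesis
        using inv_p[OF b, of "\<gamma> b * (\<sigma> b * (?v * k ?v))"]
          divide_right_mono[of "\<bar>\<gamma> b * (\<sigma> b * (?v * k ?v))\<bar>" "C * (S * ?w)" m] m(1) by linarith
    qed
    have 3: "\<bar>\<sigma> b * K ?v * (p' b / (p b)^2)\<bar> \<le> (S * ?w) * (C / m)"
    proof -
      have "\<bar>\<sigma> b * K ?v\<bar> \<le> S * ?w"
        unfolding abs_mult using \<sigma>(2)[OF b] K(2)[of ?v] S by (intro mult_mono) auto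
      then show ?thesis
        unfolding abs_mult[of "\<sigma> b * K ?v"] using inv_p'[OF b] S w by (intro mult_mono mult_nonneg_nonneg) auto
    qed
    have "\<bar>- (\<sigma>' b * K ?v / p b + \<gamma> b * (\<sigma> b * (?v * k ?v)) / p b - \<sigma> b * K ?v * (p' b / (p b)^2))\<bar>
        \<le> S * ?w / m + C * (S * ?w) / m + (S * ?w) * (C / m)"
      using 1 2 3 by linarith
    also have "S * w / m + C * (S * w) / m + (S * w) * (C / m) = (1 + 2 * C) * S * w / m" for w
      using m(1) by (simp add: field_simps)
    finally have "\<bar>- (\<sigma>' b * K ?v / p b + \<gamma> b * (\<sigma> b * (?v * k ?v)) / p b - \<sigma> b * K ?v * (p' b / (p b)^2))\<bar> / R
        \<le> (1 + 2 * C) * S * ?w / m / R"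
      using R by (intro divide_right_mono) auto
    then show ?thesis unfolding eq using R by (simp add: abs_divide ac_simps)
  qed
  have int1: "(\<lambda>b. 1 / (1 + (R * q b)^2)) integrable_on {l..r}"
    using pos by (intro integrable_continuous_interval continuous_intros cont_q) (auto simp: less_imp_neq[THEN not_sym])
  have int2: "(\<lambda>b. \<sigma> b * k (R * q b)) integrable_on {l..r}"
  proof (intro integrable_continuous_interval continuous_intros)
    show "continuous_on {l..r} \<sigma>"
      using \<sigma>(1) by (meson DERIV_continuous_on has_field_derivative_at_within)
    show "continuous_on {l..r} (\<lambda>b. k (R * q b))"
      by (rule continuous_on_compose2[OF k]) (auto intro!: continuous_intros cont_q)
  qed
  have "\<bar>integral {l..r} (\<lambda>b. \<sigma> b * k (R * q b))\<bar>
      \<le> \<bar>?F r - ?F l\<bar> + integral {l..r} (\<lambda>b. ?B * (1 / (1 + (R * q b)^2)))"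
    by (rule integral_of_deriv_error[OF lr int2 F err]) (use integrable_on_cmult_left[OF int1, of ?B] in simp_all)
  also have "\<dots> = ?B * integral {l..r} (\<lambda>b. 1 / (1 + (R * q b)^2))"
    unfolding integral_mult_right by (simp add: \<sigma>(4,5))
  also have "\<dots> \<le> ?B * ((4 + 3 * C * (r - l)) / (R * m))"
    using C_nonneg S M R m by (intro mult_left_mono small_phase_integral) auto
  also have "\<dots> = (1 + 2 * C) * S * M * (4 + 3 * C * (r - l)) / (R * m)^2"
    by (simp add: power2_eq_square)
  finally show ?thesis .
qed

end

section \<open>Decay of the kernels and transversality of the phases\<close>

lemma exp_decay: "exp (- (v^2) / 2) \<le> 4096 / (1 + v^2)^4" for v :: real
proof -
  \<comment> \<open>The fourth power of \<open>1 + x \<le> exp x\<close> at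
    \<open>x = v^2 / 8\<close>. A fourth power leaves one factor \<open>1 + v^2\<close> in the
    denominator after cubic expressions in \<open>1 + v^2\<close> have been absorbed.\<close>
  have "(1 + v^2)^4 \<le> (8 * (1 + v^2 / 8))^4"
    by (intro power_mono) auto
  also have "\<dots> = 4096 * (1 + v^2 / 8)^4"
    by (simp only: power_mult_distrib) simp
  also have "(1 + v^2 / 8)^4 \<le> exp (v^2 / 8)^4"
    by (intro power_mono exp_ge_add_one_self) auto
  also have "exp (v^2 / 8)^4 = exp (v^2 / 2)"
    by (simp flip: exp_of_nat_mult)
  finally have 1: "(1 + v^2)^4 \<le> 4096 * exp (v^2 / 2)" by simp
  have 2: "0 < (1 + v^2)^4"
    by (intro zero_less_power add_pos_nonneg) auto
  have "inverse y \<le> 4096 / x" if "x \<le> 4096 * y" "0 < x" "0 < y" for x y :: real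
    using that by (simp add: field_simps)
  from this[OF 1 2 exp_gt_zero] show ?thesis
    by (simp add: exp_minus)
qed

lemma poly_exp_decay:
  fixes v x :: real
  assumes "\<bar>x\<bar> \<le> 3 * (1 + v^2)^3"
  shows "\<bar>x * exp (- (v^2) / 2)\<bar> \<le> 12288 / (1 + v^2)"
proof -
  have pos: "0 < 1 + v^2" by (simp add: add_pos_nonneg)
  have "\<bar>x * exp (- (v^2) / 2)\<bar> = \<bar>x\<bar> * exp (- (v^2) / 2)" by (simp add: abs_mult)
  also have "\<dots> \<le> (3 * (1 + v^2)^3) * (4096 / (1 + v^2)^4)"
    using assms exp_decay[of v] by (intro mult_mono) auto
  also have "\<dots> = 12288 / (1 + v^2)"
  proof -
    have "(3 * c) * (4096 / (s * c)) = 12288 / s" if "0 < s" "0 < c" for s c :: real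
      using that by simp
    from this[OF pos zero_less_power[OF pos, of 3]] show ?thesis
      by (simp only: power4_eq_xxxx power3_eq_cube mult.assoc)
  qed
  finally show ?thesis .
qed

lemma poly_bounds:
  fixes v :: real
  defines "s \<equiv> 1 + v^2"
  shows "\<bar>v\<bar> \<le> s" "\<bar>1 - v^2\<bar> \<le> s" "\<bar>3 - v^2\<bar> \<le> 3 * s" "\<bar>3 - 6 * v^2 + v^4\<bar> \<le> 3 * s^2" "1 \<le> s"
    "s \<le> s^3" "s^2 \<le> s^3"
proof -
  show "\<bar>v\<bar> \<le> s" unfolding s_def by (rule abs_le_one_plus_square)
  have v: "0 \<le> v^2" by simp
  then show "\<bar>1 - v^2\<bar> \<le> s" unfolding s_def by linarith
  show "\<bar>3 - v^2\<bar> \<le> 3 * s" using v unfolding s_def abs_le_iff by simp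
  show s: "1 \<le> s" using v unfolding s_def by linarith
  have "v^4 = (v^2)^2" by simp
  then show "\<bar>3 - 6 * v^2 + v^4\<bar> \<le> 3 * s^2"
    using zero_le_power2[of "v^2"] v unfolding s_def power2_sum by (simp add: abs_le_iff)
  show "s \<le> s^3" "s^2 \<le> s^3" using s power_increasing[of 1 3 s] power_increasing[of 2 3 s] by auto
qed

text \<open>Exactly the decay hypotheses for two pairs of antiderivative and kernel:
  \<open>v * exp (- (v^2) / 2)\<close> with \<open>gker2\<close>, and \<open>gker3\<close> with
  \<open>gker4\<close>.\<close>

lemma gker_bounds:
  "\<bar>gker2 v\<bar> \<le> 12288 / (1 + v^2)" "\<bar>v * gker2 v\<bar> \<le> 12288 / (1 + v^2)"
  "\<bar>v * exp (- (v^2) / 2)\<bar> \<le> 12288 / (1 + v^2)" "\<bar>gker3 v\<bar> \<le> 12288 / (1 + v^2)"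
  "\<bar>gker4 v\<bar> \<le> 12288 / (1 + v^2)" "\<bar>v * gker4 v\<bar> \<le> 12288 / (1 + v^2)"
proof -
  note b = poly_bounds[of v]
  have m: "\<bar>v * x\<bar> \<le> (1 + v^2) * c" if "\<bar>x\<bar> \<le> c" for x c
    unfolding abs_mult using b(1,5) that by (intro mult_mono) auto
  have m2: "\<bar>v * x\<bar> \<le> 3 * (1 + v^2)^3" if "\<bar>x\<bar> \<le> 3 * (1 + v^2)" for x
  proof -
    have "(1 + v^2) * (3 * (1 + v^2)) = 3 * (1 + v^2)^2"
      by (simp only: power2_eq_square ac_simps)
    then show ?thesis using m[OF that] b(7) by linarith
  qed
  have b2: "\<bar>1 - v^2\<bar> \<le> 3 * (1 + v^2)"
    using b(2,5) by argo
  show "\<bar>gker2 v\<bar> \<le> 12288 / (1 + v^2)" unfolding gker2_def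
    by (rule poly_exp_decay) (use b in linarith)
  show "\<bar>v * exp (- (v^2) / 2)\<bar> \<le> 12288 / (1 + v^2)"
    by (rule poly_exp_decay) (use b in linarith)
  show "\<bar>gker4 v\<bar> \<le> 12288 / (1 + v^2)" unfolding gker4_def
    by (rule poly_exp_decay) (use b in linarith)
  show "\<bar>v * gker2 v\<bar> \<le> 12288 / (1 + v^2)" unfolding gker2_def mult.assoc[symmetric]
    by (rule poly_exp_decay) (rule m2[OF b2])
  show "\<bar>v * gker4 v\<bar> \<le> 12288 / (1 + v^2)" unfolding gker4_def mult.assoc[symmetric]
    by (rule poly_exp_decay) (use m[OF b(4)] in \<open>simp only: power2_eq_square power3_eq_cube ac_simps\<close>)
  have "3 * v - v^3 = v * (3 - v^2)" by (simp add: algebra_simps power2_eq_square power3_eq_cube)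
  then show "\<bar>gker3 v\<bar> \<le> 12288 / (1 + v^2)" unfolding gker3_def
    by (intro poly_exp_decay) (simp only: m2 b(3))
qed

lemma gker_derivs:
  "((\<lambda>v. v * exp (- (v^2) / 2)) has_real_derivative gker2 v) (at v)"
  "(gker2 has_real_derivative - gker3 v) (at v)"
  "(gker3 has_real_derivative gker4 v) (at v)"
  unfolding gker2_def gker3_def gker4_def
  by (auto intro!: derivative_eq_intros simp: algebra_simps power2_eq_square power3_eq_cube power4_eq_xxxx)

lemma continuous_gker: "continuous_on A gker2" "continuous_on A gker4"
  unfolding gker2_def gker4_def by (auto intro!: continuous_intros)

text \<open>Since \<open>1 / (z - b)\<close> has its own square as derivative in \<open>b\<close>,
  the difference \<open>du\<close> has derivative \<open>du * su\<close>. Subtracting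
  \<open>su v v'\<close> times the whole phase from its derivative eliminates the pair
  \<open>v, v'\<close> and leaves \<open>\<alpha> * du z z' * (su z z' - su v v')\<close>. This is
  bounded away from zero because \<open>du z z'\<close> is comparable to \<open>z' - z\<close> and
  the sums \<open>su\<close> are separated.\<close>

lemma phase_difference:
  fixes z z' v v' \<alpha> \<beta> \<delta> D \<kappa> l r :: real
  defines "du \<equiv> \<lambda>z z' b. 1 / (z - b) - 1 / (z' - b)"
    and "su \<equiv> \<lambda>z z' b. 1 / (z - b) + 1 / (z' - b)"
    and "sq \<equiv> \<lambda>z z' b. 1 / (z - b)^2 + 1 / (z' - b)^2"
  assumes lr: "l \<le> r" and \<delta>: "0 < \<delta>" and \<kappa>: "0 < \<kappa>"
    and rng: "\<And>b w. b \<in> {l..r} \<Longrightarrow> w \<in> {z, z', v, v'} \<Longrightarrow> \<delta> \<le> w - b \<and> w - b \<le> D"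
    and sep: "\<And>b. b \<in> {l..r} \<Longrightarrow> \<kappa> \<le> \<bar>su z z' b - su v v' b\<bar>"
    and nz: "\<alpha> \<noteq> 0" "z \<noteq> z'"
  shows "phase l r (\<lambda>b. \<alpha> * du z z' b + \<beta> * du v v' b)
    (\<lambda>b. \<alpha> * du z z' b * (su z z' b - su v v' b))
    (\<lambda>b. \<alpha> * du z z' b * (su z z' b * (su z z' b - su v v' b) + (sq z z' b - sq v v' b)))
    (su v v') (\<bar>\<alpha>\<bar> * \<bar>z - z'\<bar> * \<kappa> / D^2) (2 / \<delta> + 12 * D^2 / (\<kappa> * \<delta>^4))"
proof
  have D: "\<delta> \<le> D" using rng[of l z] lr by force
  have pos: "w - b > 0" "w - b \<noteq> 0" if "b \<in> {l..r}" "w \<in> {z, z', v, v'}" for b w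
    using rng[OF that] \<delta> by auto
  have inv: "0 < 1 / (w - b)" "1 / (w - b) \<le> 1 / \<delta>" "1 / D \<le> 1 / (w - b)" if "b \<in> {l..r}" "w \<in> {z, z', v, v'}" for b w
    using rng[OF that] \<delta> pos[OF that] by (auto intro!: divide_left_mono)
  have inv2: "0 \<le> 1 / (w - b)^2" "1 / (w - b)^2 \<le> 1 / \<delta>^2" if "b \<in> {l..r}" "w \<in> {z, z', v, v'}" for b w
    using rng[OF that] \<delta> by (auto intro!: divide_left_mono power_mono)
  have d1: "((\<lambda>b. 1 / (w - b)) has_real_derivative 1 / (w - b)^2) (at b)" if "b \<in> {l..r}" "w \<in> {z, z', v, v'}" for b w
    using pos(2)[OF that] by (auto intro!: derivative_eq_intros simp: power2_eq_square)
  have d2: "((\<lambda>b. du w w' b) has_real_derivative du w w' b * su w w' b) (at b)"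
    if "b \<in> {l..r}" "w \<in> {z, z', v, v'}" "w' \<in> {z, z', v, v'}" for b w w'
    using DERIV_diff[OF d1[OF that(1,2)] d1[OF that(1,3)]]
    by (simp add: du_def su_def algebra_simps power2_eq_square)
  have d3: "((\<lambda>b. su w w' b) has_real_derivative sq w w' b) (at b)"
    if "b \<in> {l..r}" "w \<in> {z, z', v, v'}" "w' \<in> {z, z', v, v'}" for b w w'
    unfolding su_def sq_def by (intro DERIV_add d1 that)
  have du: "du z z' b = (z' - z) * (1 / (z - b) * (1 / (z' - b)))" if "b \<in> {l..r}" for b
    using pos(2)[OF that, of z] pos(2)[OF that, of z'] by (simp add: du_def field_simps)
  have su: "\<bar>su z z' b\<bar> \<le> 2 / \<delta>" "\<bar>su v v' b\<bar> \<le> 2 / \<delta>" if "b \<in> {l..r}" for b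
    using inv[OF that, of z] inv[OF that, of z'] inv[OF that, of v] inv[OF that, of v'] unfolding su_def by auto
  have sq: "\<bar>sq z z' b - sq v v' b\<bar> \<le> 2 * (1 / \<delta>^2)" if "b \<in> {l..r}" for b
  proof -
    have four: "\<bar>a1 + a2 - (a3 + a4)\<bar> \<le> 2 * e"
      if "0 \<le> a1" "a1 \<le> e" "0 \<le> a2" "a2 \<le> e" "0 \<le> a3" "a3 \<le> e" "0 \<le> a4" "a4 \<le> e"
      for a1 a2 a3 a4 e :: real
      using that by linarith
    show ?thesis
      unfolding sq_def by (rule four) (use inv2[OF that] in \<open>simp_all only: insert_iff simp_thms\<close>)
  qed
  show "l \<le> r" by fact
  show "0 < \<bar>\<alpha>\<bar> * \<bar>z - z'\<bar> * \<kappa> / D^2" using nz \<kappa> D \<delta> by simp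
  fix b assume b: "b \<in> {l..r}"
  have "((\<lambda>b. \<alpha> * du z z' b + \<beta> * du v v' b) has_real_derivative \<alpha> * (du z z' b * su z z' b) + \<beta> * (du v v' b * su v v' b)) (at b)"
    by (intro DERIV_add DERIV_cmult d2 b) auto
  then show "((\<lambda>b. \<alpha> * du z z' b + \<beta> * du v v' b) has_real_derivative
      \<alpha> * du z z' b * (su z z' b - su v v' b) + su v v' b * (\<alpha> * du z z' b + \<beta> * du v v' b)) (at b)"
    by (simp add: algebra_simps)
  have "((\<lambda>b. \<alpha> * du z z' b * (su z z' b - su v v' b)) has_real_derivative
      \<alpha> * (du z z' b * su z z' b) * (su z z' b - su v v' b) + (sq z z' b - sq v v' b) * (\<alpha> * du z z' b)) (at b)"
    by (intro DERIV_mult DERIV_diff DERIV_cmult d2 d3 b) auto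
  then show "((\<lambda>b. \<alpha> * du z z' b * (su z z' b - su v v' b)) has_real_derivative
      \<alpha> * du z z' b * (su z z' b * (su z z' b - su v v' b) + (sq z z' b - sq v v' b))) (at b)"
    by (simp add: algebra_simps)
  show "\<bar>su v v' b\<bar> \<le> 2 / \<delta> + 12 * D^2 / (\<kappa> * \<delta>^4)"
    using su(2)[OF b] \<kappa> \<delta> by (intro add_increasing2) auto
  have e: "\<bar>\<alpha> * du z z' b\<bar> = \<bar>\<alpha>\<bar> * \<bar>z - z'\<bar> * (1 / (z - b) * (1 / (z' - b)))"
    using pos(1)[OF b, of z] pos(1)[OF b, of z'] unfolding du[OF b] by (simp add: abs_mult abs_minus_commute)
  have "1 / D^2 \<le> 1 / (z - b) * (1 / (z' - b))"
    using mult_mono[OF inv(3)[OF b, of z] inv(3)[OF b, of z']] inv(1)[OF b, of z] \<delta> D by (simp add: power2_eq_square)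
  then have "\<bar>\<alpha>\<bar> * \<bar>z - z'\<bar> * (1 / D^2) \<le> \<bar>\<alpha> * du z z' b\<bar>"
    unfolding e by (intro mult_left_mono) auto
  then have "\<bar>\<alpha>\<bar> * \<bar>z - z'\<bar> * (1 / D^2) * \<kappa> \<le> \<bar>\<alpha> * du z z' b\<bar> * \<bar>su z z' b - su v v' b\<bar>"
    using sep[OF b] \<kappa> by (intro mult_mono) auto
  then show "\<bar>\<alpha>\<bar> * \<bar>z - z'\<bar> * \<kappa> / D^2 \<le> \<bar>\<alpha> * du z z' b * (su z z' b - su v v' b)\<bar>"
    by (simp add: abs_mult)
  have "1 / (z - b) * (1 / (z' - b)) \<le> 1 / \<delta>^2"
    using mult_mono[OF inv(2)[OF b, of z] inv(2)[OF b, of z']] inv(1)[OF b, of z'] \<delta> by (simp add: power2_eq_square)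
  then have A: "\<bar>\<alpha> * du z z' b\<bar> \<le> \<bar>\<alpha>\<bar> * \<bar>z - z'\<bar> * (1 / \<delta>^2)"
    unfolding e by (intro mult_left_mono) auto
  have B: "\<bar>su z z' b * (su z z' b - su v v' b) + (sq z z' b - sq v v' b)\<bar> \<le> (2 / \<delta>) * (4 / \<delta>) + 2 * (1 / \<delta>^2)"
  proof -
    have "\<bar>su z z' b - su v v' b\<bar> \<le> 2 / \<delta> + 2 / \<delta>"
      using su[OF b] by (intro order_trans[OF abs_triangle_ineq4] add_mono)
    then have "\<bar>su z z' b - su v v' b\<bar> \<le> 4 / \<delta>" by simp
    then have "\<bar>su z z' b * (su z z' b - su v v' b)\<bar> \<le> (2 / \<delta>) * (4 / \<delta>)"
      unfolding abs_mult using su(1)[OF b] \<delta> by (intro mult_mono) auto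
    then show ?thesis using sq[OF b] by (intro order_trans[OF abs_triangle_ineq] add_mono)
  qed
  have "\<bar>\<alpha> * du z z' b * (su z z' b * (su z z' b - su v v' b) + (sq z z' b - sq v v' b))\<bar>
      \<le> (\<bar>\<alpha>\<bar> * \<bar>z - z'\<bar> * (1 / \<delta>^2)) * ((2 / \<delta>) * (4 / \<delta>) + 2 * (1 / \<delta>^2))"
    unfolding abs_mult[of "\<alpha> * du z z' b"] by (intro mult_mono A B) auto
  also have "\<dots> \<le> (\<bar>\<alpha>\<bar> * \<bar>z - z'\<bar>) * (12 / \<delta>^4)"
  proof -
    have "(1 / \<delta>^2) * ((2 / \<delta>) * (4 / \<delta>) + 2 * (1 / \<delta>^2)) = 10 / \<delta>^4"
      using \<delta> by (simp add: field_simps power2_eq_square power4_eq_xxxx)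
    moreover have "10 / \<delta>^4 \<le> 12 / \<delta>^4" using \<delta> by (intro divide_right_mono) auto
    ultimately have "(1 / \<delta>^2) * ((2 / \<delta>) * (4 / \<delta>) + 2 * (1 / \<delta>^2)) \<le> 12 / \<delta>^4" by linarith
    then show ?thesis unfolding mult.assoc by (intro mult_left_mono) auto
  qed
  also have "\<dots> = 12 * D^2 / (\<kappa> * \<delta>^4) * (\<bar>\<alpha>\<bar> * \<bar>z - z'\<bar> * \<kappa> / D^2)"
    using \<kappa> \<delta> D by simp
  also have "\<dots> \<le> (2 / \<delta> + 12 * D^2 / (\<kappa> * \<delta>^4)) * (\<bar>\<alpha>\<bar> * \<bar>z - z'\<bar> * \<kappa> / D^2)"
    using \<kappa> \<delta> by (intro mult_right_mono) auto
  finally show "\<bar>\<alpha> * du z z' b * (su z z' b * (su z z' b - su v v' b) + (sq z z' b - sq v v' b))\<bar>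
      \<le> (2 / \<delta> + 12 * D^2 / (\<kappa> * \<delta>^4)) * (\<bar>\<alpha>\<bar> * \<bar>z - z'\<bar> * \<kappa> / D^2)" .
qed

text \<open>Both factors of the product are at most \<open>1 + R * max u v\<close>, so quadratic
  decay in the larger variable gives linear decay in each. The product form is what makes the later
  energy factorise.\<close>

lemma combine_decay:
  fixes I N A R u v :: real
  assumes R: "0 < R" and uv: "0 \<le> u" "0 \<le> v" and AN: "0 \<le> A" "0 \<le> N" and A: "\<bar>I\<bar> \<le> A"
    and u: "u > 0 \<Longrightarrow> \<bar>I\<bar> \<le> N / (R * u)^2" and v: "v > 0 \<Longrightarrow> \<bar>I\<bar> \<le> N / (R * v)^2"
  shows "\<bar>I\<bar> \<le> 4 * (A + N) / ((1 + R * u) * (1 + R * v))"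
proof -
  define d where "d = max u v"
  have d: "u \<le> d" "v \<le> d" "0 \<le> d" using uv by (auto simp: d_def)
  have Rd: "R * u \<le> R * d" "R * v \<le> R * d" "0 \<le> R * d" using R d by auto
  have P: "0 < (1 + R * u) * (1 + R * v)" using R uv by (intro mult_pos_pos add_pos_nonneg) auto
  have le: "(1 + R * u) * (1 + R * v) \<le> (1 + R * d) * (1 + R * d)"
    using Rd R uv by (intro mult_mono) auto
  show ?thesis
  proof (cases "R * d \<le> 1")
    case True
    then have "(1 + R * d) * (1 + R * d) \<le> 2 * 2"
      using Rd by (intro mult_mono) auto
    then have 4: "(1 + R * u) * (1 + R * v) \<le> 4" using le by simp
    have "A * ((1 + R * u) * (1 + R * v)) \<le> A * 4" using 4 AN by (intro mult_left_mono) auto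
    also have "\<dots> \<le> 4 * (A + N)" using AN by simp
    finally have "A \<le> 4 * (A + N) / ((1 + R * u) * (1 + R * v))" using P by (simp add: pos_le_divide_eq)
    then show ?thesis using A by simp
  next
    case False
    then have "d \<noteq> 0" by auto
    then have d0: "d > 0" using d(3) by simp
    have "(1 + R * d) * (1 + R * d) \<le> (2 * (R * d)) * (2 * (R * d))"
      using False Rd by (intro mult_mono) auto
    then have le2: "(1 + R * u) * (1 + R * v) \<le> 4 * (R * d)^2" using le by (simp add: power2_eq_square)
    have "\<bar>I\<bar> \<le> N / (R * d)^2"
    proof (cases "u \<le> v")
      case True
      then have "d = v" by (simp add: d_def)
      then show ?thesis using v d0 by simp
    next
      case False
      then have "d = u" by (simp add: d_def)
      then show ?thesis using u d0 by simp
    qed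
    also have "\<dots> = 4 * N / (4 * (R * d)^2)" by simp
    also have "\<dots> \<le> 4 * (A + N) / ((1 + R * u) * (1 + R * v))"
      using le2 P AN by (intro frac_le) auto
    finally show ?thesis .
  qed
qed

section \<open>The phase as a function of the first point, and its oscillation\<close>

definition bphase :: "real \<Rightarrow> real \<Rightarrow> real \<Rightarrow> real \<Rightarrow> real" where
  "bphase t x y b = t / (y - b) - (t - 1) / (x - b)"

definition bphase' :: "real \<Rightarrow> real \<Rightarrow> real \<Rightarrow> real \<Rightarrow> real" where
  "bphase' t x y b = t / (y - b)^2 - (t - 1) / (x - b)^2"

lemma inverse_square_deriv:
  fixes w b c :: real
  assumes "w - b \<noteq> 0"
  shows "((\<lambda>b. c / (w - b)^2) has_real_derivative 2 * c * (1 / (w - b))^3) (at b)"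
proof -
  have "((\<lambda>b. 1 / (w - b)) has_real_derivative 1 / (w - b)^2) (at b)"
    using assms by (auto intro!: derivative_eq_intros simp: power2_eq_square)
  from DERIV_cmult[OF DERIV_power[OF this, of 2], of c] show ?thesis
    by (simp add: power_one_over power2_eq_square power3_eq_cube mult.commute[of c])
qed

text \<open>
  The first point ranges over \<open>{l..r}\<close>, enlarged by multiples of \<open>\<eta>\<close> to make room for a cut-off;
  the other three points range over \<open>{p2..q2}\<close>, \<open>{p3..q3}\<close>, \<open>{p4..q4}\<close>, and \<open>t\<close> over \<open>{1 + \<tau>..T}\<close>.
\<close>

locale config =
  fixes l r \<eta> \<delta> D \<tau> T p2 q2 p3 q3 p4 q4 :: real
  assumes lr: "l \<le> r" and \<eta>: "0 < \<eta>" and \<delta>: "0 < \<delta>" and \<tau>: "0 < \<tau>"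
    and sep: "r + 2 * \<eta> + \<delta> \<le> p2" "p2 \<le> q2" "q2 + \<delta> \<le> p3" "p3 \<le> q3" "q3 + \<delta> \<le> p4" "p4 \<le> q4"
    and D: "q4 - (l - \<eta>) \<le> D"
begin

abbreviation "l' \<equiv> l - \<eta>"
abbreviation "r' \<equiv> r + 2 * \<eta>"
abbreviation "JJ \<equiv> {p2..q2} \<union> {p3..q3} \<union> {p4..q4}"

lemma lr': "l' \<le> r'" using lr \<eta> by simp

lemma range: assumes "b \<in> {l'..r'}" "x \<in> JJ" shows "\<delta> \<le> x - b" "x - b \<le> D"
  using assms sep D \<delta> by auto

lemma \<delta>D: "\<delta> \<le> D"
  using range[of l' p2] lr' sep by auto

lemma range_inv:
  assumes "b \<in> {l'..r'}" "x \<in> JJ"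
  shows "0 < 1 / (x - b)" "1 / (x - b) \<le> 1 / \<delta>" "1 / D \<le> 1 / (x - b)" "x - b \<noteq> 0"
  using range[OF assms] \<delta> by (auto intro!: divide_left_mono)

lemma bphase_deriv:
  assumes "b \<in> {l'..r'}" "x \<in> JJ" "y \<in> JJ"
  shows "(bphase t x y has_real_derivative bphase' t x y b) (at b)"
  unfolding bphase_def[abs_def] bphase'_def using range_inv(4)[OF assms(1,2)] range_inv(4)[OF assms(1,3)]
  by (auto intro!: derivative_eq_intros simp: power2_eq_square)

lemma bphase'_deriv:
  assumes "b \<in> {l'..r'}" "x \<in> JJ" "y \<in> JJ"
  shows "(bphase' t x y has_real_derivative 2 * t * (1 / (y - b))^3 - 2 * (t - 1) * (1 / (x - b))^3) (at b)"
  unfolding bphase'_def[abs_def]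
  by (intro DERIV_diff inverse_square_deriv range_inv(4)[OF assms(1,2)] range_inv(4)[OF assms(1,3)])

text \<open>\<open>\<kappa>\<close> is twice the bound of \<open>sep_lower\<close>, one for each
  term of a sum \<open>su\<close>; \<open>Cph\<close> is the constant of
  \<open>phase_difference\<close>; \<open>cph\<close> turns the distance of two points into a lower
  bound for \<open>m\<close>; the factor 4 of \<open>Cosc\<close> stems from
  \<open>combine_decay\<close>.\<close>

definition "\<kappa> = 2 * \<delta> / D^2"
definition "Cph = 2 / \<delta> + 12 * D^2 / (\<kappa> * \<delta>^4)"
definition "cph = \<tau> * \<kappa> / D^2"
definition "Cosc = 4 * (r' - l' + (1 + 2 * Cph) * (4 + 3 * Cph * (r' - l')) / cph^2)"

lemma const_pos: "0 < \<kappa>" "0 < Cph" "0 < cph" "0 \<le> Cosc"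
proof -
  show k: "0 < \<kappa>" using \<delta> \<delta>D unfolding \<kappa>_def by auto
  show c: "0 < Cph" using k \<delta> \<delta>D unfolding Cph_def by (intro add_pos_nonneg) auto
  show d: "0 < cph" using k \<tau> \<delta> \<delta>D unfolding cph_def by auto
  show "0 \<le> Cosc" using c d lr' unfolding Cosc_def by auto
qed

lemma sep_lower:
  assumes "b \<in> {l'..r'}" "x \<in> JJ" "y \<in> JJ" "x + \<delta> \<le> y"
  shows "\<delta> / D^2 \<le> 1 / (x - b) - 1 / (y - b)"
proof -
  note x = range_inv[OF assms(1,2)] and y = range_inv[OF assms(1,3)]
  have "1 / (x - b) - 1 / (y - b) = (y - x) * (1 / (x - b) * (1 / (y - b)))"
    using x(4) y(4) by (simp add: field_simps)
  moreover have "1 / D^2 \<le> 1 / (x - b) * (1 / (y - b))"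
    using mult_mono[OF x(3) y(3)] x(1) \<delta> \<delta>D by (simp add: power2_eq_square)
  then have "\<delta> * (1 / D^2) \<le> (y - x) * (1 / (x - b) * (1 / (y - b)))"
    using assms(4) \<delta> by (intro mult_mono) auto
  ultimately show ?thesis by simp
qed

text \<open>The phase difference is a combination of the differences for \<open>x, x'\<close> and
  for \<open>y, y'\<close>. Either pair may take the leading role in
  \<open>phase_difference\<close>, with coefficient \<open>-(t - 1)\<close> or \<open>t\<close>,
  both of modulus at least \<open>\<tau>\<close>. This gives quadratic decay in each
  distance.\<close>

lemma oscillation_pair:
  assumes R: "0 < R" and t: "1 + \<tau> \<le> t" and x: "x \<in> {p2..q2}" "x' \<in> {p2..q2}" and y: "y \<in> {p3..q3}" "y' \<in> {p3..q3}"
    and K: "\<And>v. (K has_real_derivative k v) (at v)" "\<And>v. \<bar>K v\<bar> \<le> M / (1 + v^2)" "\<And>v. \<bar>v * k v\<bar> \<le> M / (1 + v^2)"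
      "\<And>v. \<bar>k v\<bar> \<le> M / (1 + v^2)"
    and k: "continuous_on UNIV k"
    and \<sigma>: "\<And>b. b \<in> {l'..r'} \<Longrightarrow> (\<sigma> has_real_derivative \<sigma>' b) (at b)"
      "\<And>b. b \<in> {l'..r'} \<Longrightarrow> \<bar>\<sigma> b\<bar> \<le> S" "\<And>b. b \<in> {l'..r'} \<Longrightarrow> \<bar>\<sigma>' b\<bar> \<le> S" "\<sigma> l' = 0" "\<sigma> r' = 0"
  shows "\<bar>integral {l'..r'} (\<lambda>b. \<sigma> b * k (R * (bphase t x y b - bphase t x' y' b)))\<bar>
    \<le> Cosc * (S * M) / ((1 + R * \<bar>x - x'\<bar>) * (1 + R * \<bar>y - y'\<bar>))" (is "\<bar>?I\<bar> \<le> _")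
proof -
  let ?N = "(1 + 2 * Cph) * S * M * (4 + 3 * Cph * (r' - l')) / cph^2"
  have S: "0 \<le> S" using \<sigma>(2)[of l'] lr' by auto
  have M: "0 \<le> M" using K(4)[of 0] by auto
  have kM: "\<bar>k v\<bar> \<le> M" for v
  proof -
    have "M / (1 + v^2) \<le> M / 1" using M by (intro divide_left_mono) (auto intro!: add_pos_nonneg)
    then show ?thesis using K(4)[of v] by simp
  qed
  let ?q = "\<lambda>b. bphase t x y b - bphase t x' y' b"
  have D2: "\<kappa> = \<delta> / D^2 + \<delta> / D^2" unfolding \<kappa>_def by simp
  have N: "0 \<le> ?N" using const_pos S M lr' by (intro divide_nonneg_nonneg mult_nonneg_nonneg add_nonneg_nonneg) auto
  have final: "\<bar>?I\<bar> \<le> ?N / (R * d)^2"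
    if ph: "phase l' r' ?q p p' \<gamma> m Cph" and m: "cph * d \<le> m" and d: "0 < d" for p p' \<gamma> m d
  proof -
    have "\<bar>?I\<bar> \<le> (1 + 2 * Cph) * S * M * (4 + 3 * Cph * (r' - l')) / (R * m)^2"
      using phase.oscillatory_integral[OF ph R K(1-3) k \<sigma>] .
    also have "\<dots> \<le> (1 + 2 * Cph) * S * M * (4 + 3 * Cph * (r' - l')) / (R * (cph * d))^2"
    proof (rule divide_left_mono)
      show "(R * (cph * d))\<^sup>2 \<le> (R * m)\<^sup>2" using R m d const_pos by (intro power_mono mult_left_mono) auto
      have "0 < m" using m mult_pos_pos[OF const_pos(3) d] by linarith
      then show "0 < (R * m)\<^sup>2 * (R * (cph * d))\<^sup>2" using R d const_pos by auto
      show "0 \<le> (1 + 2 * Cph) * S * M * (4 + 3 * Cph * (r' - l'))"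
        using const_pos S M lr' by (intro mult_nonneg_nonneg add_nonneg_nonneg) auto
    qed
    also have "\<dots> = ?N / (R * d)^2" by (simp add: power_mult_distrib ac_simps)
    finally show ?thesis .
  qed
  have low: "\<kappa> \<le> (1 / (x - b) + 1 / (x' - b)) - (1 / (y - b) + 1 / (y' - b))" if "b \<in> {l'..r'}" for b
  proof -
    have "\<delta> / D^2 \<le> 1 / (x - b) - 1 / (y - b)" "\<delta> / D^2 \<le> 1 / (x' - b) - 1 / (y' - b)"
      using x y sep by (intro sep_lower that; force)+
    then show ?thesis unfolding D2 by linarith
  qed
  have 1: "\<bar>?I\<bar> \<le> ?N / (R * \<bar>x - x'\<bar>)^2" if "\<bar>x - x'\<bar> > 0"
  proof (rule final)
    have "phase l' r' (\<lambda>b. -(t - 1) * (1 / (x - b) - 1 / (x' - b)) + t * (1 / (y - b) - 1 / (y' - b)))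
      (\<lambda>b. -(t - 1) * (1 / (x - b) - 1 / (x' - b)) * ((1 / (x - b) + 1 / (x' - b)) - (1 / (y - b) + 1 / (y' - b))))
      (\<lambda>b. -(t - 1) * (1 / (x - b) - 1 / (x' - b)) * ((1 / (x - b) + 1 / (x' - b)) * ((1 / (x - b) + 1 / (x' - b)) - (1 / (y - b) + 1 / (y' - b)))
        + ((1 / (x - b)^2 + 1 / (x' - b)^2) - (1 / (y - b)^2 + 1 / (y' - b)^2))))
      (\<lambda>b. 1 / (y - b) + 1 / (y' - b)) (\<bar>-(t - 1)\<bar> * \<bar>x - x'\<bar> * \<kappa> / D^2) (2 / \<delta> + 12 * D^2 / (\<kappa> * \<delta>^4))"
    proof (rule phase_difference[OF lr' \<delta> const_pos(1)])
      show "\<delta> \<le> w - b \<and> w - b \<le> D" if "b \<in> {l'..r'}" "w \<in> {x, x', y, y'}" for b w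
        using range[OF that(1), of w] that x y by auto
      show "\<kappa> \<le> \<bar>1 / (x - b) + 1 / (x' - b) - (1 / (y - b) + 1 / (y' - b))\<bar>" if "b \<in> {l'..r'}" for b
        using low[OF that] by linarith
    qed (use t \<tau> that in auto)
    also have "(\<lambda>b. -(t - 1) * (1 / (x - b) - 1 / (x' - b)) + t * (1 / (y - b) - 1 / (y' - b))) = ?q"
      by (rule ext) (simp add: bphase_def right_diff_distrib left_diff_distrib diff_divide_distrib)
    finally show "phase l' r' ?q
      (\<lambda>b. -(t - 1) * (1 / (x - b) - 1 / (x' - b)) * ((1 / (x - b) + 1 / (x' - b)) - (1 / (y - b) + 1 / (y' - b))))
      (\<lambda>b. -(t - 1) * (1 / (x - b) - 1 / (x' - b)) * ((1 / (x - b) + 1 / (x' - b)) * ((1 / (x - b) + 1 / (x' - b)) - (1 / (y - b) + 1 / (y' - b)))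
        + ((1 / (x - b)^2 + 1 / (x' - b)^2) - (1 / (y - b)^2 + 1 / (y' - b)^2))))
      (\<lambda>b. 1 / (y - b) + 1 / (y' - b)) (\<bar>-(t - 1)\<bar> * \<bar>x - x'\<bar> * \<kappa> / D^2) Cph"
      unfolding Cph_def .
    have "\<tau> * (\<kappa> / D^2 * \<bar>x - x'\<bar>) \<le> \<bar>-(t - 1)\<bar> * (\<kappa> / D^2 * \<bar>x - x'\<bar>)"
      using t \<tau> const_pos by (intro mult_right_mono) auto
    then show "cph * \<bar>x - x'\<bar> \<le> \<bar>-(t - 1)\<bar> * \<bar>x - x'\<bar> * \<kappa> / D^2" unfolding cph_def by (simp add: ac_simps)
  qed (use that in auto)
  have 2: "\<bar>?I\<bar> \<le> ?N / (R * \<bar>y - y'\<bar>)^2" if "\<bar>y - y'\<bar> > 0"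
  proof (rule final)
    have "phase l' r' (\<lambda>b. t * (1 / (y - b) - 1 / (y' - b)) + (-(t - 1)) * (1 / (x - b) - 1 / (x' - b)))
      (\<lambda>b. t * (1 / (y - b) - 1 / (y' - b)) * ((1 / (y - b) + 1 / (y' - b)) - (1 / (x - b) + 1 / (x' - b))))
      (\<lambda>b. t * (1 / (y - b) - 1 / (y' - b)) * ((1 / (y - b) + 1 / (y' - b)) * ((1 / (y - b) + 1 / (y' - b)) - (1 / (x - b) + 1 / (x' - b)))
        + ((1 / (y - b)^2 + 1 / (y' - b)^2) - (1 / (x - b)^2 + 1 / (x' - b)^2))))
      (\<lambda>b. 1 / (x - b) + 1 / (x' - b)) (\<bar>t\<bar> * \<bar>y - y'\<bar> * \<kappa> / D^2) (2 / \<delta> + 12 * D^2 / (\<kappa> * \<delta>^4))"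
    proof (rule phase_difference[OF lr' \<delta> const_pos(1)])
      show "\<delta> \<le> w - b \<and> w - b \<le> D" if "b \<in> {l'..r'}" "w \<in> {y, y', x, x'}" for b w
        using range[OF that(1), of w] that x y by auto
      show "\<kappa> \<le> \<bar>1 / (y - b) + 1 / (y' - b) - (1 / (x - b) + 1 / (x' - b))\<bar>" if "b \<in> {l'..r'}" for b
        using low[OF that] by linarith
    qed (use t \<tau> that in auto)
    also have "(\<lambda>b. t * (1 / (y - b) - 1 / (y' - b)) + (-(t - 1)) * (1 / (x - b) - 1 / (x' - b))) = ?q"
      by (rule ext) (simp add: bphase_def right_diff_distrib left_diff_distrib diff_divide_distrib)
    finally show "phase l' r' ?q
      (\<lambda>b. t * (1 / (y - b) - 1 / (y' - b)) * ((1 / (y - b) + 1 / (y' - b)) - (1 / (x - b) + 1 / (x' - b))))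
      (\<lambda>b. t * (1 / (y - b) - 1 / (y' - b)) * ((1 / (y - b) + 1 / (y' - b)) * ((1 / (y - b) + 1 / (y' - b)) - (1 / (x - b) + 1 / (x' - b)))
        + ((1 / (y - b)^2 + 1 / (y' - b)^2) - (1 / (x - b)^2 + 1 / (x' - b)^2))))
      (\<lambda>b. 1 / (x - b) + 1 / (x' - b)) (\<bar>t\<bar> * \<bar>y - y'\<bar> * \<kappa> / D^2) Cph"
      unfolding Cph_def .
    have "\<tau> * (\<kappa> / D^2 * \<bar>y - y'\<bar>) \<le> \<bar>t\<bar> * (\<kappa> / D^2 * \<bar>y - y'\<bar>)"
      using t \<tau> const_pos by (intro mult_right_mono) auto
    then show "cph * \<bar>y - y'\<bar> \<le> \<bar>t\<bar> * \<bar>y - y'\<bar> * \<kappa> / D^2" unfolding cph_def by (simp add: ac_simps)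
  qed (use that in auto)
  \<comment> \<open>The trivial bound, needed when both distances are below the scale
    \<open>1 / R\<close>.\<close>
  have 0: "\<bar>?I\<bar> \<le> S * M * (r' - l')"
  proof -
    have cont: "continuous_on {l'..r'} (\<lambda>b. \<sigma> b * k (R * ?q b))"
    proof (rule continuous_on_mult)
      show "continuous_on {l'..r'} \<sigma>"
        by (rule DERIV_continuous_on[OF has_field_derivative_at_within[OF \<sigma>(1)]])
      have "continuous_on {l'..r'} (bphase t u v)" if "u \<in> JJ" "v \<in> JJ" for u v
        by (rule DERIV_continuous_on[OF has_field_derivative_at_within[OF bphase_deriv[OF _ that]]])
      from this[of x y] this[of x' y'] x y
      have "continuous_on {l'..r'} (bphase t x y)" "continuous_on {l'..r'} (bphase t x' y')"
        by auto
      then show "continuous_on {l'..r'} (\<lambda>b. k (R * ?q b))"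
        by (intro continuous_on_compose2[OF k] continuous_intros) auto
    qed
    have "norm ?I \<le> integral {l'..r'} (\<lambda>_. S * M)"
    proof (rule integral_norm_bound_integral)
      show "norm (\<sigma> b * k (R * ?q b)) \<le> S * M" if "b \<in> {l'..r'}" for b
        unfolding real_norm_def abs_mult using \<sigma>(2)[OF that] kM S by (intro mult_mono) auto
    qed (use cont in \<open>auto intro!: integrable_continuous_interval\<close>)
    then show ?thesis using lr' by (simp add: ac_simps)
  qed
  have "\<bar>?I\<bar> \<le> 4 * (S * M * (r' - l') + ?N) / ((1 + R * \<bar>x - x'\<bar>) * (1 + R * \<bar>y - y'\<bar>))"
    using S M lr' by (intro combine_decay R N 0 1 2) auto
  also have "4 * (S * M * (r' - l') + ?N) = Cosc * (S * M)"
  proof -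
    have "4 * (S * M * L + u * S * M * W / c2) = 4 * (L + u * W / c2) * (S * M)" for L u W c2 :: real
      by (simp add: algebra_simps)
    then show ?thesis unfolding Cosc_def .
  qed
  finally show ?thesis .
qed

end

section \<open>The cut-off in the first point and the averaged kernels\<close>

context config
begin

text \<open>A parabola is enough: a single integration by parts only asks that the amplitude vanish
  at both ends. On \<open>{l..r + \<eta>}\<close>, which contains every window
  \<open>{a..a + 1 / R}\<close> with \<open>a\<close> in \<open>{l..r}\<close> and
  \<open>1 / R \<le> \<eta>\<close>, both ends are at least \<open>\<eta>\<close> away.\<close>

definition "bump b = (b - l') * (r' - b) / \<eta>^2"
definition "bumpS = ((r' - l')^2 + (r' - l')) / \<eta>^2"
definition "slope1 = 2 * T / \<delta>^2"
definition "slope2 = 4 * T / \<delta>^3"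
text \<open>Bounds the amplitude \<open>bump\<close> times two phase derivatives, and also its
  derivative by the product rule.\<close>

definition "ampS = bumpS * slope1^2 + 2 * bumpS * slope1 * slope2"
definition "Cint = Cosc * 12288 * (2 * bumpS + ampS)"

lemma bump_deriv: "(bump has_real_derivative ((r' - b) - (b - l')) / \<eta>^2) (at b)"
  unfolding bump_def[abs_def] using \<eta>
  by (auto intro!: derivative_eq_intros simp: field_simps)

lemma bump_nonneg: "b \<in> {l'..r'} \<Longrightarrow> 0 \<le> bump b"
  by (simp add: bump_def)

lemma bump_ge_1: assumes "b \<in> {l..r + \<eta>}" shows "1 \<le> bump b"
proof -
  have "\<eta> * \<eta> \<le> (b - l') * (r' - b)" using assms \<eta> by (intro mult_mono) auto
  then show ?thesis using \<eta> by (simp add: bump_def power2_eq_square)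
qed

lemma bumpS_nonneg: "0 \<le> bumpS"
  unfolding bumpS_def using lr' by (intro divide_nonneg_nonneg add_nonneg_nonneg) auto

lemma bump_bounds:
  assumes "b \<in> {l'..r'}"
  shows "\<bar>bump b\<bar> \<le> bumpS" "\<bar>((r' - b) - (b - l')) / \<eta>^2\<bar> \<le> bumpS"
proof -
  have "(b - l') * (r' - b) \<le> (r' - l') * (r' - l')" using assms by (intro mult_mono) auto
  then have "(b - l') * (r' - b) \<le> (r' - l')^2 + (r' - l')" using lr' by (simp add: power2_eq_square)
  then have "bump b \<le> bumpS" unfolding bump_def bumpS_def by (rule divide_right_mono) simp
  then show "\<bar>bump b\<bar> \<le> bumpS" using bump_nonneg[OF assms] by simp
  have "\<bar>(r' - b) - (b - l')\<bar> \<le> r' - l'" using assms by (simp add: abs_le_iff)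
  moreover have "0 \<le> (r' - l')^2" by simp
  ultimately have "\<bar>(r' - b) - (b - l')\<bar> \<le> (r' - l')^2 + (r' - l')" by linarith
  then show "\<bar>((r' - b) - (b - l')) / \<eta>^2\<bar> \<le> bumpS"
    unfolding bumpS_def abs_divide by (simp add: divide_right_mono)
qed

lemma bphase'_bound:
  assumes "b \<in> {l'..r'}" "x \<in> JJ" "y \<in> JJ" "1 + \<tau> \<le> t" "t \<le> T"
  shows "\<bar>bphase' t x y b\<bar> \<le> slope1"
proof -
  have i: "0 \<le> 1 / (w - b)^2" "1 / (w - b)^2 \<le> 1 / \<delta>^2" if "w \<in> JJ" for w
    using range[OF assms(1) that] \<delta> by (auto intro!: divide_left_mono power_mono)
  have "bphase' t x y b = t * (1 / (y - b)^2) - (t - 1) * (1 / (x - b)^2)" by (simp add: bphase'_def)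
  moreover have "t * (1 / (y - b)^2) \<le> T * (1 / \<delta>^2)" "(t - 1) * (1 / (x - b)^2) \<le> T * (1 / \<delta>^2)"
    using assms(4,5) \<tau> i assms(2,3) by (intro mult_mono; simp)+
  moreover have "0 \<le> t * (1 / (y - b)^2)" "0 \<le> (t - 1) * (1 / (x - b)^2)" "0 \<le> T * (1 / \<delta>^2)"
    using assms(4,5) \<tau> by simp_all
  moreover have "slope1 = T * (1 / \<delta>^2) + T * (1 / \<delta>^2)" by (simp add: slope1_def)
  ultimately show ?thesis by linarith
qed

lemma bphase''_bound:
  assumes "b \<in> {l'..r'}" "x \<in> JJ" "y \<in> JJ" "1 + \<tau> \<le> t" "t \<le> T"
  shows "\<bar>2 * t * (1 / (y - b))^3 - 2 * (t - 1) * (1 / (x - b))^3\<bar> \<le> slope2"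
proof -
  have i: "0 \<le> (1 / (w - b))^3" "(1 / (w - b))^3 \<le> 1 / \<delta>^3" if "w \<in> JJ" for w
    using range_inv(1,2)[OF assms(1) that] power_mono[of "1 / (w - b)" "1 / \<delta>" 3]
    by (simp_all add: power_one_over)
  have "2 * t * (1 / (y - b))^3 \<le> 2 * T * (1 / \<delta>^3)" "2 * (t - 1) * (1 / (x - b))^3 \<le> 2 * T * (1 / \<delta>^3)"
    using assms(4,5) \<tau> i assms(2,3) by (intro mult_mono; simp)+
  moreover have "0 \<le> 2 * t * (1 / (y - b))^3" "0 \<le> 2 * (t - 1) * (1 / (x - b))^3" "0 \<le> 2 * T * (1 / \<delta>^3)"
    using assms(4,5) \<tau> i(1)[OF assms(2)] i(1)[OF assms(3)] \<delta> by simp_all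
  moreover have "slope2 = 2 * T * (1 / \<delta>^3) + 2 * T * (1 / \<delta>^3)" by (simp add: slope2_def)
  ultimately show ?thesis by linarith
qed

text \<open>The two integrals are the contributions of one pair to \<open>2 * HH + DD\<close>. They
  differ in amplitude and kernel but share the phase, so \<open>oscillation_pair\<close> serves
  both.\<close>

lemma bump_integral:
  assumes R: "0 < R" and t: "1 + \<tau> \<le> t" "t \<le> T"
    and x: "x \<in> {p2..q2}" "x' \<in> {p2..q2}" and y: "y \<in> {p3..q3}" "y' \<in> {p3..q3}"
  defines "q \<equiv> \<lambda>b. R * (bphase t x y b - bphase t x' y' b)"
  shows "2 * integral {l'..r'} (\<lambda>b. bump b * gker2 (q b))
      + integral {l'..r'} (\<lambda>b. bump b * (bphase' t x y b * bphase' t x' y' b) * gker4 (q b))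
    \<le> Cint * (1 / ((1 + R * \<bar>x - x'\<bar>) * (1 + R * \<bar>y - y'\<bar>)))" (is "2 * ?I2 + ?I4 \<le> _")
proof -
  let ?d = "1 / ((1 + R * \<bar>x - x'\<bar>) * (1 + R * \<bar>y - y'\<bar>))"
  have J: "x \<in> JJ" "x' \<in> JJ" "y \<in> JJ" "y' \<in> JJ" using x y by auto
  have bnd: "bump l' = 0" "bump r' = 0" by (simp_all add: bump_def)
  have "\<bar>?I2\<bar> \<le> Cosc * (bumpS * 12288) / ((1 + R * \<bar>x - x'\<bar>) * (1 + R * \<bar>y - y'\<bar>))"
    unfolding q_def
    by (rule oscillation_pair[OF R t(1) x y gker_derivs(1) gker_bounds(3,2,1) continuous_gker(1) bump_deriv bump_bounds bnd])
  then have 2: "?I2 \<le> Cosc * (bumpS * 12288) * ?d" by simp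
  let ?B = "bphase' t x y" and ?B' = "bphase' t x' y'"
  let ?BB = "\<lambda>x y b. 2 * t * (1 / (y - b))^3 - 2 * (t - 1) * (1 / (x - b))^3"
  let ?\<sigma> = "\<lambda>b. bump b * (?B b * ?B' b)"
  let ?\<sigma>' = "\<lambda>b. ((r' - b) - (b - l')) / \<eta>^2 * (?B b * ?B' b) + (?BB x y b * ?B' b + ?BB x' y' b * ?B b) * bump b"
  have s0: "0 \<le> slope1" "0 \<le> slope2" using t \<tau> \<delta> by (simp_all add: slope1_def slope2_def)
  have BB: "\<bar>?B b * ?B' b\<bar> \<le> slope1^2" if "b \<in> {l'..r'}" for b
    unfolding abs_mult power2_eq_square using s0 that t J by (intro mult_mono bphase'_bound) auto
  have 4: "\<bar>?I4\<bar> \<le> Cosc * (ampS * 12288) / ((1 + R * \<bar>x - x'\<bar>) * (1 + R * \<bar>y - y'\<bar>))"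
    unfolding q_def
  proof (rule oscillation_pair[OF R t(1) x y gker_derivs(3) gker_bounds(4,6,5) continuous_gker(2)])
    fix b assume b: "b \<in> {l'..r'}"
    show "(?\<sigma> has_real_derivative ?\<sigma>' b) (at b)"
      by (intro DERIV_mult bump_deriv bphase'_deriv b J)
    have "\<bar>?\<sigma> b\<bar> \<le> bumpS * slope1^2"
      unfolding abs_mult[of "bump b"] using bump_bounds(1)[OF b] BB[OF b] bumpS_nonneg by (intro mult_mono) auto
    moreover have "0 \<le> 2 * bumpS * slope1 * slope2" using bumpS_nonneg s0 by simp
    ultimately show "\<bar>?\<sigma> b\<bar> \<le> ampS" unfolding ampS_def by linarith
    have A: "\<bar>((r' - b) - (b - l')) / \<eta>^2 * (?B b * ?B' b)\<bar> \<le> bumpS * slope1^2"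
      unfolding abs_mult[of "_ / _"] using bump_bounds(2)[OF b] BB[OF b] bumpS_nonneg by (intro mult_mono) auto
    have m: "\<bar>u * v\<bar> \<le> slope2 * slope1" if "\<bar>u\<bar> \<le> slope2" "\<bar>v\<bar> \<le> slope1" for u v
      unfolding abs_mult using that s0 by (intro mult_mono) auto
    have "\<bar>?BB x y b * ?B' b + ?BB x' y' b * ?B b\<bar> \<le> slope2 * slope1 + slope2 * slope1"
      by (intro order_trans[OF abs_triangle_ineq] add_mono m bphase'_bound bphase''_bound b J t)
    then have "\<bar>(?BB x y b * ?B' b + ?BB x' y' b * ?B b) * bump b\<bar> \<le> (slope2 * slope1 + slope2 * slope1) * bumpS"
      unfolding abs_mult[of _ "bump b"] using bump_bounds(1)[OF b] s0 by (intro mult_mono) auto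
    then have "\<bar>?\<sigma>' b\<bar> \<le> bumpS * slope1^2 + (slope2 * slope1 + slope2 * slope1) * bumpS"
      using A by (intro order_trans[OF abs_triangle_ineq] add_mono)
    then show "\<bar>?\<sigma>' b\<bar> \<le> ampS" unfolding ampS_def by (simp add: algebra_simps)
  qed (simp_all add: bnd)
  then have 4: "?I4 \<le> Cosc * (ampS * 12288) * ?d" by simp
  have "2 * ?I2 + ?I4 \<le> 2 * (Cosc * (bumpS * 12288) * ?d) + Cosc * (ampS * 12288) * ?d"
    using 2 4 by linarith
  also have "2 * (Cosc * (u * 12288) * d) + Cosc * (v * 12288) * d = Cosc * 12288 * (2 * u + v) * d" for u v d
    by (simp add: algebra_simps)
  finally show ?thesis unfolding Cint_def .
qed

end

section \<open>The smoothed density of cross ratios\<close>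

lemma continuous_on_gker:
  assumes "continuous_on A f"
  shows "continuous_on A (\<lambda>b. gker2 (f b))" "continuous_on A (\<lambda>b. gker4 (f b))"
  using continuous_on_compose2[OF continuous_gker(1) assms] continuous_on_compose2[OF continuous_gker(2) assms]
  by auto

lemma sum_product_pairs:
  fixes f g :: "_ \<Rightarrow> real"
  shows "sum f A * sum g B = (\<Sum>j\<in>A \<times> B. f (fst j) * g (snd j))"
  by (simp add: sum_product sum.cartesian_product case_prod_unfold)

context config
begin

text \<open>These constants live in \<open>config\<close>, not in \<open>masses\<close>: they must
  not depend on the weights or on \<open>N\<close>.\<close>

definition "Cen s = 12 / (1 - 2 powr (s - 1))" for s :: real
definition "CH s = 6 * Cint * (Cen s)^2" for s :: real
definition "CE s = 24576 * (1 + D^2) * Cen s" for s :: real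

end

text \<open>The Frostman condition is only required at scales above \<open>1 / N\<close>.\<close>

locale masses = config +
  fixes P1 P2 P3 P4 :: "real set" and w1 w2 w3 w4 :: "real \<Rightarrow> real" and s N :: real
  assumes fin: "finite P1" "finite P2" "finite P3" "finite P4"
    and sub: "P1 \<subseteq> {l..r}" "P2 \<subseteq> {p2..q2}" "P3 \<subseteq> {p3..q3}" "P4 \<subseteq> {p4..q4}"
    and w: "\<And>p. 0 \<le> w1 p" "\<And>p. 0 \<le> w2 p" "\<And>p. 0 \<le> w3 p" "\<And>p. 0 \<le> w4 p"
    and total: "sum w1 P1 \<le> 1" "sum w2 P2 \<le> 1" "sum w3 P3 \<le> 1" "sum w4 P4 \<le> 1"
    and s: "0 < s" "s < 1"
    and ball: "\<And>x u. 1 / N \<le> u \<Longrightarrow> sum w1 {p \<in> P1. \<bar>p - x\<bar> \<le> u} \<le> 6 * u powr s"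
      "\<And>x u. 1 / N \<le> u \<Longrightarrow> sum w2 {p \<in> P2. \<bar>p - x\<bar> \<le> u} \<le> 6 * u powr s"
      "\<And>x u. 1 / N \<le> u \<Longrightarrow> sum w3 {p \<in> P3. \<bar>p - x\<bar> \<le> u} \<le> 6 * u powr s"
      "\<And>x u. 1 / N \<le> u \<Longrightarrow> sum w4 {p \<in> P4. \<bar>p - x\<bar> \<le> u} \<le> 6 * u powr s"
begin

abbreviation "PP \<equiv> P2 \<times> P3"

text \<open>
  \<open>EE\<close> and \<open>HH\<close> are the energies of the two sides of the separated relation for a fixed first point;
  \<open>DD\<close> is, up to the factor \<open>R^2\<close>, the corresponding energy of the derivative of \<open>ph\<close> in the first point.
\<close>

definition "wt j = w2 (fst j) * w3 (snd j)"
definition "ph t j b = bphase t (fst j) (snd j) b"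
definition "ph' t j b = bphase' t (fst j) (snd j) b"
definition "HH t R b = (\<Sum>i\<in>PP. \<Sum>j\<in>PP. wt i * wt j * gker2 (R * ph t i b - R * ph t j b))"
definition "DD t R b = (\<Sum>i\<in>PP. \<Sum>j\<in>PP. wt i * ph' t i b * (wt j * ph' t j b) * gker4 (R * ph t i b - R * ph t j b))"
definition "EE R a = (\<Sum>i\<in>P4. \<Sum>j\<in>P4. w4 i * w4 j * gker2 (R * (1 / (i - a)) - R * (1 / (j - a))))"

lemma finPP: "finite PP" using fin by simp

lemma memPP: "j \<in> PP \<Longrightarrow> fst j \<in> JJ \<and> snd j \<in> JJ"
  using sub by auto

lemma wt_nonneg: "0 \<le> wt j" using w by (simp add: wt_def)

lemma HH_nonneg: "0 \<le> HH t R b" and DD_nonneg: "0 \<le> DD t R b"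
  unfolding HH_def DD_def using finPP by (rule gker2_psd gker4_psd)+

lemma ph_deriv: "b \<in> {l'..r'} \<Longrightarrow> j \<in> PP \<Longrightarrow> (ph t j has_real_derivative ph' t j b) (at b)"
  using bphase_deriv[of b "fst j" "snd j" t] memPP[of j] unfolding ph_def[abs_def] ph'_def by simp

lemma ph_cont: "j \<in> PP \<Longrightarrow> continuous_on {l'..r'} (ph t j)"
  by (rule DERIV_continuous_on[OF has_field_derivative_at_within[OF ph_deriv]])

lemma ph'_cont: "j \<in> PP \<Longrightarrow> continuous_on {l'..r'} (ph' t j)"
  unfolding ph'_def[abs_def] using memPP[of j]
  by (intro DERIV_continuous_on[OF has_field_derivative_at_within[OF bphase'_deriv]]) auto

lemma HH_cont: "continuous_on {l'..r'} (HH t R)"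
  unfolding HH_def[abs_def] by (intro continuous_intros continuous_on_gker ph_cont)

lemma DD_cont: "continuous_on {l'..r'} (DD t R)"
  unfolding DD_def[abs_def] by (intro continuous_intros continuous_on_gker ph_cont ph'_cont)

text \<open>The derivative of \<open>gker2\<close> is \<open>- gker3\<close>. As
  \<open>gker3\<close> is odd, exchanging \<open>i\<close> and \<open>j\<close> merges the terms
  with \<open>ph' t i b\<close> and \<open>ph' t j b\<close> into one mixed sum, to which
  \<open>gker3_cross\<close> applies.\<close>

lemma HH_deriv:
  assumes b: "b \<in> {l'..r'}" and R: "0 < R"
  obtains h where "(HH t R has_real_derivative h) (at b)" "\<bar>h\<bar> \<le> R * (HH t R b + DD t R b)"
proof -
  let ?k = "\<lambda>i j. gker3 (R * ph t i b - R * ph t j b)"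
  let ?X = "\<Sum>i\<in>PP. \<Sum>j\<in>PP. wt i * ph' t i b * wt j * ?k i j"
  let ?h = "\<Sum>i\<in>PP. \<Sum>j\<in>PP. wt i * wt j * (- ?k i j * (R * ph' t i b - R * ph' t j b))"
  have "(HH t R has_real_derivative ?h) (at b)"
    unfolding HH_def[abs_def]
    by (intro DERIV_sum DERIV_cmult DERIV_chain2[OF gker_derivs(2)] DERIV_diff ph_deriv b)
  moreover have "?h = - (2 * R * ?X)"
  proof -
    have anti: "?k i j = - ?k j i" for i j
      using gker3_minus[of "R * ph t j b - R * ph t i b"] by simp
    have "?h = (\<Sum>i\<in>PP. \<Sum>j\<in>PP. - R * (wt i * ph' t i b * wt j * ?k i j)) + (\<Sum>i\<in>PP. \<Sum>j\<in>PP. R * (wt i * wt j * ph' t j b * ?k i j))"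
      unfolding sum.distrib[symmetric] by (intro sum.cong refl) (simp add: algebra_simps)
    also have "(\<Sum>i\<in>PP. \<Sum>j\<in>PP. R * (wt i * wt j * ph' t j b * ?k i j)) = (\<Sum>j\<in>PP. \<Sum>i\<in>PP. R * (wt i * wt j * ph' t j b * ?k i j))"
      by (rule sum.swap)
    also have "\<dots> = (\<Sum>i\<in>PP. \<Sum>j\<in>PP. - R * (wt i * ph' t i b * wt j * ?k i j))"
    proof (intro sum.cong refl)
      fix i j
      show "R * (wt j * wt i * ph' t i b * ?k j i) = - R * (wt i * ph' t i b * wt j * ?k i j)"
        by (subst anti[of j i]) simp
    qed
    finally show ?thesis unfolding sum_distrib_left[symmetric] by simp
  qed
  moreover have "2 * \<bar>?X\<bar> \<le> HH t R b + DD t R b"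
    unfolding HH_def DD_def using gker3_cross[OF finPP, of "\<lambda>i. wt i * ph' t i b" wt "\<lambda>i. R * ph t i b"] .
  then have "R * (2 * \<bar>?X\<bar>) \<le> R * (HH t R b + DD t R b)" using R by (intro mult_left_mono) auto
  ultimately show thesis using R by (intro that[of ?h]) (auto simp: abs_mult)
qed

text \<open>A Sobolev embedding on the scale \<open>1 / R\<close>, obtained by differentiating \<open>(b - a - 1 / R) * HH t R b\<close>.\<close>

lemma HH_sobolev:
  assumes a: "a \<in> {l..r}" and R: "0 < R" "1 / R \<le> \<eta>"
  shows "HH t R a \<le> R * integral {a..a + 1 / R} (\<lambda>b. 2 * HH t R b + DD t R b)"
proof -
  let ?u = "a + 1 / R"
  have sub': "{a..?u} \<subseteq> {l'..r'}" using a R \<eta> by auto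
  have "\<exists>h. \<forall>b\<in>{a..?u}. (HH t R has_real_derivative h b) (at b) \<and> \<bar>h b\<bar> \<le> R * (HH t R b + DD t R b)"
    by (rule bchoice) (use HH_deriv[OF _ R(1)] sub' in blast)
  then obtain h where h: "\<And>b. b \<in> {a..?u} \<Longrightarrow> (HH t R has_real_derivative h b) (at b)"
    "\<And>b. b \<in> {a..?u} \<Longrightarrow> \<bar>h b\<bar> \<le> R * (HH t R b + DD t R b)" by blast
  let ?F = "\<lambda>b. (b - ?u) * HH t R b"
  let ?F' = "\<lambda>b. HH t R b + h b * (b - ?u)"
  have "(?F' has_integral (?F ?u - ?F a)) {a..?u}"
  proof (rule fundamental_theorem_of_calculus)
    fix b assume b: "b \<in> {a..?u}"
    have "((\<lambda>b. b - ?u) has_real_derivative 1) (at b)" by (auto intro!: derivative_eq_intros)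
    from has_field_derivative_at_within[OF DERIV_mult[OF this h(1)[OF b]]]
    show "(?F has_vector_derivative ?F' b) (at b within {a..?u})"
      unfolding has_real_derivative_iff_has_vector_derivative[symmetric] by simp
  qed (use R in simp)
  moreover have "?F ?u - ?F a = HH t R a / R" by simp
  ultimately have "(?F' has_integral (HH t R a / R)) {a..?u}" by simp
  moreover have "((\<lambda>b. 2 * HH t R b + DD t R b) has_integral integral {a..?u} (\<lambda>b. 2 * HH t R b + DD t R b)) {a..?u}"
    by (intro integrable_integral integrable_continuous_interval continuous_intros
        continuous_on_subset[OF HH_cont sub'] continuous_on_subset[OF DD_cont sub'])
  moreover have "?F' b \<le> 2 * HH t R b + DD t R b" if b: "b \<in> {a..?u}" for b
  proof -
    have "\<bar>h b * (b - ?u)\<bar> \<le> R * (HH t R b + DD t R b) * (1 / R)"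
      unfolding abs_mult using h(2)[OF b] b by (intro mult_mono) auto
    then have "h b * (b - ?u) \<le> HH t R b + DD t R b" using R by simp
    then show ?thesis by simp
  qed
  ultimately have "HH t R a / R \<le> integral {a..?u} (\<lambda>b. 2 * HH t R b + DD t R b)"
    by (rule has_integral_le)
  then show ?thesis using R by (simp add: pos_divide_le_eq mult.commute)
qed

text \<open>For fixed \<open>i\<close> the inner sum is a product of one-point energies over
  \<open>P2\<close> and \<open>P3\<close>; the total weight of \<open>PP\<close> is at most
  1.\<close>

lemma pair_energy:
  assumes R: "0 < R" "R \<le> N"
  shows "(\<Sum>i\<in>PP. \<Sum>j\<in>PP. wt i * wt j * (1 / ((1 + R * \<bar>fst i - fst j\<bar>) * (1 + R * \<bar>snd i - snd j\<bar>))))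
    \<le> (Cen s * R powr - s)^2"
proof -
  let ?C = "Cen s * R powr - s"
  have RN: "1 / N \<le> 1 / R" using R by (intro divide_left_mono) auto
  have e2: "(\<Sum>p\<in>P2. w2 p / (1 + R * \<bar>p - x\<bar>)) \<le> ?C" and e3: "(\<Sum>p\<in>P3. w3 p / (1 + R * \<bar>p - x\<bar>)) \<le> ?C" for x
    unfolding Cen_def using RN by (intro energy_bound fin w s R ball; simp)+
  have nn2: "0 \<le> (\<Sum>p\<in>P2. w2 p / (1 + R * \<bar>p - x\<bar>))" and nn3: "0 \<le> (\<Sum>p\<in>P3. w3 p / (1 + R * \<bar>p - x\<bar>))" for x
    using w R by (intro sum_nonneg divide_nonneg_nonneg; simp)+
  have inner: "(\<Sum>j\<in>PP. wt i * wt j * (1 / ((1 + R * \<bar>fst i - fst j\<bar>) * (1 + R * \<bar>snd i - snd j\<bar>)))) \<le> wt i * ?C^2" for i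
  proof -
    have "(\<Sum>j\<in>PP. wt i * wt j * (1 / ((1 + R * \<bar>fst i - fst j\<bar>) * (1 + R * \<bar>snd i - snd j\<bar>))))
      = wt i * ((\<Sum>p\<in>P2. w2 p / (1 + R * \<bar>p - fst i\<bar>)) * (\<Sum>p\<in>P3. w3 p / (1 + R * \<bar>p - snd i\<bar>)))"
      unfolding sum_product_pairs unfolding sum_distrib_left
      by (intro sum.cong refl) (simp add: wt_def abs_minus_commute)
    also have "\<dots> \<le> wt i * (?C * ?C)"
      using e2 e3 nn2 nn3 wt_nonneg order_trans[OF nn2 e2]
      by (intro mult_left_mono mult_mono) auto
    finally show ?thesis by (simp add: power2_eq_square)
  qed
  have "sum wt PP = sum w2 P2 * sum w3 P3"
    unfolding sum_product_pairs by (simp add: wt_def)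
  also have "\<dots> \<le> 1 * 1" using total w by (intro mult_mono) (auto intro: sum_nonneg)
  finally have 1: "sum wt PP \<le> 1" by simp
  have "(\<Sum>i\<in>PP. \<Sum>j\<in>PP. wt i * wt j * (1 / ((1 + R * \<bar>fst i - fst j\<bar>) * (1 + R * \<bar>snd i - snd j\<bar>)))) \<le> (\<Sum>i\<in>PP. wt i * ?C^2)"
    by (intro sum_mono inner)
  also have "\<dots> = sum wt PP * ?C^2" by (simp add: sum_distrib_right)
  also have "\<dots> \<le> 1 * ?C^2" using 1 by (intro mult_right_mono) auto
  finally show ?thesis by simp
qed

lemma Cint_nonneg: "1 + \<tau> \<le> T \<Longrightarrow> 0 \<le> Cint"
  unfolding Cint_def ampS_def slope1_def slope2_def using const_pos(4) bumpS_nonneg \<tau> \<delta>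
  by (intro mult_nonneg_nonneg add_nonneg_nonneg) auto

text \<open>Against Lebesgue measure in \<open>b\<close> the oscillation can be exploited pair by
  pair; finiteness of the sums makes the exchange with the integral immediate.\<close>

lemma bump_HH_integral:
  assumes R: "0 < R" "R \<le> N" and t: "1 + \<tau> \<le> t" "t \<le> T"
  shows "integral {l'..r'} (\<lambda>b. bump b * (2 * HH t R b + DD t R b)) \<le> Cint * (Cen s * R powr - s)^2"
proof -
  let ?q = "\<lambda>i j b. R * (ph t i b - ph t j b)"
  let ?f = "\<lambda>i j b. bump b * gker2 (?q i j b)"
  let ?g = "\<lambda>i j b. bump b * (ph' t i b * ph' t j b) * gker4 (?q i j b)"
  have cb: "continuous_on {l'..r'} bump" unfolding bump_def[abs_def] by (intro continuous_intros) (use \<eta> in auto)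
  have cont: "continuous_on {l'..r'} (?f i j)" "continuous_on {l'..r'} (?g i j)" if "i \<in> PP" "j \<in> PP" for i j
    using that by (auto intro!: continuous_intros continuous_on_gker cb ph_cont ph'_cont)
  have "bump b * (2 * HH t R b + DD t R b) = (\<Sum>i\<in>PP. \<Sum>j\<in>PP. wt i * wt j * (2 * ?f i j b + ?g i j b))" for b
    unfolding HH_def DD_def distrib_left mult.assoc[symmetric] sum_distrib_left sum.distrib[symmetric]
    by (intro sum.cong refl) (simp add: algebra_simps)
  moreover have "((\<lambda>b. \<Sum>i\<in>PP. \<Sum>j\<in>PP. wt i * wt j * (2 * ?f i j b + ?g i j b)) has_integral
      (\<Sum>i\<in>PP. \<Sum>j\<in>PP. wt i * wt j * (2 * integral {l'..r'} (?f i j) + integral {l'..r'} (?g i j)))) {l'..r'}"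
    by (intro has_integral_sum finPP has_integral_mult_right has_integral_add integrable_integral
        integrable_continuous_interval cont)
  ultimately have "integral {l'..r'} (\<lambda>b. bump b * (2 * HH t R b + DD t R b))
      = (\<Sum>i\<in>PP. \<Sum>j\<in>PP. wt i * wt j * (2 * integral {l'..r'} (?f i j) + integral {l'..r'} (?g i j)))"
    by (simp only: integral_unique)
  also have "\<dots> \<le> (\<Sum>i\<in>PP. \<Sum>j\<in>PP. wt i * wt j * (Cint * (1 / ((1 + R * \<bar>fst i - fst j\<bar>) * (1 + R * \<bar>snd i - snd j\<bar>)))))"
  proof (intro sum_mono mult_left_mono)
    fix i j assume ij: "i \<in> PP" "j \<in> PP"
    then have "fst i \<in> {p2..q2}" "fst j \<in> {p2..q2}" "snd i \<in> {p3..q3}" "snd j \<in> {p3..q3}" using sub by auto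
    from bump_integral[OF R(1) t this]
    show "2 * integral {l'..r'} (?f i j) + integral {l'..r'} (?g i j)
      \<le> Cint * (1 / ((1 + R * \<bar>fst i - fst j\<bar>) * (1 + R * \<bar>snd i - snd j\<bar>)))"
      unfolding ph_def ph'_def .
  qed (simp add: wt_nonneg)
  also have "\<dots> = Cint * (\<Sum>i\<in>PP. \<Sum>j\<in>PP. wt i * wt j * (1 / ((1 + R * \<bar>fst i - fst j\<bar>) * (1 + R * \<bar>snd i - snd j\<bar>))))"
    by (rule double_sum_scale)
  also have "\<dots> \<le> Cint * (Cen s * R powr - s)^2"
    using Cint_nonneg t by (intro mult_left_mono pair_energy R) auto
  finally show ?thesis .
qed

text \<open>\<open>HH_sobolev\<close> replaces each value by an integral over a window of length
  \<open>1 / R\<close>, at the cost of a factor \<open>R\<close>. The windows through a given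
  \<open>b\<close> have total weight at most \<open>6 * (1 / R) powr s\<close>, which leaves
  \<open>R powr (1 - s)\<close> times a Lebesgue integral.\<close>

lemma HH_sum:
  assumes R: "0 < R" "R \<le> N" "1 / R \<le> \<eta>" and t: "1 + \<tau> \<le> t" "t \<le> T"
  shows "(\<Sum>a\<in>P1. w1 a * HH t R a) \<le> CH s * R powr (1 - 3 * s)"
proof -
  let ?\<Psi> = "\<lambda>b. 2 * HH t R b + DD t R b"
  let ?in = "\<lambda>a b. if b \<in> {a..a + 1 / R} then ?\<Psi> b else 0"
  have \<Psi>: "0 \<le> ?\<Psi> b" for b using HH_nonneg[of t R b] DD_nonneg[of t R b] by simp
  have cont: "continuous_on {l'..r'} ?\<Psi>" by (intro continuous_intros HH_cont DD_cont)
  have RN: "1 / N \<le> 1 / R" using R by (intro divide_left_mono) auto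
  have sub': "{a..a + 1 / R} \<subseteq> {l'..r'}" if "a \<in> P1" for a using sub(1) that R \<eta> by force
  have "(\<Sum>a\<in>P1. w1 a * HH t R a) \<le> (\<Sum>a\<in>P1. w1 a * (R * integral {a..a + 1 / R} ?\<Psi>))"
    using sub(1) R w by (intro sum_mono mult_left_mono HH_sobolev) auto
  also have "\<dots> \<le> integral {l'..r'} (\<lambda>b. R * (6 * (1 / R) powr s) * (bump b * ?\<Psi> b))"
  proof (rule has_integral_le)
    show "((\<lambda>b. \<Sum>a\<in>P1. w1 a * (R * ?in a b)) has_integral (\<Sum>a\<in>P1. w1 a * (R * integral {a..a + 1 / R} ?\<Psi>))) {l'..r'}"
    proof (intro has_integral_sum fin(1) has_integral_mult_right)
      fix a assume a: "a \<in> P1"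
      have "(?\<Psi> has_integral integral {a..a + 1 / R} ?\<Psi>) {a..a + 1 / R}"
        by (intro integrable_integral integrable_continuous_interval continuous_on_subset[OF cont sub'[OF a]])
      then show "(?in a has_integral integral {a..a + 1 / R} ?\<Psi>) {l'..r'}"
        by (rule iffD2[OF has_integral_restrict[OF sub'[OF a]]])
    qed
    show "((\<lambda>b. R * (6 * (1 / R) powr s) * (bump b * ?\<Psi> b)) has_integral integral {l'..r'} (\<lambda>b. R * (6 * (1 / R) powr s) * (bump b * ?\<Psi> b))) {l'..r'}"
      unfolding bump_def using \<eta>
      by (intro integrable_integral integrable_continuous_interval continuous_intros cont) auto
    fix b assume b: "b \<in> {l'..r'}"
    have e: "(\<Sum>a\<in>P1. w1 a * (R * ?in a b)) = R * (sum w1 {a \<in> P1. b \<in> {a..a + 1 / R}} * ?\<Psi> b)"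
      using fin(1) unfolding sum_distrib_left sum_distrib_right by (subst sum.inter_filter) (auto intro!: sum.cong)
    \<comment> \<open>On \<open>{l..r + \<eta>}\<close> the cut-off is at least 1; elsewhere no
      window contains \<open>b\<close> and the left side is 0.\<close>
    have "sum w1 {a \<in> P1. b \<in> {a..a + 1 / R}} \<le> 6 * (1 / R) powr s * bump b"
    proof (cases "b \<in> {l..r + \<eta>}")
      case True
      have "sum w1 {a \<in> P1. b \<in> {a..a + 1 / R}} \<le> sum w1 {a \<in> P1. \<bar>a - b\<bar> \<le> 1 / R}"
        using fin w by (intro sum_mono2) auto
      also have "\<dots> \<le> 6 * (1 / R) powr s" by (rule ball(1)[OF RN])
      also have "\<dots> \<le> 6 * (1 / R) powr s * bump b"
        using mult_left_mono[OF bump_ge_1[OF True], of "6 * (1 / R) powr s"] by simp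
      finally show ?thesis .
    next
      case False
      then have "{a \<in> P1. b \<in> {a..a + 1 / R}} = {}" using sub(1) R by force
      then have "sum w1 {a \<in> P1. b \<in> {a..a + 1 / R}} = 0" by (metis sum.empty)
      then show ?thesis using bump_nonneg[OF b] by simp
    qed
    then have "sum w1 {a \<in> P1. b \<in> {a..a + 1 / R}} * ?\<Psi> b \<le> 6 * (1 / R) powr s * bump b * ?\<Psi> b"
      using \<Psi> by (rule mult_right_mono)
    then have "R * (sum w1 {a \<in> P1. b \<in> {a..a + 1 / R}} * ?\<Psi> b) \<le> R * (6 * (1 / R) powr s * bump b * ?\<Psi> b)"
      using R by (intro mult_left_mono) auto
    then show "(\<Sum>a\<in>P1. w1 a * (R * ?in a b)) \<le> R * (6 * (1 / R) powr s) * (bump b * ?\<Psi> b)"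
      unfolding e by (simp only: mult.assoc)
  qed
  also have "\<dots> = R * (6 * (1 / R) powr s) * integral {l'..r'} (\<lambda>b. bump b * ?\<Psi> b)"
    by (rule integral_mult_right)
  also have "\<dots> \<le> R * (6 * (1 / R) powr s) * (Cint * (Cen s * R powr - s)^2)"
    using R t by (intro mult_left_mono bump_HH_integral) auto
  also have "\<dots> = CH s * (R * R powr - s * (R powr - s)^2)"
    using R by (simp add: CH_def power_divide powr_divide powr_minus_divide)
  also have "R * R powr - s * (R powr - s)^2 = R powr (1 - 3 * s)"
  proof -
    have "R * R powr - s * (R powr - s)^2 = R powr 1 * R powr - s * (R powr - s * R powr - s)"
      using R by (simp add: power2_eq_square)
    also have "\<dots> = R powr (1 - 3 * s)" by (simp only: powr_add[symmetric]) simp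
    finally show ?thesis .
  qed
  finally show ?thesis .
qed

end

section \<open>The scale derivative of the smoothed density\<close>

context masses
begin

text \<open>On the bounded range the map \<open>1 / (x - a)\<close> contracts distances by at most
  \<open>D^2\<close>, so the kernel is dominated by a multiple of
  \<open>1 / (1 + R * \<bar>j - i\<bar>)\<close> uniformly in \<open>a\<close>, and
  \<open>energy_bound\<close> applies.\<close>

lemma EE_bound:
  assumes R: "0 < R" "R \<le> N" and a: "a \<in> {l..r}"
  shows "EE R a \<le> CE s * R powr - s"
proof -
  let ?C = "24576 * (1 + D^2)"
  have RN: "1 / N \<le> 1 / R" using R by (intro divide_left_mono) auto
  have a': "a \<in> {l'..r'}" using a \<eta> by auto
  have g: "gker2 (R * (1 / (i - a)) - R * (1 / (j - a))) \<le> ?C * (1 / (1 + R * \<bar>j - i\<bar>))" if "i \<in> P4" "j \<in> P4" for i j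
  proof -
    let ?v = "R * (1 / (i - a)) - R * (1 / (j - a))"
    have ij: "i \<in> JJ" "j \<in> JJ" using that sub(4) by auto
    note i = range_inv[OF a' ij(1)] and j = range_inv[OF a' ij(2)]
    have "?v = R * ((j - i) * (1 / (i - a) * (1 / (j - a))))" using i(4) j(4) by (simp add: field_simps)
    then have v: "\<bar>?v\<bar> = R * \<bar>j - i\<bar> * (1 / (i - a) * (1 / (j - a)))"
      using R i(1) j(1) by (simp add: abs_mult)
    have "1 / D * (1 / D) \<le> 1 / (i - a) * (1 / (j - a))"
      using i j \<delta> \<delta>D by (intro mult_mono) auto
    then have "R * \<bar>j - i\<bar> * (1 / D * (1 / D)) \<le> \<bar>?v\<bar>" unfolding v using R by (intro mult_left_mono) auto
    then have "D^2 * (R * \<bar>j - i\<bar> * (1 / D * (1 / D))) \<le> D^2 * \<bar>?v\<bar>" by (intro mult_left_mono) auto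
    moreover have "D^2 * (R * \<bar>j - i\<bar> * (1 / D * (1 / D))) = R * \<bar>j - i\<bar>" using \<delta> \<delta>D by (simp add: power2_eq_square)
    ultimately have "R * \<bar>j - i\<bar> \<le> D^2 * \<bar>?v\<bar>" by simp
    moreover have "1 + x \<le> (1 + d) * (1 + u)" if "x \<le> d * u" "0 \<le> d" "0 \<le> u" for x d u :: real
      using that by (simp add: algebra_simps)
    ultimately have 1: "1 + R * \<bar>j - i\<bar> \<le> (1 + D^2) * (1 + \<bar>?v\<bar>)" by simp
    have "1 + \<bar>u\<bar> \<le> 2 * (1 + u^2)" for u :: real
      using abs_le_one_plus_square[of u] zero_le_power2[of u] unfolding distrib_left by linarith
    from this[of ?v]
    have "(1 + D^2) * (1 + \<bar>?v\<bar>) \<le> (1 + D^2) * (2 * (1 + ?v^2))" by (intro mult_left_mono) auto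
    with 1 have 2: "1 + R * \<bar>j - i\<bar> \<le> (1 + D^2) * (2 * (1 + ?v^2))" by linarith
    have "0 < 1 + ?v^2" "0 < 1 + R * \<bar>j - i\<bar>" using R by (intro add_pos_nonneg; simp)+
    moreover have "12288 / z \<le> 24576 * d * (1 / y)" if "y \<le> d * (2 * z)" "0 < z" "0 < y" for y z d :: real
      using that by (simp add: field_simps)
    ultimately have "12288 / (1 + ?v^2) \<le> ?C * (1 / (1 + R * \<bar>j - i\<bar>))" using 2 by blast
    then show ?thesis using gker_bounds(1)[of ?v] by linarith
  qed
  have "EE R a \<le> (\<Sum>i\<in>P4. \<Sum>j\<in>P4. w4 i * w4 j * (?C * (1 / (1 + R * \<bar>j - i\<bar>))))"
    unfolding EE_def using w by (intro sum_mono mult_left_mono g) auto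
  also have "\<dots> = (\<Sum>i\<in>P4. w4 i * (?C * (\<Sum>j\<in>P4. w4 j / (1 + R * \<bar>j - i\<bar>))))"
    unfolding sum_distrib_left by (intro sum.cong refl) simp
  also have "\<dots> \<le> (\<Sum>i\<in>P4. w4 i * (?C * (Cen s * R powr - s)))"
    unfolding Cen_def using RN w by (intro sum_mono mult_left_mono energy_bound fin s R ball) auto
  also have "\<dots> = sum w4 P4 * (CE s * R powr - s)" by (simp add: sum_distrib_right CE_def mult.assoc)
  also have "\<dots> \<le> 1 * (CE s * R powr - s)"
  proof (rule mult_right_mono[OF total(4)])
    have "2 powr (s - 1) < (1::real)" using s powr_less_mono[of "s - 1" 0 2] by simp
    then show "0 \<le> CE s * R powr - s" by (simp add: CE_def Cen_def)
  qed
  finally show ?thesis by simp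
qed

definition "gap t a v j = 1 / (v - a) - ph t j a"

definition "nu t R = (\<Sum>a\<in>P1. w1 a * (\<Sum>v\<in>P4. \<Sum>j\<in>PP. w4 v * wt j * (R * exp (- ((R * gap t a v j)^2) / 2))))"

definition "nu' t R = (\<Sum>a\<in>P1. w1 a * (\<Sum>v\<in>P4. \<Sum>j\<in>PP. w4 v * wt j * gker2 (R * gap t a v j)))"

text \<open>The derivative of \<open>R * exp (- ((R * u)^2) / 2)\<close> in \<open>R\<close> is
  exactly \<open>gker2 (R * u)\<close>; this is why the kernel is normalised by the factor
  \<open>R\<close>.\<close>

lemma nu_deriv: "(nu t has_real_derivative nu' t R) (at R)"
proof -
  have "((\<lambda>R. R * exp (- ((R * u)^2) / 2)) has_real_derivative gker2 (R * u)) (at R)" for u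
    unfolding gker2_def by (auto intro!: derivative_eq_intros simp: algebra_simps power2_eq_square)
  then show ?thesis
    unfolding nu_def[abs_def] nu'_def by (intro DERIV_sum DERIV_cmult)
qed

definition "Cnu = (CE s + CH s) / 2"

lemma nu'_lower:
  assumes R: "0 < R" "R \<le> N" "1 / R \<le> \<eta>" and t: "1 + \<tau> \<le> t" "t \<le> T"
  shows "- Cnu * R powr (1/2 - 2 * s) \<le> nu' t R"
proof -
  \<comment> \<open>The choice that equalises \<open>q * R powr - s\<close> and
    \<open>R powr (1 - 3 * s) / q\<close>.\<close>
  define q where "q = R powr (1/2 - s)"
  have q: "0 < q" using R by (simp add: q_def)
  let ?X = "\<lambda>a. \<Sum>v\<in>P4. \<Sum>j\<in>PP. w4 v * wt j * gker2 (R * gap t a v j)"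
  have X: "- 2 * ?X a \<le> q * EE R a + HH t R a / q" for a
    using gker2_cross[OF fin(4) finPP q, of w4 wt "\<lambda>v. R * (1 / (v - a))" "\<lambda>j. R * ph t j a"]
    unfolding EE_def HH_def gap_def right_diff_distrib .
  have "- 2 * nu' t R = (\<Sum>a\<in>P1. w1 a * (- 2 * ?X a))"
    unfolding nu'_def sum_distrib_left by (intro sum.cong refl) (simp add: sum_distrib_left ac_simps)
  also have "\<dots> \<le> (\<Sum>a\<in>P1. w1 a * (q * EE R a + HH t R a / q))"
    using w by (intro sum_mono mult_left_mono X)
  also have "\<dots> = q * (\<Sum>a\<in>P1. w1 a * EE R a) + (\<Sum>a\<in>P1. w1 a * HH t R a) / q"
    by (simp add: distrib_left sum.distrib sum_distrib_left sum_divide_distrib ac_simps)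
  also have "\<dots> \<le> q * (CE s * R powr - s) + CH s * R powr (1 - 3 * s) / q"
  proof (intro add_mono mult_left_mono divide_right_mono HH_sum R t)
    have "0 \<le> CE s * R powr - s"
    proof -
      have "2 powr (s - 1) < (1::real)" using s powr_less_mono[of "s - 1" 0 2] by simp
      then show ?thesis by (simp add: CE_def Cen_def)
    qed
    then have "(\<Sum>a\<in>P1. w1 a * EE R a) \<le> sum w1 P1 * (CE s * R powr - s)"
      unfolding sum_distrib_right using sub(1) w by (intro sum_mono mult_left_mono EE_bound R) auto
    also have "\<dots> \<le> 1 * (CE s * R powr - s)" using \<open>0 \<le> CE s * R powr - s\<close> by (intro mult_right_mono total)
    finally show "(\<Sum>a\<in>P1. w1 a * EE R a) \<le> CE s * R powr - s" by simp
  qed (use q in auto)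
  also have "\<dots> = CE s * (R powr (1/2 - s) * R powr - s) + CH s * (R powr (1 - 3 * s) / R powr (1/2 - s))"
    by (simp add: q_def)
  also have "\<dots> = CE s * R powr (1/2 - 2 * s) + CH s * R powr (1/2 - 2 * s)"
    by (simp only: powr_add[symmetric] powr_diff[symmetric]) (simp add: algebra_simps)
  also have "\<dots> = 2 * (Cnu * R powr (1/2 - 2 * s))" by (simp add: Cnu_def algebra_simps)
  finally show ?thesis by simp
qed

lemma Cnu_nonneg: "1 + \<tau> \<le> T \<Longrightarrow> 0 \<le> Cnu"
proof -
  assume "1 + \<tau> \<le> T"
  then have "0 \<le> Cint" by (rule Cint_nonneg)
  moreover have "2 powr (s - 1) < (1::real)" using s powr_less_mono[of "s - 1" 0 2] by simp
  ultimately show ?thesis by (simp add: Cnu_def CE_def CH_def Cen_def)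
qed

text \<open>Subtracting from \<open>nu\<close> the multiple of \<open>x powr (3/2 - 2 * s)\<close>
  whose derivative cancels the lower bound for \<open>nu'\<close> gives a nondecreasing function.
  For \<open>s > 3/4\<close> this correction is small at large \<open>R\<close>, however large
  \<open>N\<close> is.\<close>

lemma nu_lower:
  assumes s34: "3/4 < s" and R: "0 < R" "R \<le> N" "1 / R \<le> \<eta>" and t: "1 + \<tau> \<le> t" "t \<le> T"
  shows "nu t R - Cnu / (2 * s - 3/2) * R powr (3/2 - 2 * s) \<le> nu t N"
proof -
  let ?e = "2 * s - 3/2"
  let ?f = "\<lambda>x. nu t x - Cnu / ?e * x powr (3/2 - 2 * s)"
  have e: "0 < ?e" using s34 by simp
  have "?f R \<le> ?f N"
  proof (rule DERIV_nonneg_imp_nondecreasing[OF R(2)])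
    fix x assume x: "R \<le> x" "x \<le> N"
    have x0: "0 < x" using x R by linarith
    have "1 / x \<le> 1 / R" using x R by (intro frac_le) auto
    then have x\<eta>: "1 / x \<le> \<eta>" using R by linarith
    have "Cnu / u * ((- u) * y) = - (Cnu * y)" if "0 < u" for u y :: real using that by simp
    from this[OF e] have k: "Cnu / ?e * ((- ?e) * x powr (1/2 - 2 * s)) = - (Cnu * x powr (1/2 - 2 * s))" .
    have p: "3/2 - 2 * s - 1 = 1/2 - 2 * s" and m: "3/2 - 2 * s = - ?e" by simp_all
    have d: "(?f has_real_derivative nu' t x - Cnu / ?e * ((3/2 - 2 * s) * x powr (3/2 - 2 * s - 1))) (at x)"
      by (intro DERIV_diff nu_deriv DERIV_cmult has_real_derivative_powr x0)
    have "Cnu / ?e * ((3/2 - 2 * s) * x powr (3/2 - 2 * s - 1)) = - (Cnu * x powr (1/2 - 2 * s))"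
      by (simp only: p) (simp only: m k)
    moreover have "- Cnu * x powr (1/2 - 2 * s) \<le> nu' t x"
      by (rule nu'_lower[OF x0 x(2) x\<eta> t])
    ultimately have "0 \<le> nu' t x - Cnu / ?e * ((3/2 - 2 * s) * x powr (3/2 - 2 * s - 1))" by linarith
    with d show "\<exists>y. (?f has_real_derivative y) (at x) \<and> 0 \<le> y" by (intro exI conjI)
  qed
  moreover have "0 \<le> Cnu / ?e * N powr (3/2 - 2 * s)"
    using e t by (intro mult_nonneg_nonneg divide_nonneg_pos Cnu_nonneg) auto
  ultimately show ?thesis by linarith
qed

end

section \<open>Pigeonholing cross ratios into cells\<close>

lemma find_cell:
  fixes h u :: real
  assumes "0 \<le> u" "u \<le> real M * h" "0 < M"
  shows "\<exists>i<M. real i * h \<le> u \<and> u \<le> (real i + 1) * h"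
  using assms
proof (induction M)
  case (Suc M)
  show ?case
  proof (cases "real M * h \<le> u")
    case True
    then show ?thesis using Suc.prems by (intro exI[of _ M]) (simp add: algebra_simps)
  next
    case False
    then have "0 < M" using Suc.prems by (cases M) auto
    then have "\<exists>i<M. real i * h \<le> u \<and> u \<le> (real i + 1) * h" using Suc False by simp
    then show ?thesis using less_SucI by blast
  qed
qed simp

text \<open>Cells may overlap, for instance at endpoints; this only increases the sum over all
  cells, so the pigeonhole principle is unaffected.\<close>

lemma heavy_cell:
  fixes f :: "'a \<Rightarrow> real"
  assumes "finite Q" "0 < M" "\<And>q. q \<in> Q \<Longrightarrow> 0 \<le> f q" "\<And>q. q \<in> Q \<Longrightarrow> \<exists>i<M. C i q"
  shows "\<exists>i<M. sum f Q / real M \<le> sum f {q \<in> Q. C i q}"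
proof (rule ccontr)
  assume "\<not> ?thesis"
  then have *: "sum f {q \<in> Q. C i q} < sum f Q / real M" if "i < M" for i using that by auto
  have "f q \<le> (\<Sum>i<M. if C i q then f q else 0)" if q: "q \<in> Q" for q
  proof -
    obtain i where i: "i < M" "C i q" using assms(4)[OF q] by blast
    have "(if C i q then f q else 0) \<le> (\<Sum>i<M. if C i q then f q else 0)"
      using i assms(3)[OF q] by (intro member_le_sum) auto
    then show ?thesis using i by simp
  qed
  then have "sum f Q \<le> (\<Sum>q\<in>Q. \<Sum>i<M. if C i q then f q else 0)" by (rule sum_mono)
  also have "\<dots> = (\<Sum>i<M. sum f {q \<in> Q. C i q})"
    using assms(1) by (subst sum.swap) (simp add: sum.inter_filter)
  also have "\<dots> < (\<Sum>i<M. sum f Q / real M)"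
    using assms(2) * by (intro sum_strict_mono) auto
  also have "\<dots> = sum f Q" using assms(2) by simp
  finally show False by simp
qed

text \<open>The cross ratio in the projective coordinate \<open>1 / (z - a)\<close>, which sends
  \<open>a\<close> to infinity and turns it into an affine ratio of the other three points.\<close>

definition inv_ratio :: "real \<Rightarrow> real \<Rightarrow> real \<Rightarrow> real \<Rightarrow> real" where
  "inv_ratio a x y v = (1 / (x - a) - 1 / (v - a)) / (1 / (x - a) - 1 / (y - a))"

lemma inv_ratio_eq_cross_ratio:
  assumes "x \<noteq> a" "y \<noteq> a" "v \<noteq> a" "y \<noteq> x"
  shows "inv_ratio a x y v = (y - a) * (v - x) / ((y - x) * (v - a))"
proof -
  have e: "1 / p - 1 / q = (q - p) / (p * q)" if "p \<noteq> 0" "q \<noteq> 0" for p q :: real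
    using that by (simp add: field_simps)
  show ?thesis
    unfolding inv_ratio_def using assms by (subst (1 2) e) (simp_all add: mult.commute)
qed

context config
begin

text \<open>The ratio is 1 plus a quotient of two consecutive gaps in the coordinate
  \<open>1 / (z - a)\<close>, each between \<open>\<delta> / D^2\<close> and
  \<open>1 / \<delta>\<close>. The defect of the separated relation is the distance of
  \<open>t\<close> from the ratio times the first of these gaps, so the two are comparable.\<close>

lemma inv_ratio_range:
  assumes "a \<in> {l..r}" "x \<in> {p2..q2}" "y \<in> {p3..q3}" "v \<in> {p4..q4}"
  shows "1 + \<delta>^2 / D^2 \<le> inv_ratio a x y v" "inv_ratio a x y v \<le> 1 + D^2 / \<delta>^2"
    "1 / (v - a) - bphase t x y a = (t - inv_ratio a x y v) * (1 / (x - a) - 1 / (y - a))"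
    "\<delta> / D^2 \<le> 1 / (x - a) - 1 / (y - a)" "1 / (x - a) - 1 / (y - a) \<le> 1 / \<delta>"
proof -
  have a: "a \<in> {l'..r'}" using assms(1) \<eta> by auto
  have J: "x \<in> JJ" "y \<in> JJ" "v \<in> JJ" using assms by auto
  let ?A = "1 / (x - a) - 1 / (y - a)" and ?B = "1 / (y - a) - 1 / (v - a)"
  have dD: "0 < \<delta> / D^2" using \<delta> \<delta>D by simp
  show A: "\<delta> / D^2 \<le> ?A" using sep assms by (intro sep_lower a J) auto
  have B: "\<delta> / D^2 \<le> ?B" using sep assms by (intro sep_lower a J) auto
  show A': "?A \<le> 1 / \<delta>" using range_inv(2)[OF a J(1)] range_inv(1)[OF a J(2)] by linarith
  have B': "?B \<le> 1 / \<delta>" using range_inv(2)[OF a J(2)] range_inv(1)[OF a J(3)] by linarith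
  have A0: "0 < ?A" "0 < ?B" using A B dD by linarith+
  have e: "inv_ratio a x y v = 1 + ?B / ?A"
  proof -
    have "(X - V) / (X - Y) = 1 + (Y - V) / (X - Y)" if "X - Y \<noteq> 0" for X Y V :: real
      using that by (simp add: field_simps)
    from this[of "1 / (x - a)" "1 / (y - a)" "1 / (v - a)"] A0(1) show ?thesis
      unfolding inv_ratio_def by (simp only: less_imp_neq[THEN not_sym] simp_thms)
  qed
  have "(\<delta> / D^2) / (1 / \<delta>) \<le> ?B / ?A" using A0 A' B dD by (intro frac_le) auto
  then show "1 + \<delta>^2 / D^2 \<le> inv_ratio a x y v" unfolding e by (simp add: power2_eq_square)
  have "?B / ?A \<le> (1 / \<delta>) / (\<delta> / D^2)" using A B' dD \<delta> by (intro frac_le) auto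
  then show "inv_ratio a x y v \<le> 1 + D^2 / \<delta>^2" unfolding e by (simp add: power2_eq_square)
  show "1 / (v - a) - bphase t x y a = (t - inv_ratio a x y v) * ?A"
  proof -
    have "V - (t * Y - (t - 1) * X) = (t - (X - V) / (X - Y)) * (X - Y)" if "X - Y \<noteq> 0" for X Y V :: real
    proof -
      have "(X - V) / (X - Y) * (X - Y) = X - V" using that by simp
      then show ?thesis unfolding left_diff_distrib[of t] by (simp add: algebra_simps)
    qed
    from this[of "1 / (x - a)" "1 / (y - a)" "1 / (v - a)"] have
      "1 / (v - a) - (t * (1 / (y - a)) - (t - 1) * (1 / (x - a)))
        = (t - (1 / (x - a) - 1 / (v - a)) / ?A) * ?A" using A0(1) by linarith
    then show ?thesis
      unfolding inv_ratio_def bphase_def by simp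
  qed
qed

end

context masses
begin

abbreviation "Q \<equiv> P1 \<times> P4 \<times> PP"

text \<open>A quadruple is stored as \<open>(a, (v, (x, y)))\<close>, the fourth point in second
  place, following the nesting of the sums in \<open>nu\<close>.\<close>

definition "qw z = w1 (fst z) * (w4 (fst (snd z)) * wt (snd (snd z)))"
definition "qgap t z = gap t (fst z) (fst (snd z)) (snd (snd z))"
definition "qr z = inv_ratio (fst z) (fst (snd (snd z))) (snd (snd (snd z))) (fst (snd z))"

lemma finQ: "finite Q" using fin by simp

lemma qw_nonneg: "0 \<le> qw z"
  by (simp add: qw_def w wt_nonneg)

lemma nu_flat: "nu t R = (\<Sum>z\<in>Q. qw z * (R * exp (- ((R * qgap t z)^2) / 2)))"
  unfolding nu_def sum_distrib_left qw_def qgap_def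
  by (simp add: sum.cartesian_product case_prod_unfold mult.assoc)

lemma qw_sum: "sum qw Q = sum w1 P1 * (sum w4 P4 * (sum w2 P2 * sum w3 P3))"
  unfolding sum_product_pairs by (simp add: qw_def wt_def)

lemma qw_sum_le: "sum qw Q \<le> 1"
proof -
  have "sum w1 P1 * (sum w4 P4 * (sum w2 P2 * sum w3 P3)) \<le> 1 * (1 * (1 * 1))"
    using total w by (intro mult_mono mult_nonneg_nonneg sum_nonneg) auto
  then show ?thesis unfolding qw_sum by simp
qed

lemma Q_range:
  assumes "z \<in> Q"
  shows "1 + \<delta>^2 / D^2 \<le> qr z" "qr z \<le> 1 + D^2 / \<delta>^2" "\<bar>qgap t z\<bar> \<le> \<bar>t - qr z\<bar> * (1 / \<delta>)"
    "\<bar>t - qr z\<bar> * (\<delta> / D^2) \<le> \<bar>qgap t z\<bar>"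
proof -
  have m: "fst z \<in> {l..r}" "fst (snd (snd z)) \<in> {p2..q2}" "snd (snd (snd z)) \<in> {p3..q3}" "fst (snd z) \<in> {p4..q4}"
    using assms sub by auto
  note r = inv_ratio_range[OF m]
  show "1 + \<delta>^2 / D^2 \<le> qr z" "qr z \<le> 1 + D^2 / \<delta>^2" using r(1,2) by (simp_all add: qr_def)
  let ?A = "1 / (fst (snd (snd z)) - fst z) - 1 / (snd (snd (snd z)) - fst z)"
  have A: "0 < \<delta> / D^2" using \<delta> \<delta>D by simp
  have e: "\<bar>qgap t z\<bar> = \<bar>t - qr z\<bar> * ?A"
    using r(3)[of t] r(4) A unfolding qgap_def gap_def ph_def qr_def by (simp add: abs_mult)
  show "\<bar>qgap t z\<bar> \<le> \<bar>t - qr z\<bar> * (1 / \<delta>)" "\<bar>t - qr z\<bar> * (\<delta> / D^2) \<le> \<bar>qgap t z\<bar>"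
    unfolding e using r(4,5) by (intro mult_left_mono; simp)+
qed

text \<open>Some cell of ratios carries at least the average weight. If \<open>t\<close> lies in the
  same cell, all its quadruples satisfy \<open>\<bar>R * qgap t z\<bar> \<le> 1\<close>, so each
  kernel value is at least \<open>R * exp (- 1 / 2)\<close>.\<close>

lemma nu_on_cell:
  assumes \<tau>T: "\<tau> \<le> \<delta>^2 / D^2" "1 + D^2 / \<delta>^2 \<le> T" and M: "0 < M" and R: "0 < R"
  defines "h \<equiv> (T - (1 + \<tau>)) / real M"
  assumes hR: "h * (1 / \<delta>) * R \<le> 1"
  shows "\<exists>i<M. \<forall>t. 1 + \<tau> + real i * h \<le> t \<longrightarrow> t \<le> 1 + \<tau> + (real i + 1) * h
    \<longrightarrow> R * exp (- 1 / 2) * (sum qw Q / real M) \<le> nu t R"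
proof -
  let ?C = "\<lambda>i z. real i * h \<le> qr z - (1 + \<tau>) \<and> qr z - (1 + \<tau>) \<le> (real i + 1) * h"
  have cells: "\<exists>i<M. ?C i z" if "z \<in> Q" for z
  proof (rule find_cell[OF _ _ M])
    show "0 \<le> qr z - (1 + \<tau>)" using Q_range(1)[OF that] \<tau>T by linarith
    have "real M * h = T - (1 + \<tau>)" using M by (simp add: h_def)
    then show "qr z - (1 + \<tau>) \<le> real M * h" using Q_range(2)[OF that] \<tau>T by linarith
  qed
  obtain i where i: "i < M" "sum qw Q / real M \<le> sum qw {z \<in> Q. ?C i z}"
  proof -
    have "\<exists>i<M. sum qw Q / real M \<le> sum qw {z \<in> Q. ?C i z}"
      by (rule heavy_cell[OF finQ M]) (simp_all only: qw_nonneg cells)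
    then show thesis by (elim exE conjE) (rule that)
  qed
  show ?thesis
  proof (intro exI[of _ i] conjI i allI impI)
    fix t assume t: "1 + \<tau> + real i * h \<le> t" "t \<le> 1 + \<tau> + (real i + 1) * h"
    have expbd: "R * exp (- 1 / 2) \<le> R * exp (- ((R * qgap t z)^2) / 2)" if z: "z \<in> Q" "?C i z" for z
    proof -
      have "\<bar>t - qr z\<bar> \<le> h" using t z(2) by (simp add: algebra_simps abs_le_iff)
      then have "\<bar>t - qr z\<bar> * (1 / \<delta>) \<le> h * (1 / \<delta>)" using \<delta> by (intro mult_right_mono) auto
      then have "\<bar>qgap t z\<bar> \<le> h * (1 / \<delta>)" using Q_range(3)[OF z(1), of t] by linarith
      then have "\<bar>qgap t z\<bar> * R \<le> 1" using hR mult_right_mono[of "\<bar>qgap t z\<bar>" "h * (1 / \<delta>)" R] R by linarith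
      then have "\<bar>R * qgap t z\<bar> \<le> 1" using R by (simp add: abs_mult mult.commute)
      then have "(R * qgap t z)^2 \<le> 1" by (simp add: abs_square_le_1)
      then show ?thesis using R by simp
    qed
    have "R * exp (- 1 / 2) * (sum qw Q / real M) \<le> R * exp (- 1 / 2) * sum qw {z \<in> Q. ?C i z}"
      using i R by (intro mult_left_mono) auto
    also have "\<dots> = (\<Sum>z\<in>{z \<in> Q. ?C i z}. qw z * (R * exp (- 1 / 2)))"
      by (simp add: sum_distrib_left mult.commute)
    also have "\<dots> \<le> (\<Sum>z\<in>{z \<in> Q. ?C i z}. qw z * (R * exp (- ((R * qgap t z)^2) / 2)))"
    proof (rule sum_mono)
      fix z assume "z \<in> {z \<in> Q. ?C i z}"
      then have z: "z \<in> Q" "?C i z" by (simp_all only: mem_Collect_eq)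
      show "qw z * (R * exp (- 1 / 2)) \<le> qw z * (R * exp (- ((R * qgap t z)^2) / 2))"
        by (rule mult_left_mono[OF expbd[OF z] qw_nonneg])
    qed
    also have "\<dots> \<le> nu t R"
      unfolding nu_flat
    proof (rule sum_mono2[OF finQ])
      show "{z \<in> Q. ?C i z} \<subseteq> Q" by (rule Collect_restrict)
      show "0 \<le> qw z * (R * exp (- ((R * qgap t z)^2) / 2))" for z
        using qw_nonneg[of z] R by simp
    qed
    finally show "R * exp (- 1 / 2) * (sum qw Q / real M) \<le> nu t R" .
  qed
qed

text \<open>The total weight is at most 1, so some kernel value exceeds \<open>c\<close>. The crude
  inequality \<open>w \<le> exp w\<close> turns this into a bound for the gap that tends to 0 as
  \<open>N\<close> grows.\<close>

lemma nu_witness: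
  assumes N: "0 < N" and c: "0 < c" "c < nu t N"
  obtains z where "z \<in> Q" "(t - qr z)^2 \<le> 2 * D^4 / (c * \<delta>^2 * N)"
proof -
  have "\<exists>z\<in>Q. c < N * exp (- ((N * qgap t z)^2) / 2)"
  proof (rule ccontr)
    assume "\<not> ?thesis"
    then have le: "N * exp (- ((N * qgap t z)^2) / 2) \<le> c" if "z \<in> Q" for z
      using that by (meson not_less)
    have "nu t N \<le> (\<Sum>z\<in>Q. qw z * c)"
      unfolding nu_flat by (intro sum_mono mult_left_mono qw_nonneg le)
    also have "\<dots> = sum qw Q * c" by (simp add: sum_distrib_right)
    also have "\<dots> \<le> 1 * c" using qw_sum_le c by (intro mult_right_mono) auto
    finally show False using c by simp
  qed
  then obtain z where z: "z \<in> Q" "c < N * exp (- ((N * qgap t z)^2) / 2)" by blast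
  let ?g = "qgap t z" and ?w = "(N * qgap t z)^2 / 2"
  have w: "?w \<le> exp ?w" using exp_ge_add_one_self[of ?w] by linarith
  have "exp (- ((N * ?g)^2) / 2) * exp ?w = 1" by (simp flip: exp_add)
  moreover have "c * exp ?w < N * exp (- ((N * ?g)^2) / 2) * exp ?w" using z(2) by simp
  moreover have "c * ?w \<le> c * exp ?w"
    using c(1) w by (intro mult_left_mono) auto
  ultimately have "c * ?w \<le> N" by (simp add: mult.assoc)
  then have "?g^2 \<le> 2 / (c * N)" using N c(1) by (simp add: field_simps power2_eq_square)
  moreover have "(\<bar>t - qr z\<bar> * (\<delta> / D^2))^2 \<le> \<bar>?g\<bar>^2"
    using Q_range(4)[OF z(1), of t] \<delta> by (intro power_mono) auto
  then have "(t - qr z)^2 * (\<delta> / D^2)^2 \<le> ?g^2" by (simp only: power_mult_distrib power2_abs)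
  ultimately have "(t - qr z)^2 * (\<delta> / D^2)^2 \<le> 2 / (c * N)" by linarith
  moreover have "0 < (\<delta> / D^2)^2" using \<delta> \<delta>D by simp
  ultimately have "(t - qr z)^2 \<le> 2 / (c * N) / (\<delta> / D^2)^2" by (subst pos_le_divide_eq)
  also have "\<dots> = 2 * D^4 / (c * \<delta>^2 * N)" by (simp add: power_divide power2_eq_square power4_eq_xxxx ac_simps)
  finally show thesis using that z(1) by blast
qed

end

section \<open>The interval\<close>

context config
begin

text \<open>The order of quantifiers is the point: the number of cells, the threshold and the error
  constant precede the weights and \<open>N\<close>, and only the index of the good cell depends on
  them.\<close>

lemma exists_uniform_cells:
  assumes s34: "3/4 < s" "s < 1" and c: "0 < c"
    and \<tau>T: "\<tau> \<le> \<delta>^2 / D^2" "1 + D^2 / \<delta>^2 \<le> T" "1 + \<tau> \<le> T"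
  obtains M :: nat and N0 c1 where "0 < M" "0 < c1"
    "\<And>P1 P2 P3 P4 w1 w2 w3 w4 N. \<lbrakk>N0 \<le> N; 0 < N;
        masses l r \<eta> \<delta> D \<tau> p2 q2 p3 q3 p4 q4 P1 P2 P3 P4 w1 w2 w3 w4 s N;
        c \<le> sum w1 P1; c \<le> sum w2 P2; c \<le> sum w3 P3; c \<le> sum w4 P4\<rbrakk> \<Longrightarrow>
        \<exists>i<M. \<forall>t. 1 + \<tau> + real i * ((T - (1 + \<tau>)) / real M) \<le> t
            \<longrightarrow> t \<le> 1 + \<tau> + (real i + 1) * ((T - (1 + \<tau>)) / real M) \<longrightarrow>
          (\<exists>a\<in>P1. \<exists>x\<in>P2. \<exists>y\<in>P3. \<exists>v\<in>P4. (t - inv_ratio a x y v)^2 \<le> c1 / N)"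
proof -
  define W where "W = (T - (1 + \<tau>)) / \<delta>"
  \<comment> \<open>A lower bound for \<open>nu t R\<close> on the heavy cell that does not involve
    \<open>R\<close>: the number of cells grows like \<open>R\<close>, which cancels the factor
    \<open>R\<close> of the kernel. Hence \<open>R\<close> can afterwards be taken so large that the
    loss at finer scales stays below \<open>c0 / 4\<close>.\<close>
  define c0 where "c0 = exp (- 1 / 2) * c^4 / (W + 2)"
  define e where "e = 2 * s - 3/2"
  define Cn where "Cn = (CE s + CH s) / 2"
  have W: "0 \<le> W" using \<tau>T \<delta> by (simp add: W_def)
  have c0: "0 < c0" using c W by (simp add: c0_def)
  have e: "0 < e" using s34 by (simp add: e_def)
  have "((\<lambda>x. Cn / e * x powr (- e)) \<longlongrightarrow> Cn / e * 0) at_top"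
    by (intro tendsto_mult tendsto_const tendsto_neg_powr) (use e in \<open>auto simp: filterlim_ident\<close>)
  then have "eventually (\<lambda>x. Cn / e * x powr (- e) < c0 / 4) at_top"
    using c0 by (intro order_tendstoD(2)) auto
  moreover have "eventually (\<lambda>x. max 1 (1 / \<eta>) \<le> x) at_top" by (rule eventually_ge_at_top)
  ultimately have "eventually (\<lambda>x. Cn / e * x powr (- e) < c0 / 4 \<and> max 1 (1 / \<eta>) \<le> x) at_top"
    by (rule eventually_conj)
  then obtain R where R: "Cn / e * R powr (- e) < c0 / 4" "1 \<le> R" "1 / \<eta> \<le> R"
    by (auto dest!: eventually_happens)
  have R\<eta>: "1 / R \<le> \<eta>" using R \<eta> by (simp add: field_simps)
  \<comment> \<open>At least \<open>R * W\<close> cells, so that a cell has width at most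
    \<open>\<delta> / R\<close>; the \<open>+ 1\<close> keeps \<open>M\<close> positive, and
    \<open>1 \<le> R\<close> absorbs the rounding.\<close>
  define M where "M = nat \<lceil>R * W\<rceil> + 1"
  have M: "R * W \<le> real M" "real M \<le> R * (W + 2)"
  proof -
    have RW: "0 \<le> R * W" using R W by simp
    show "R * W \<le> real M" unfolding M_def using RW by linarith
    have "real M \<le> R * W + 2" unfolding M_def using RW by linarith
    then show "real M \<le> R * (W + 2)" using R by (simp add: algebra_simps)
  qed
  have M0: "0 < M" by (simp add: M_def)
  show thesis
  proof (rule that[of M "2 * D^4 / (c0 / 4 * \<delta>^2)" R])
    show "0 < M" by (rule M0)
    show "0 < 2 * D^4 / (c0 / 4 * \<delta>^2)" using c0 \<delta> \<delta>D by simp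
    fix P1 P2 P3 P4 w1 w2 w3 w4 N
    assume N: "R \<le> N" "0 < N"
      and ms: "masses l r \<eta> \<delta> D \<tau> p2 q2 p3 q3 p4 q4 P1 P2 P3 P4 w1 w2 w3 w4 s N"
      and cw: "c \<le> sum w1 P1" "c \<le> sum w2 P2" "c \<le> sum w3 P3" "c \<le> sum w4 P4"
    interpret masses l r \<eta> \<delta> D \<tau> T p2 q2 p3 q3 p4 q4 P1 P2 P3 P4 w1 w2 w3 w4 s N
      by (rule ms)
    let ?h = "(T - (1 + \<tau>)) / real M"
    have "?h * (1 / \<delta>) * R = R * W / real M" by (simp add: W_def ac_simps)
    also have "\<dots> \<le> 1" using M M0 by simp
    finally have hR: "?h * (1 / \<delta>) * R \<le> 1" .
    have R0: "0 < R" using R by simp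
    obtain i where i: "i < M" "\<And>t. 1 + \<tau> + real i * ?h \<le> t \<Longrightarrow> t \<le> 1 + \<tau> + (real i + 1) * ?h
        \<Longrightarrow> R * exp (- 1 / 2) * (sum qw Q / real M) \<le> nu t R"
      using nu_on_cell[OF \<tau>T(1,2) M0 R0 hR] by blast
    have c4: "c^4 \<le> sum qw Q"
    proof -
      have "c * (c * (c * c)) \<le> sum w1 P1 * (sum w4 P4 * (sum w2 P2 * sum w3 P3))"
        using c cw w by (intro mult_mono mult_nonneg_nonneg sum_nonneg) auto
      then show ?thesis unfolding qw_sum by (simp add: power4_eq_xxxx mult.assoc)
    qed
    have "c0 = R * exp (- 1 / 2) * (c^4 / (R * (W + 2)))" using R0 by (simp add: c0_def)
    also have "\<dots> \<le> R * exp (- 1 / 2) * (sum qw Q / real M)"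
      using c4 c M M0 R0 sum_nonneg[of Q qw] qw_nonneg by (intro mult_left_mono frac_le) auto
    finally have low: "c0 \<le> R * exp (- 1 / 2) * (sum qw Q / real M)" .
    show "\<exists>i<M. \<forall>t. 1 + \<tau> + real i * ?h \<le> t \<longrightarrow> t \<le> 1 + \<tau> + (real i + 1) * ?h \<longrightarrow>
          (\<exists>a\<in>P1. \<exists>x\<in>P2. \<exists>y\<in>P3. \<exists>v\<in>P4. (t - inv_ratio a x y v)^2 \<le> 2 * D^4 / (c0 / 4 * \<delta>^2) / N)"
    proof (intro exI[of _ i] conjI i(1) allI impI)
      fix t assume t: "1 + \<tau> + real i * ?h \<le> t" "t \<le> 1 + \<tau> + (real i + 1) * ?h"
      have h0: "0 \<le> ?h" using \<tau>T by simp
      have "(real i + 1) * ?h \<le> real M * ?h" using i(1) h0 by (intro mult_right_mono) auto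
      also have "\<dots> = T - (1 + \<tau>)" using M0 by simp
      finally have tT: "t \<le> T" using t(2) by linarith
      have "0 \<le> real i * ?h" by (rule mult_nonneg_nonneg[OF _ h0]) simp
      then have t\<tau>: "1 + \<tau> \<le> t" using t(1) by linarith
      have "nu t R - Cnu / (2 * s - 3/2) * R powr (3/2 - 2 * s) \<le> nu t N"
        by (rule nu_lower[OF s34(1) R0 N(1) R\<eta> t\<tau> tT])
      moreover have "Cnu / (2 * s - 3/2) * R powr (3/2 - 2 * s) = Cn / e * R powr (- e)"
        by (simp add: Cnu_def Cn_def e_def)
      ultimately have large: "c0 / 4 < nu t N" using i(2)[OF t] low R(1) c0 by linarith
      have "0 < c0 / 4" using c0 by simp
      then obtain z where z: "z \<in> Q" "(t - qr z)^2 \<le> 2 * D^4 / (c0 / 4 * \<delta>^2 * N)"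
        by (rule nu_witness[OF N(2) _ large])
      then show "\<exists>a\<in>P1. \<exists>x\<in>P2. \<exists>y\<in>P3. \<exists>v\<in>P4. (t - inv_ratio a x y v)^2 \<le> 2 * D^4 / (c0 / 4 * \<delta>^2) / N"
        unfolding qr_def by (intro bexI[of _ "fst z"] bexI[of _ "fst (snd (snd z))"]
          bexI[of _ "snd (snd (snd z))"] bexI[of _ "fst (snd z)"]) auto
    qed
  qed
qed

end

text \<open>Indices at distance two leave an empty cell of length \<open>h\<close> between
  consecutive pieces. Three quarters of it pay for \<open>2 * \<eta> + \<delta>\<close> next to the
  first piece.\<close>

lemma separated_config:
  fixes k :: nat and m1 m2 m3 m4 :: int
  assumes "m1 + 2 \<le> m2" "m2 + 2 \<le> m3" "m3 + 2 \<le> m4"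
  defines "h \<equiv> 1 / 2 ^ k"
  defines "lo \<equiv> \<lambda>m. real_of_int m * h" and "hi \<equiv> \<lambda>m. (real_of_int m + 1) * h"
  assumes "0 < \<tau>"
  shows "config (lo m1) (hi m1) (h / 4) (h / 4) (hi m4 - lo m1 + h) \<tau> (lo m2) (hi m2) (lo m3) (hi m3) (lo m4) (hi m4)"
proof -
  have h: "0 < h" by (simp add: h_def)
  have gap: "hi m + h \<le> lo m'" if "m + 2 \<le> m'" for m m' :: int
  proof -
    have "(real_of_int m + 2) * h \<le> real_of_int m' * h"
      using that h by (intro mult_right_mono) auto
    then show ?thesis by (simp add: hi_def lo_def algebra_simps)
  qed
  have lh: "lo m \<le> hi m" for m using h by (simp add: lo_def hi_def algebra_simps)
  show ?thesis
    using h gap[OF assms(1)] gap[OF assms(2)] gap[OF assms(3)] lh assms(7) by unfold_locales simp_all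
qed

lemma dyadic_subset: "dyadic k m \<subseteq> {real_of_int m * (1 / 2 ^ k)..(real_of_int m + 1) * (1 / 2 ^ k)}"
  by (auto simp: dyadic_iff)

lemma compact_inv_ratio_image:
  assumes "compact A1" "compact A2" "compact A3" "compact A4"
    and "\<And>a x y v. a \<in> A1 \<Longrightarrow> x \<in> A2 \<Longrightarrow> y \<in> A3 \<Longrightarrow> v \<in> A4 \<Longrightarrow> a < x \<and> x < y \<and> y < v"
  shows "closed ((\<lambda>(a, x, y, v). inv_ratio a x y v) ` (A1 \<times> A2 \<times> A3 \<times> A4))"
proof (intro compact_imp_closed compact_continuous_image compact_Times assms)
  have "fst (snd z) - fst z \<noteq> 0" "fst (snd (snd z)) - fst z \<noteq> 0" "snd (snd (snd z)) - fst z \<noteq> 0"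
    "1 / (fst (snd z) - fst z) - 1 / (fst (snd (snd z)) - fst z) \<noteq> 0" if "z \<in> A1 \<times> A2 \<times> A3 \<times> A4" for z
    using assms(5)[of "fst z" "fst (snd z)" "fst (snd (snd z))" "snd (snd (snd z))"] that by auto
  then show "continuous_on (A1 \<times> A2 \<times> A3 \<times> A4) (\<lambda>(a, x, y, v). inv_ratio a x y v)"
    unfolding case_prod_unfold inv_ratio_def by (intro continuous_intros) blast+
qed

theorem theorem1p4:
  fixes E :: "real set"
  assumes "compact E"
    and "hausdorff_dim E > 3/4"
  shows "\<exists>a b. a < b \<and> {a<..<b} \<subseteq>
           {(x3 - x1) * (x4 - x2) / ((x3 - x2) * (x4 - x1)) | x1 x2 x3 x4.
              x1 \<in> E \<and> x2 \<in> E \<and> x3 \<in> E \<and> x4 \<in> E \<and> (x3 - x2) * (x4 - x1) \<noteq> 0}"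
    (is "\<exists>a b. a < b \<and> {a<..<b} \<subseteq> ?S")
proof (rule ccontr)
  assume none: "\<nexists>a b. a < b \<and> {a<..<b} \<subseteq> ?S"
  \<comment> \<open>Strictly between 3/4 and both the dimension and 1; the latter is required by the
    energy estimate.\<close>
  define s where "s = (3/4 + min (hausdorff_dim E) 1) / 2"
  have s: "3/4 < s" "s < 1" "s < hausdorff_dim E" using assms(2) by (auto simp: s_def)
  have "hausdorff_measure s E \<noteq> 0"
  proof
    assume "hausdorff_measure s E = 0"
    then have "hausdorff_dim E \<le> s"
      unfolding hausdorff_dim_def using s by (intro cInf_lower bdd_belowI[of _ 0]) auto
    then show False using s by simp
  qed
  then obtain c' where c': "0 < c'" "fat s c' E"
    using fat_if_hausdorff_measure_nonzero[of s E] s by auto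
  have s0: "0 < s" using s by simp
  obtain k c m1 m2 m3 m4 where c: "0 < c" and m: "m1 + 2 \<le> m2" "m2 + 2 \<le> m3" "m3 + 2 \<le> m4"
    and fat: "fat s c (E \<inter> dyadic k m1)" "fat s c (E \<inter> dyadic k m2)" "fat s c (E \<inter> dyadic k m3)" "fat s c (E \<inter> dyadic k m4)"
    by (rule four_fat_pieces[OF compact_imp_bounded[OF assms(1)] c'(2,1) s0]) (rule that)
  define h :: real where "h = 1 / 2 ^ k"
  define lo where "lo m = real_of_int m * h" for m
  define hi where "hi m = (real_of_int m + 1) * h" for m
  define D where "D = hi m4 - lo m1 + h"
  define \<tau> where "\<tau> = (h / 4)^2 / D^2"
  \<comment> \<open>One more than the upper bound for the ratios, so that
    \<open>1 + \<tau> < T\<close> and the cells have positive length.\<close>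
  define T where "T = 2 + D^2 / (h / 4)^2"
  have h: "0 < h" by (simp add: h_def)
  have Dh: "h / 4 \<le> D"
  proof -
    have "real_of_int m1 * h \<le> (real_of_int m4 + 1) * h" using m h by (intro mult_right_mono) auto
    then show ?thesis using h by (simp add: D_def lo_def hi_def)
  qed
  have \<tau>: "0 < \<tau>" using h Dh by (simp add: \<tau>_def)
  have "\<tau> \<le> 1" unfolding \<tau>_def using Dh h by (simp add: power_mono divide_le_eq_1)
  moreover have "0 < D^2 / (h / 4)^2" using h Dh by simp
  ultimately have T: "1 + \<tau> < T" by (simp add: T_def)
  interpret cfg: config "lo m1" "hi m1" "h / 4" "h / 4" D \<tau> T "lo m2" "hi m2" "lo m3" "hi m3" "lo m4" "hi m4"
    using separated_config[OF m \<tau>, of k] unfolding D_def lo_def hi_def h_def .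
  obtain M :: nat and N0 c1 where M: "0 < M" and c1: "0 < c1" and cells:
    "\<And>P1 P2 P3 P4 w1 w2 w3 w4 N. \<lbrakk>N0 \<le> N; 0 < N;
        masses (lo m1) (hi m1) (h / 4) (h / 4) D \<tau> (lo m2) (hi m2) (lo m3) (hi m3) (lo m4) (hi m4) P1 P2 P3 P4 w1 w2 w3 w4 s N;
        c \<le> sum w1 P1; c \<le> sum w2 P2; c \<le> sum w3 P3; c \<le> sum w4 P4\<rbrakk> \<Longrightarrow>
        \<exists>i<M. \<forall>t. 1 + \<tau> + real i * ((T - (1 + \<tau>)) / real M) \<le> t
            \<longrightarrow> t \<le> 1 + \<tau> + (real i + 1) * ((T - (1 + \<tau>)) / real M) \<longrightarrow>
          (\<exists>a\<in>P1. \<exists>x\<in>P2. \<exists>y\<in>P3. \<exists>v\<in>P4. (t - inv_ratio a x y v)^2 \<le> c1 / N)"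
  proof (rule cfg.exists_uniform_cells[OF s(1,2) c])
    show "\<tau> \<le> (h / 4)^2 / D^2" by (simp add: \<tau>_def)
    show "1 + D^2 / (h / 4)^2 \<le> T" by (simp add: T_def)
    show "1 + \<tau> \<le> T" using T by simp
  qed (use that in blast)
  define g where "g = (T - (1 + \<tau>)) / real M"
  have g: "0 < g" using T M by (simp add: g_def)
  let ?lo = "\<lambda>i::nat. 1 + \<tau> + real i * g" and ?hi = "\<lambda>i::nat. 1 + \<tau> + (real i + 1) * g"
  \<comment> \<open>One point outside the set of cross ratios is fixed in every cell, since it is
    not yet known which cell will be heavy.\<close>
  have "\<exists>t. t \<in> {?lo i<..<?hi i} \<and> t \<notin> ?S" for i
  proof -
    have "?lo i < ?hi i" using g by (simp add: algebra_simps)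
    then have "\<not> {?lo i<..<?hi i} \<subseteq> ?S" using none by blast
    then show ?thesis unfolding subset_iff not_all not_imp .
  qed
  then have "\<exists>tt. \<forall>i. tt i \<in> {?lo i<..<?hi i} \<and> tt i \<notin> ?S"
    by (intro choice allI)
  then obtain tt where "\<forall>i. tt i \<in> {?lo i<..<?hi i} \<and> tt i \<notin> ?S"
    by (rule exE)
  note tt = conjunct1[OF spec[OF this]] conjunct2[OF spec[OF this]]
  define A where "A m = E \<inter> {lo m..hi m}" for m
  have cA: "compact (A m)" for m unfolding A_def using assms(1) by (intro compact_Int) auto
  have gap: "hi m < lo m'" if "m + 2 \<le> m'" for m m' :: int
  proof -
    have "(real_of_int m + 1) * h < real_of_int m' * h" using that h by (intro mult_strict_right_mono) auto
    then show ?thesis by (simp add: hi_def lo_def)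
  qed
  have ord: "a < x \<and> x < y \<and> y < v" if "a \<in> A m1" "x \<in> A m2" "y \<in> A m3" "v \<in> A m4" for a x y v
    using that gap[OF m(1)] gap[OF m(2)] gap[OF m(3)] by (auto simp: A_def)
  let ?C = "(\<lambda>(a, x, y, v). inv_ratio a x y v) ` (A m1 \<times> A m2 \<times> A m3 \<times> A m4)"
  have "closed ?C" by (rule compact_inv_ratio_image[OF cA cA cA cA ord])
  have CS: "?C \<subseteq> ?S"
  proof clarify
    fix a x y v assume z: "a \<in> A m1" "x \<in> A m2" "y \<in> A m3" "v \<in> A m4"
    then have "inv_ratio a x y v = (y - a) * (v - x) / ((y - x) * (v - a))" "(y - x) * (v - a) \<noteq> 0"
      using ord[OF z] by (auto intro!: inv_ratio_eq_cross_ratio)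
    moreover have "a \<in> E" "x \<in> E" "y \<in> E" "v \<in> E" using z by (auto simp: A_def)
    ultimately show "\<exists>x1 x2 x3 x4. inv_ratio a x y v = (x3 - x1) * (x4 - x2) / ((x3 - x2) * (x4 - x1)) \<and>
        x1 \<in> E \<and> x2 \<in> E \<and> x3 \<in> E \<and> x4 \<in> E \<and> (x3 - x2) * (x4 - x1) \<noteq> 0" by blast
  qed
  have "\<exists>\<epsilon>>0. \<forall>y\<in>?C. \<epsilon> \<le> dist (tt i) y" for i
    using separate_point_closed[OF \<open>closed ?C\<close>, of "tt i"] tt(2)[of i] CS by blast
  then obtain \<epsilon> where \<epsilon>: "\<And>i. 0 < \<epsilon> i" "\<And>i y. y \<in> ?C \<Longrightarrow> \<epsilon> i \<le> dist (tt i) y" by metis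
  \<comment> \<open>The compact image misses all these points; as there are finitely many cells, one
    distance serves for all of them.\<close>
  define \<epsilon>0 where "\<epsilon>0 = Min (\<epsilon> ` {..<M})"
  have \<epsilon>0: "0 < \<epsilon>0" "\<And>i. i < M \<Longrightarrow> \<epsilon>0 \<le> \<epsilon> i"
  proof -
    have "{..<M} \<noteq> {}" using M by (simp add: lessThan_empty_iff)
    then show "0 < \<epsilon>0" unfolding \<epsilon>0_def using \<epsilon>(1) by (subst Min_gr_iff) auto
    show "\<epsilon>0 \<le> \<epsilon> i" if "i < M" for i unfolding \<epsilon>0_def using that by (intro Min_le) auto
  qed
  obtain n1 where n1: "max N0 (c1 / \<epsilon>0^2) < 2 ^ n1" using real_arch_pow[of 2 "max N0 (c1 / \<epsilon>0^2)"] by (auto simp del: max_less_iff_conj)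
  \<comment> \<open>Only here is the scale of the weights fixed: fine enough that the approximation
    error \<open>c1 / N\<close> is below \<open>\<epsilon>0^2\<close>, and at least the level
    \<open>k\<close> of the pieces.\<close>
  define n where "n = max n1 k"
  define N :: real where "N = 2 ^ n"
  have "(2::real) ^ n1 \<le> N" by (simp add: N_def n_def)
  moreover have "N0 < 2 ^ n1" "c1 / \<epsilon>0^2 < 2 ^ n1" using n1 by simp_all
  ultimately have N: "N0 \<le> N" "c1 / \<epsilon>0^2 < N" by linarith+
  have N_pos: "0 < N" by (simp add: N_def)
  have kn: "k \<le> n" by (simp add: n_def)
  have s1: "s \<le> 1" using s by simp
  note frost = discrete_frostman[OF _ s0 s1 kn]
  obtain P1 w1 where F1: "finite P1" "P1 \<subseteq> E \<inter> dyadic k m1" "\<And>p. 0 \<le> w1 p" "c \<le> sum w1 P1" "sum w1 P1 \<le> 1"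
    "\<And>x r. 1 / 2 ^ n \<le> r \<Longrightarrow> sum w1 {p \<in> P1. \<bar>p - x\<bar> \<le> r} \<le> 6 * r powr s"
    using frost[OF fat(1)] by blast
  obtain P2 w2 where F2: "finite P2" "P2 \<subseteq> E \<inter> dyadic k m2" "\<And>p. 0 \<le> w2 p" "c \<le> sum w2 P2" "sum w2 P2 \<le> 1"
    "\<And>x r. 1 / 2 ^ n \<le> r \<Longrightarrow> sum w2 {p \<in> P2. \<bar>p - x\<bar> \<le> r} \<le> 6 * r powr s"
    using frost[OF fat(2)] by blast
  obtain P3 w3 where F3: "finite P3" "P3 \<subseteq> E \<inter> dyadic k m3" "\<And>p. 0 \<le> w3 p" "c \<le> sum w3 P3" "sum w3 P3 \<le> 1"
    "\<And>x r. 1 / 2 ^ n \<le> r \<Longrightarrow> sum w3 {p \<in> P3. \<bar>p - x\<bar> \<le> r} \<le> 6 * r powr s"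
    using frost[OF fat(3)] by blast
  obtain P4 w4 where F4: "finite P4" "P4 \<subseteq> E \<inter> dyadic k m4" "\<And>p. 0 \<le> w4 p" "c \<le> sum w4 P4" "sum w4 P4 \<le> 1"
    "\<And>x r. 1 / 2 ^ n \<le> r \<Longrightarrow> sum w4 {p \<in> P4. \<bar>p - x\<bar> \<le> r} \<le> 6 * r powr s"
    using frost[OF fat(4)] by blast
  have EA: "E \<inter> dyadic k m \<subseteq> A m" for m
    using dyadic_subset[of k m] unfolding A_def lo_def hi_def h_def by blast
  have PA: "P1 \<subseteq> A m1" "P2 \<subseteq> A m2" "P3 \<subseteq> A m3" "P4 \<subseteq> A m4"
    using F1(2) F2(2) F3(2) F4(2) EA by blast+
  then have PI: "P1 \<subseteq> {lo m1..hi m1}" "P2 \<subseteq> {lo m2..hi m2}" "P3 \<subseteq> {lo m3..hi m3}" "P4 \<subseteq> {lo m4..hi m4}"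
    unfolding A_def by blast+
  have "masses (lo m1) (hi m1) (h / 4) (h / 4) D \<tau> (lo m2) (hi m2) (lo m3) (hi m3) (lo m4) (hi m4) P1 P2 P3 P4 w1 w2 w3 w4 s N"
    unfolding N_def by unfold_locales (fact F1 F2 F3 F4 PI s0 s(2))+
  from cells[OF N(1) N_pos this F1(4) F2(4) F3(4) F4(4)]
  obtain i where i: "i < M" "\<And>t. ?lo i \<le> t \<Longrightarrow> t \<le> ?hi i \<Longrightarrow>
      \<exists>a\<in>P1. \<exists>x\<in>P2. \<exists>y\<in>P3. \<exists>v\<in>P4. (t - inv_ratio a x y v)^2 \<le> c1 / N"
    unfolding g_def[symmetric] by blast
  have "?lo i \<le> tt i" "tt i \<le> ?hi i" using tt(1)[of i] by simp_all
  from i(2)[OF this] obtain a x y v where z: "a \<in> P1" "x \<in> P2" "y \<in> P3" "v \<in> P4"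
    "(tt i - inv_ratio a x y v)^2 \<le> c1 / N" by blast
  have "inv_ratio a x y v \<in> ?C" using z PA by force
  from \<epsilon>(2)[OF this, of i] have "\<epsilon>0 \<le> \<bar>tt i - inv_ratio a x y v\<bar>"
    using \<epsilon>0(2)[OF i(1)] by (simp add: dist_real_def)
  then have "\<epsilon>0^2 \<le> \<bar>tt i - inv_ratio a x y v\<bar>^2" using \<epsilon>0(1) by (intro power_mono) auto
  then have "\<epsilon>0^2 \<le> c1 / N" using z(5) by simp
  moreover have "c1 / N < \<epsilon>0^2" using N(2) N_pos \<epsilon>0(1) by (simp add: field_simps)
  ultimately show False by simp
qed

end
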